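(* Let $(M,\tau)$ be a tracial von Neumann algebra generated by a unital von Neumann subalgebra $B\le M$ and a tuple of self-adjoint operators $\mathbf{x}=(x_i)_{i\in I}$ in $M$, with $I$ countable, and let $\eta$ be a $\tau$-symmetric covariance matrix on $B$ indexed by $I$. Let $i\in I$. Then $\xi_i\in L^2(M,\tau)$ is the $i$-th $(B,\eta)$-conjugate variable for $\mathbf{x}$ if and only if for all $b,b_1,b_2,\ldots\in B$ and $j,i_1,i_2,\ldots\in I$ one has $$\begin{cases}\kappa_B^{(1)}(\xi_i b)=0,\\ \kappa_B^{(2)}(\xi_i\otimes bx_j)=\eta_{ij}(b),\\ \kappa_B^{(d+1)}(\xi_i\otimes b_1x_{i_1}\otimes\cdots\otimes b_dx_{i_d})=0\quad\text{for all } d\ge 2.\end{cases}$$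
   Context: A tracial von Neumann algebra $(M,\tau)$ is a von Neumann algebra $M$ with a faithful normal tracial state $\tau$. $L^2(M,\tau)$ is the GNS Hilbert space with $\langle a,b\rangle_\tau=\tau(a^*b)$. $E_B:M\to B$ is the unique $\tau$-preserving faithful normal conditional expectation. $B\langle\mathbf{x}\rangle$ is the $*$-algebra generated by $B$ and $\{x_i:i\in I\}$; that $M$ is generated by $B$ and $\mathbf{x}$ means $M=B\langle\mathbf{x}\rangle''$. Covariance matrices. A covariance matrix on $B$ is a normal completely positive map $\eta:B\to B\otimes B(\ell^2(I))$ of the form $\eta(b)=\sum_{i,j\in I}\eta_{ij}(b)\otimes e_{ij}$ ($\sigma$-weak convergence), where $\eta_{ij}:B\to B$ are linear and $(e_{ij})$ are matrix units of $B(\ell^2(I))$. It is extended to $M$ by $\eta_{ij}:=\eta_{ij}\circ E_B:M\to B$. It is $\tau$-symmetric if $\tau(\eta_{ij}(a)b)=\tau(a\,\eta_{ji}(b))$ for all $a,b\in B$, $i,j\in I$. Conjugate variables. A vector $\xi_i\in L^2(M,\tau)$ is the $i$-th $(B,\eta)$-conjugate variable for $\mathbf{x}$ if for all $d\ge 0$, $j_1,\dots,j_d\in I$ and $b_0,\dots,b_d\in B$, $$\langle \xi_i, b_0x_{j_1}b_1\cdots x_{j_d}b_d\rangle_\tau=\sum_{k=1}^d\tau\big(\eta_{ij_k}(b_0x_{j_1}\cdots x_{j_{k-1}}b_{k-1})\,E_B(b_kx_{j_{k+1}}\cdots x_{j_d}b_d)\big)$$ (for $d=0$ the right-hand side is $0$).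 $B$-valued cumulants. Let $NC(d)$ be the set of non-crossing partitions of $\{1,\dots,d\}$ and let $\otimes$ denote the algebraic tensor product over $B$. The cumulants $\kappa_B^{(d)}:M^{\otimes_B d}\to B$, $d\ge1$, are the $B$-$B$-bimodule maps determined inductively by the moment-cumulant formula $$E_B(a_1\cdots a_d)=\sum_{\pi\in NC(d)}\kappa_B(\pi)[a_1\otimes\cdots\otimes a_d],$$ where $\kappa_B(\pi)$ is defined recursively: if $\pi=\pi_1\cup\{V\}$ with $V=\{k,k+1,\dots,l\}$ an interval block, then $\kappa_B(\pi)[a_1\otimes\cdots\otimes a_d]=\kappa_B(\pi_1)[a_1\otimes\cdots\otimes a_{k-1}\,\kappa_B^{(l-k+1)}(a_k\otimes\cdots\otimes a_l)\otimes a_{l+1}\otimes\cdots\otimes a_d]$ (if $k=1<l+1\le d$ the value is multiplied on the left of $a_{l+1}$; if $\pi$ has the single block $\{1,\dots,d\}$ then $\kappa_B(\pi)=\kappa_B^{(d)}$). Extension to $L^2$. $E_B$ extends to a bounded $B$-bimodular map $L^2(M,\tau)\to L^2(B,\tau)$, so the moments $E_B(a_1\cdots a_d)$ make sense (with values in $L^2(B,\tau)$) when one entry lies in $L^2(M,\tau)$ and the others in $M$; via the same moment-cumulant formula, each $\kappa_B^{(d)}$ is extended to allow one entry from $L^2(M,\tau)$, with values in $L^2(B,\tau)$. *)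

theory Defs
  imports "HOL-Analysis.Analysis" "HOL-Library.Disjoint_Sets"
begin

section \<open>Complex Hilbert spaces\<close>

text \<open>The inner product is linear in the second argument, matching \<open>\<langle>a, b\<rangle> = \<tau>(a\<^sup>* b)\<close>.\<close>

class complex_hilbert_space = banach +
  fixes cscale :: "complex \<Rightarrow> 'a \<Rightarrow> 'a"
    and cinner :: "'a \<Rightarrow> 'a \<Rightarrow> complex"
  assumes cscale_add_right: "cscale c (x + y) = cscale c x + cscale c y"
    and cscale_add_left: "cscale (c + d) x = cscale c x + cscale d x"
    and cscale_cscale: "cscale c (cscale d x) = cscale (c * d) x"
    and cscale_of_real: "cscale (of_real r) x = r *\<^sub>R x"
    and cinner_commute: "cinner x y = cnj (cinner y x)"
    and cinner_add_right: "cinner x (y + z) = cinner x y + cinner x z"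
    and cinner_cscale_right: "cinner x (cscale c y) = c * cinner x y"
    and cinner_self: "cinner x x = of_real ((norm x)\<^sup>2)"

lemma cinner_add_left: "cinner (x + y) z = cinner x z + cinner y (z::'a::complex_hilbert_space)"
  by (metis cinner_add_right cinner_commute complex_cnj_add)

lemma cinner_cscale_left: "cinner (cscale c x) (y::'a::complex_hilbert_space) = cnj c * cinner x y"
  by (metis cinner_commute cinner_cscale_right complex_cnj_mult)

lemma cscale_scaleR: "cscale c (r *\<^sub>R x) = r *\<^sub>R cscale c (x::'a::complex_hilbert_space)"
  by (metis cscale_of_real cscale_cscale mult.commute)

lemma norm_cscale: "norm (cscale c (x::'a::complex_hilbert_space)) = cmod c * norm x"
proof -
  have "complex_of_real ((norm (cscale c x))\<^sup>2) = cnj c * (c * of_real ((norm x)\<^sup>2))"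
    by (simp add: cinner_self[symmetric] cinner_cscale_left cinner_cscale_right mult.left_commute del: of_real_power)
  also have "\<dots> = of_real ((cmod c * norm x)\<^sup>2)"
    using complex_norm_square[of c] by (simp add: power_mult_distrib mult_ac)
  finally have "(norm (cscale c x))\<^sup>2 = (cmod c * norm x)\<^sup>2"
    using of_real_eq_iff by blast
  then show ?thesis by (simp add: power2_eq_iff_nonneg)
qed

lemma cmod_cinner_le: "cmod (cinner x (y::'a::complex_hilbert_space)) \<le> (norm x)\<^sup>2 + (norm y)\<^sup>2"
proof (cases "cinner x y = 0")
  case False
  define c where "c = - cnj (cinner x y) / of_real (cmod (cinner x y))"
  have c1: "cmod c = 1" using False by (simp add: c_def norm_divide)
  have cc: "cnj c * c = 1" using complex_norm_square[of c] c1 by (simp add: mult.commute)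
  have ci: "c * cinner x y = - of_real (cmod (cinner x y))"
    using False complex_norm_square[of "cinner x y"]
    by (simp add: c_def field_simps power2_eq_square)
  have ci': "cnj c * cinner y x = - of_real (cmod (cinner x y))"
    using arg_cong[OF ci, of cnj] cinner_commute[of y x] by simp
  have "complex_of_real ((norm (x + cscale c y))\<^sup>2)
      = cinner x x + c * cinner x y + (cnj c * cinner y x + cnj c * c * cinner y y)"
    by (simp only: cinner_self[symmetric] cinner_add_left cinner_add_right
        cinner_cscale_left cinner_cscale_right algebra_simps)
  also have "\<dots> = of_real ((norm x)\<^sup>2 + (norm y)\<^sup>2 - 2 * cmod (cinner x y))"
    by (simp add: ci ci' cc cinner_self)
  finally have "(norm (x + cscale c y))\<^sup>2 = (norm x)\<^sup>2 + (norm y)\<^sup>2 - 2 * cmod (cinner x y)"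
    using of_real_eq_iff by blast
  moreover have "(norm (x + cscale c y))\<^sup>2 \<ge> 0" by simp
  ultimately have "2 * cmod (cinner x y) \<le> (norm x)\<^sup>2 + (norm y)\<^sup>2" by linarith
  then show ?thesis using norm_ge_zero[of "cinner x y"] by linarith
qed simp

instantiation complex :: complex_hilbert_space
begin

definition cscale_complex :: "complex \<Rightarrow> complex \<Rightarrow> complex" where "cscale_complex = (*)"
definition cinner_complex :: "complex \<Rightarrow> complex \<Rightarrow> complex" where "cinner_complex x y = cnj x * y"

instance
  by standard
    (simp_all add: cscale_complex_def cinner_complex_def algebra_simps scaleR_conv_of_real
      complex_norm_square[symmetric] mult.commute del: of_real_power)

end

section \<open>The Hilbert space of square-summable families\<close>

text \<open>\<open>('i, 'h) ell2\<close> is \<open>\<ell>\<^sup>2(I; H)\<close>, i.e. \<open>H \<otimes> \<ell>\<^sup>2(I)\<close>.\<close>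

typedef (overloaded) ('i, 'h) ell2 =
  "{f :: 'i \<Rightarrow> 'h::complex_hilbert_space. (\<lambda>i. (norm (f i))\<^sup>2) summable_on UNIV}"
  by (rule exI[of _ "\<lambda>_. 0"]) simp

setup_lifting type_definition_ell2

lemma sq_summable_iff:
  "(\<lambda>i. (norm (f i :: 'h::real_normed_vector))\<^sup>2) summable_on UNIV
    \<longleftrightarrow> (\<exists>C. \<forall>F. finite F \<longrightarrow> L2_set (\<lambda>i. norm (f i)) F \<le> C)"
proof
  assume s: "(\<lambda>i. (norm (f i))\<^sup>2) summable_on UNIV"
  show "\<exists>C. \<forall>F. finite F \<longrightarrow> L2_set (\<lambda>i. norm (f i)) F \<le> C"
    by (rule exI[of _ "sqrt (infsum (\<lambda>i. (norm (f i))\<^sup>2) UNIV)"])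
      (auto simp: L2_set_def intro!: finite_sum_le_infsum s)
next
  assume "\<exists>C. \<forall>F. finite F \<longrightarrow> L2_set (\<lambda>i. norm (f i)) F \<le> C"
  then obtain C where C: "\<And>F. finite F \<Longrightarrow> L2_set (\<lambda>i. norm (f i)) F \<le> C" by blast
  have "sum (\<lambda>i. (norm (f i))\<^sup>2) F \<le> C\<^sup>2" if "finite F" for F
  proof -
    have "(L2_set (\<lambda>i. norm (f i)) F)\<^sup>2 \<le> C\<^sup>2"
      using C[OF that] by (intro power_mono) auto
    then show ?thesis by (simp add: L2_set_def sum_nonneg)
  qed
  then show "(\<lambda>i. (norm (f i))\<^sup>2) summable_on UNIV"
    by (intro nonneg_bdd_above_summable_on) (auto simp: bdd_above_def)
qed

lemma sq_summable_add:
  assumes "(\<lambda>i. (norm (f i :: 'h::real_normed_vector))\<^sup>2) summable_on UNIV"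
    and "(\<lambda>i. (norm (g i))\<^sup>2) summable_on UNIV"
  shows "(\<lambda>i. (norm (f i + g i))\<^sup>2) summable_on UNIV"
proof -
  obtain C D where C: "\<And>F. finite F \<Longrightarrow> L2_set (\<lambda>i. norm (f i)) F \<le> C"
    and D: "\<And>F. finite F \<Longrightarrow> L2_set (\<lambda>i. norm (g i)) F \<le> D"
    using assms unfolding sq_summable_iff by blast
  have "L2_set (\<lambda>i. norm (f i + g i)) F \<le> C + D" if "finite F" for F
  proof -
    have "L2_set (\<lambda>i. norm (f i + g i)) F \<le> L2_set (\<lambda>i. norm (f i) + norm (g i)) F"
      by (intro L2_set_mono norm_triangle_ineq) auto
    also have "\<dots> \<le> L2_set (\<lambda>i. norm (f i)) F + L2_set (\<lambda>i. norm (g i)) F"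
      by (rule L2_set_triangle_ineq)
    finally show ?thesis using C[OF that] D[OF that] by linarith
  qed
  then show ?thesis unfolding sq_summable_iff by blast
qed

lemma sq_summable_cscale:
  assumes "(\<lambda>i. (norm (f i :: 'h::complex_hilbert_space))\<^sup>2) summable_on UNIV"
  shows "(\<lambda>i. (norm (cscale c (f i)))\<^sup>2) summable_on UNIV"
  using summable_on_cmult_right[OF assms, of "(cmod c)\<^sup>2"]
  by (simp add: norm_cscale power_mult_distrib)

lemma sq_summable_cinner:
  assumes "(\<lambda>i. (norm (f i :: 'h::complex_hilbert_space))\<^sup>2) summable_on UNIV"
    and "(\<lambda>i. (norm (g i))\<^sup>2) summable_on UNIV"
  shows "(\<lambda>i. cinner (f i) (g i)) summable_on UNIV"
proof (rule Infinite_Sum.abs_summable_summable, rule Infinite_Sum.abs_summable_on_comparison_test)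
  show "(\<lambda>i. norm ((norm (f i))\<^sup>2 + (norm (g i))\<^sup>2)) summable_on UNIV"
    using summable_on_add[OF assms] by simp
qed (use cmod_cinner_le in auto)

instantiation ell2 :: (type, complex_hilbert_space) real_normed_vector
begin

lift_definition zero_ell2 :: "('a, 'b) ell2" is "\<lambda>_. 0" by simp
lift_definition plus_ell2 :: "('a, 'b) ell2 \<Rightarrow> ('a, 'b) ell2 \<Rightarrow> ('a, 'b) ell2"
  is "\<lambda>f g i. f i + g i" by (rule sq_summable_add)
lift_definition uminus_ell2 :: "('a, 'b) ell2 \<Rightarrow> ('a, 'b) ell2" is "\<lambda>f i. - f i" by simp
lift_definition minus_ell2 :: "('a, 'b) ell2 \<Rightarrow> ('a, 'b) ell2 \<Rightarrow> ('a, 'b) ell2"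
  is "\<lambda>f g i. f i - g i"
  subgoal for f g using sq_summable_add[of f "\<lambda>i. - g i"] by simp
  done
lift_definition scaleR_ell2 :: "real \<Rightarrow> ('a, 'b) ell2 \<Rightarrow> ('a, 'b) ell2"
  is "\<lambda>r f i. r *\<^sub>R f i"
  subgoal for r f using sq_summable_cscale[of f "of_real r"] by (simp add: cscale_of_real)
  done
lift_definition norm_ell2 :: "('a, 'b) ell2 \<Rightarrow> real"
  is "\<lambda>f. sqrt (\<Sum>\<^sub>\<infinity>i. (norm (f i))\<^sup>2)" .
definition sgn_ell2 :: "('a, 'b) ell2 \<Rightarrow> ('a, 'b) ell2" where "sgn_ell2 x = scaleR (inverse (norm x)) x"
definition dist_ell2 :: "('a, 'b) ell2 \<Rightarrow> ('a, 'b) ell2 \<Rightarrow> real" where "dist_ell2 x y = norm (x - y)"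
definition uniformity_ell2 :: "(('a, 'b) ell2 \<times> ('a, 'b) ell2) filter"
  where "uniformity_ell2 = (INF e\<in>{0<..}. principal {(x, y). dist x y < e})"
definition open_ell2 :: "('a, 'b) ell2 set \<Rightarrow> bool"
  where "open_ell2 U = (\<forall>x\<in>U. eventually (\<lambda>(x', y). x' = x \<longrightarrow> y \<in> U) uniformity)"

lemma ell2_eqI: "(\<And>i. Rep_ell2 x i = Rep_ell2 y i) \<Longrightarrow> x = (y :: ('a, 'b) ell2)"
  by (simp add: Rep_ell2_inject[symmetric] fun_eq_iff)

lemma ell2_summable: "(\<lambda>i. (norm (Rep_ell2 x i))\<^sup>2) summable_on UNIV" for x :: "('a, 'b) ell2"
  using Rep_ell2[of x] by simp

lemma L2_set_le_norm_ell2: "finite F \<Longrightarrow> L2_set (\<lambda>i. norm (Rep_ell2 x i)) F \<le> norm x"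
  for x :: "('a, 'b) ell2"
  by (auto simp: L2_set_def norm_ell2.rep_eq intro!: finite_sum_le_infsum ell2_summable)

lemma norm_ell2_le:
  fixes x :: "('a, 'b) ell2"
  assumes "\<And>F. finite F \<Longrightarrow> L2_set (\<lambda>i. norm (Rep_ell2 x i)) F \<le> C"
  shows "norm x \<le> C"
proof -
  have C0: "0 \<le> C" using assms[of "{}"] by simp
  have "(\<Sum>\<^sub>\<infinity>i. (norm (Rep_ell2 x i))\<^sup>2) \<le> C\<^sup>2"
  proof (rule infsum_le_finite_sums[OF ell2_summable])
    fix F :: "'a set" assume "finite F"
    then have "(L2_set (\<lambda>i. norm (Rep_ell2 x i)) F)\<^sup>2 \<le> C\<^sup>2"
      using assms by (intro power_mono) auto
    then show "sum (\<lambda>i. (norm (Rep_ell2 x i))\<^sup>2) F \<le> C\<^sup>2"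
      by (simp add: L2_set_def sum_nonneg)
  qed
  then show ?thesis using C0 by (simp add: norm_ell2.rep_eq real_le_lsqrt)
qed

lemma norm_Rep_ell2_le: "norm (Rep_ell2 x i) \<le> norm x" for x :: "('a, 'b) ell2"
  using L2_set_le_norm_ell2[of "{i}" x] by simp

instance
proof
  fix x y z :: "('a, 'b) ell2" and a b :: real
  show "x + y + z = x + (y + z)" by transfer (simp add: add_ac)
  show "x + y = y + x" by transfer (simp add: add_ac)
  show "0 + x = x" by transfer simp
  show "- x + x = 0" by transfer simp
  show "x - y = x + - y" by transfer simp
  show "a *\<^sub>R (x + y) = a *\<^sub>R x + a *\<^sub>R y" by transfer (simp add: scaleR_add_right)
  show "(a + b) *\<^sub>R x = a *\<^sub>R x + b *\<^sub>R x" by transfer (simp add: scaleR_add_left)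
  show "a *\<^sub>R b *\<^sub>R x = (a * b) *\<^sub>R x" by transfer simp
  show "1 *\<^sub>R x = x" by transfer simp
  show "sgn x = inverse (norm x) *\<^sub>R x" by (rule sgn_ell2_def)
  show "dist x y = norm (x - y)" by (rule dist_ell2_def)
  show "uniformity = (INF e\<in>{0<..}. principal {(x, y). dist x (y::('a, 'b) ell2) < e})"
    by (rule uniformity_ell2_def)
  show "open U = (\<forall>x\<in>U. eventually (\<lambda>(x', y). x' = x \<longrightarrow> y \<in> U) uniformity)"
    for U :: "('a, 'b) ell2 set" by (rule open_ell2_def)
  show "norm x = 0 \<longleftrightarrow> x = 0"
  proof
    assume "norm x = 0"
    then have "norm (Rep_ell2 x i) \<le> 0" for i using norm_Rep_ell2_le[of x i] by simp
    then show "x = 0" by (intro ell2_eqI) (simp add: zero_ell2.rep_eq)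
  qed (simp add: norm_ell2.rep_eq zero_ell2.rep_eq)
  show "norm (x + y) \<le> norm x + norm y"
  proof (rule norm_ell2_le)
    fix F :: "'a set" assume F: "finite F"
    have "L2_set (\<lambda>i. norm (Rep_ell2 (x + y) i)) F
        \<le> L2_set (\<lambda>i. norm (Rep_ell2 x i) + norm (Rep_ell2 y i)) F"
      by (intro L2_set_mono) (auto simp: plus_ell2.rep_eq norm_triangle_ineq)
    also have "\<dots> \<le> L2_set (\<lambda>i. norm (Rep_ell2 x i)) F + L2_set (\<lambda>i. norm (Rep_ell2 y i)) F"
      by (rule L2_set_triangle_ineq)
    finally show "L2_set (\<lambda>i. norm (Rep_ell2 (x + y) i)) F \<le> norm x + norm y"
      using L2_set_le_norm_ell2[OF F, of x] L2_set_le_norm_ell2[OF F, of y] by linarith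
  qed
  show "norm (a *\<^sub>R x) = \<bar>a\<bar> * norm x"
    by (simp add: norm_ell2.rep_eq scaleR_ell2.rep_eq power_mult_distrib infsum_cmult_right'
        real_sqrt_mult)
qed

end

instantiation ell2 :: (type, complex_hilbert_space) complex_hilbert_space
begin

lift_definition cscale_ell2 :: "complex \<Rightarrow> ('a, 'b) ell2 \<Rightarrow> ('a, 'b) ell2"
  is "\<lambda>c f i. cscale c (f i)" by (rule sq_summable_cscale)
lift_definition cinner_ell2 :: "('a, 'b) ell2 \<Rightarrow> ('a, 'b) ell2 \<Rightarrow> complex"
  is "\<lambda>f g. \<Sum>\<^sub>\<infinity>i. cinner (f i) (g i)" .

lemma ell2_cinner_self: "cinner x x = complex_of_real ((norm x)\<^sup>2)" for x :: "('a, 'b) ell2"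
proof -
  have "cinner x x = (\<Sum>\<^sub>\<infinity>i. complex_of_real ((norm (Rep_ell2 x i))\<^sup>2))"
    by (simp only: cinner_ell2.rep_eq cinner_self)
  also have "\<dots> = complex_of_real (\<Sum>\<^sub>\<infinity>i. (norm (Rep_ell2 x i))\<^sup>2)"
    by (rule infsumI, rule has_sum_of_real, rule has_sum_infsum, rule ell2_summable)
  also have "\<dots> = complex_of_real ((norm x)\<^sup>2)"
    by (simp add: norm_ell2.rep_eq infsum_nonneg)
  finally show ?thesis .
qed

instance
proof
  fix x y z :: "('a, 'b) ell2" and a :: real and c d :: complex
  show "cscale c (x + y) = cscale c x + cscale c y" by transfer (simp add: cscale_add_right)
  show "cscale (c + d) x = cscale c x + cscale d x" by transfer (simp add: cscale_add_left)
  show "cscale c (cscale d x) = cscale (c * d) x" by transfer (simp add: cscale_cscale)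
  show "cscale (complex_of_real a) x = a *\<^sub>R x" by transfer (simp add: cscale_of_real)
  show "cinner x y = cnj (cinner y x)"
    unfolding cinner_ell2.rep_eq infsum_cnj[symmetric] cinner_commute[symmetric] ..
  show "cinner x (y + z) = cinner x y + cinner x z"
    by transfer (simp add: cinner_add_right infsum_add sq_summable_cinner)
  show "cinner x (cscale c y) = c * cinner x y"
    by transfer (simp add: cinner_cscale_right infsum_cmult_right')
  show "cinner x x = complex_of_real ((norm x)\<^sup>2)" by (rule ell2_cinner_self)
next
  fix X :: "nat \<Rightarrow> ('a, 'b) ell2"
  assume X: "Cauchy X"
  have norm_diff: "dist (X m) (X n) = norm (X m - X n)" for m n by (rule dist_ell2_def)
  have "Cauchy (\<lambda>n. Rep_ell2 (X n) i)" for i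
  proof (rule metric_CauchyI)
    fix e :: real assume "0 < e"
    then obtain N where N: "\<And>m n. m \<ge> N \<Longrightarrow> n \<ge> N \<Longrightarrow> dist (X m) (X n) < e"
      using metric_CauchyD[OF X] by blast
    have "dist (Rep_ell2 (X m) i) (Rep_ell2 (X n) i) < e" if "m \<ge> N" "n \<ge> N" for m n
      using N[OF that] norm_Rep_ell2_le[of "X m - X n" i]
      by (simp add: norm_diff dist_norm minus_ell2.rep_eq)
    then show "\<exists>N. \<forall>m\<ge>N. \<forall>n\<ge>N. dist (Rep_ell2 (X m) i) (Rep_ell2 (X n) i) < e" by blast
  qed
  then have "\<forall>i. \<exists>l. (\<lambda>n. Rep_ell2 (X n) i) \<longlonglongrightarrow> l"
    by (simp add: Cauchy_convergent_iff convergent_def)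
  then obtain g where g: "\<And>i. (\<lambda>n. Rep_ell2 (X n) i) \<longlonglongrightarrow> g i" by metis
  have bound: "\<exists>N. \<forall>n\<ge>N. \<forall>F. finite F \<longrightarrow> L2_set (\<lambda>i. norm (Rep_ell2 (X n) i - g i)) F \<le> e"
    if e: "0 < e" for e
  proof -
    obtain N where N: "\<And>m n. m \<ge> N \<Longrightarrow> n \<ge> N \<Longrightarrow> dist (X m) (X n) < e"
      using metric_CauchyD[OF X e] by blast
    have "L2_set (\<lambda>i. norm (Rep_ell2 (X n) i - g i)) F \<le> e" if "n \<ge> N" "finite F" for n F
    proof (rule LIMSEQ_le_const2)
      show "(\<lambda>m. L2_set (\<lambda>i. norm (Rep_ell2 (X n) i - Rep_ell2 (X m) i)) F)
          \<longlonglongrightarrow> L2_set (\<lambda>i. norm (Rep_ell2 (X n) i - g i)) F"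
        unfolding L2_set_def by (intro tendsto_intros g)
      show "\<exists>N. \<forall>m\<ge>N. L2_set (\<lambda>i. norm (Rep_ell2 (X n) i - Rep_ell2 (X m) i)) F \<le> e"
      proof (intro exI[of _ N] allI impI)
        fix m assume "N \<le> m"
        then show "L2_set (\<lambda>i. norm (Rep_ell2 (X n) i - Rep_ell2 (X m) i)) F \<le> e"
          using L2_set_le_norm_ell2[OF \<open>finite F\<close>, of "X n - X m"] N[OF \<open>n \<ge> N\<close>, of m]
          by (simp add: minus_ell2.rep_eq norm_diff)
      qed
    qed
    then show ?thesis by blast
  qed
  obtain N where N: "\<And>F. finite F \<Longrightarrow> L2_set (\<lambda>i. norm (Rep_ell2 (X N) i - g i)) F \<le> 1"
    using bound[of 1] by auto
  have "(\<lambda>i. (norm (Rep_ell2 (X N) i - g i))\<^sup>2) summable_on UNIV"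
    unfolding sq_summable_iff using N by blast
  then have "(\<lambda>i. (norm (g i - Rep_ell2 (X N) i))\<^sup>2) summable_on UNIV"
    by (simp add: norm_minus_commute)
  from sq_summable_add[OF this ell2_summable[of "X N"]]
  have gs: "(\<lambda>i. (norm (g i))\<^sup>2) summable_on UNIV" by simp
  define G where "G = Abs_ell2 g"
  have G: "Rep_ell2 G = g" unfolding G_def using gs by (simp add: Abs_ell2_inverse)
  have "X \<longlonglongrightarrow> G"
  proof (rule metric_LIMSEQ_I)
    fix e :: real assume "0 < e"
    then obtain N where N: "\<And>n F. n \<ge> N \<Longrightarrow> finite F \<Longrightarrow>
        L2_set (\<lambda>i. norm (Rep_ell2 (X n) i - g i)) F \<le> e / 2"
      using bound[of "e / 2"] by auto
    have "dist (X n) G < e" if "n \<ge> N" for n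
    proof -
      have "norm (X n - G) \<le> e / 2"
        by (rule norm_ell2_le) (use N[OF that] in \<open>simp add: minus_ell2.rep_eq G\<close>)
      then show ?thesis using \<open>0 < e\<close> by (simp add: dist_ell2_def)
    qed
    then show "\<exists>N. \<forall>n\<ge>N. dist (X n) G < e" by blast
  qed
  then show "convergent X" by (rule convergentI)
qed

end


section \<open>Operators and von Neumann algebras\<close>

definition single :: "'i \<Rightarrow> 'h \<Rightarrow> ('i, 'h::complex_hilbert_space) ell2"
  where "single i h = Abs_ell2 (\<lambda>k. if k = i then h else 0)"

lemma Rep_single: "Rep_ell2 (single i h) = (\<lambda>k. if k = i then h else 0)"
proof -
  have "(\<lambda>k. (norm (if k = i then h else 0))\<^sup>2) summable_on UNIV"
    by (rule finite_nonzero_values_imp_summable_on) (rule finite_subset[of _ "{i}"], auto)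
  then show ?thesis by (simp add: single_def Abs_ell2_inverse)
qed

lemma norm_single: "norm (single i h) = norm h"
proof (rule antisym)
  show "norm (single i h) \<le> norm h"
  proof (rule norm_ell2_le)
    fix F :: "'a set" assume "finite F"
    then have "(\<Sum>k\<in>F. (norm (if k = i then h else 0))\<^sup>2) \<le> (norm h)\<^sup>2"
      by (simp add: if_distrib[of norm] if_distrib[of "\<lambda>r. r\<^sup>2"] sum.delta cong: if_cong)
    then show "L2_set (\<lambda>k. norm (Rep_ell2 (single i h) k)) F \<le> norm h"
      by (simp add: L2_set_def Rep_single real_le_lsqrt sum_nonneg)
  qed
  show "norm h \<le> norm (single i h)"
    using norm_Rep_ell2_le[of "single i h" i] by (simp add: Rep_single)
qed

text \<open>Bounded operators are complex-linear elements of the type of bounded real-linear maps.\<close>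

definition bounded_ops :: "('h::complex_hilbert_space \<Rightarrow>\<^sub>L 'h) set"
  where "bounded_ops = {a. \<forall>c v. blinfun_apply a (cscale c v) = cscale c (blinfun_apply a v)}"

definition scalar_op :: "complex \<Rightarrow> 'h::complex_hilbert_space \<Rightarrow>\<^sub>L 'h"
  where "scalar_op c = Blinfun (cscale c)"

lemma scalar_op_apply: "blinfun_apply (scalar_op c) v = cscale c v"
  unfolding scalar_op_def
  by (subst bounded_linear_Blinfun_apply)
    (auto intro!: bounded_linear_intro[of _ "cmod c"]
      simp: cscale_add_right cscale_scaleR norm_cscale mult.commute)

text \<open>\<open>mat_unit i j b\<close> is \<open>b \<otimes> e\<^sub>i\<^sub>j\<close>.\<close>

definition mat_unit ::
    "'i \<Rightarrow> 'i \<Rightarrow> ('h::complex_hilbert_space \<Rightarrow>\<^sub>L 'h) \<Rightarrow> (('i, 'h) ell2 \<Rightarrow>\<^sub>L ('i, 'h) ell2)"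
  where "mat_unit i j b = Blinfun (\<lambda>f. single i (blinfun_apply b (Rep_ell2 f j)))"

lemma mat_unit_apply:
  "blinfun_apply (mat_unit i j b) f = single i (blinfun_apply b (Rep_ell2 f j))"
  unfolding mat_unit_def
proof (subst bounded_linear_Blinfun_apply)
  show "bounded_linear (\<lambda>f. single i (blinfun_apply b (Rep_ell2 f j)))"
  proof (rule bounded_linear_intro[of _ "norm b"])
    fix f g :: "('a, 'b) ell2" and r :: real
    show "single i (blinfun_apply b (Rep_ell2 (f + g) j))
        = single i (blinfun_apply b (Rep_ell2 f j)) + single i (blinfun_apply b (Rep_ell2 g j))"
      by (rule ell2_eqI) (simp add: Rep_single plus_ell2.rep_eq blinfun.add_right)
    show "single i (blinfun_apply b (Rep_ell2 (r *\<^sub>R f) j))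
        = r *\<^sub>R single i (blinfun_apply b (Rep_ell2 f j))"
      by (rule ell2_eqI) (simp add: Rep_single scaleR_ell2.rep_eq blinfun.scaleR_right)
    show "norm (single i (blinfun_apply b (Rep_ell2 f j))) \<le> norm f * norm b"
      using norm_blinfun[of b "Rep_ell2 f j"]
        mult_left_mono[OF norm_Rep_ell2_le[of f j], of "norm b"]
      by (simp add: norm_single mult.commute)
  qed
qed simp

definition adj :: "('h::complex_hilbert_space \<Rightarrow>\<^sub>L 'h) \<Rightarrow> ('h \<Rightarrow>\<^sub>L 'h)"
  where "adj a = (THE a'. \<forall>u v. cinner (blinfun_apply a' u) v = cinner u (blinfun_apply a v))"

lemma adj_eqI:
  fixes a a' :: "'h::complex_hilbert_space \<Rightarrow>\<^sub>L 'h"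
  assumes "\<And>u v. cinner (blinfun_apply a' u) v = cinner u (blinfun_apply a v)"
  shows "adj a = a'"
  unfolding adj_def
proof (rule the_equality)
  fix c :: "'h \<Rightarrow>\<^sub>L 'h"
  assume c: "\<forall>u v. cinner (blinfun_apply c u) v = cinner u (blinfun_apply a v)"
  show "c = a'"
  proof (rule blinfun_eqI)
    fix u
    define w where "w = blinfun_apply c u - blinfun_apply a' u"
    have "cinner (w + blinfun_apply a' u) w = cinner (blinfun_apply a' u) w"
      by (simp add: w_def c assms)
    then have "cinner w w = 0" by (simp add: cinner_add_left)
    then show "blinfun_apply c u = blinfun_apply a' u" by (simp add: cinner_self w_def)
  qed
qed (use assms in blast)

definition positive_op :: "('h::complex_hilbert_space \<Rightarrow>\<^sub>L 'h) \<Rightarrow> bool"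
  where "positive_op a \<longleftrightarrow> (\<forall>v. cinner v (blinfun_apply a v) \<in> \<real>\<^sub>\<ge>\<^sub>0)"

definition commutant :: "('h::complex_hilbert_space \<Rightarrow>\<^sub>L 'h) set \<Rightarrow> ('h \<Rightarrow>\<^sub>L 'h) set"
  where "commutant S = {a \<in> bounded_ops. \<forall>s\<in>S. a o\<^sub>L s = s o\<^sub>L a}"

definition von_neumann_algebra :: "('h::complex_hilbert_space \<Rightarrow>\<^sub>L 'h) set \<Rightarrow> bool"
  where "von_neumann_algebra M \<longleftrightarrow>
    M \<subseteq> bounded_ops \<and>
    (\<forall>a\<in>M. \<exists>a'\<in>M. \<forall>u v. cinner (blinfun_apply a' u) v = cinner u (blinfun_apply a v)) \<and>
    commutant (commutant M) = M"

inductive_set star_algebra ::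
    "('h::complex_hilbert_space \<Rightarrow>\<^sub>L 'h) set \<Rightarrow> ('h \<Rightarrow>\<^sub>L 'h) set"
  for S where
    base: "a \<in> S \<Longrightarrow> a \<in> star_algebra S"
  | add: "a \<in> star_algebra S \<Longrightarrow> b \<in> star_algebra S \<Longrightarrow> a + b \<in> star_algebra S"
  | scale: "a \<in> star_algebra S \<Longrightarrow> scalar_op c o\<^sub>L a \<in> star_algebra S"
  | mult: "a \<in> star_algebra S \<Longrightarrow> b \<in> star_algebra S \<Longrightarrow> a o\<^sub>L b \<in> star_algebra S"
  | star: "a \<in> star_algebra S \<Longrightarrow> adj a \<in> star_algebra S"

text \<open>The von Neumann tensor product \<open>B \<otimes> B(\<ell>\<^sup>2(I))\<close> acting on \<open>H \<otimes> \<ell>\<^sup>2(I)\<close>.\<close>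

definition tensor_B_ell2 ::
    "('h::complex_hilbert_space \<Rightarrow>\<^sub>L 'h) set \<Rightarrow> (('i, 'h) ell2 \<Rightarrow>\<^sub>L ('i, 'h) ell2) set"
  where "tensor_B_ell2 B = commutant (commutant {mat_unit i j b | i j b. b \<in> B})"

definition sigma_weak :: "('h::complex_hilbert_space \<Rightarrow>\<^sub>L 'h) topology"
  where "sigma_weak = topology_generated_by
    {{a. (\<Sum>n. cinner (u n) (blinfun_apply a (v n))) \<in> U} | u v U. open U \<and>
      summable (\<lambda>n::nat. (norm (u n))\<^sup>2) \<and> summable (\<lambda>n. (norm (v n))\<^sup>2)}"

definition linear_on_ops ::
    "('h::complex_hilbert_space \<Rightarrow>\<^sub>L 'h) set \<Rightarrow>
     (('h \<Rightarrow>\<^sub>L 'h) \<Rightarrow> ('l::complex_hilbert_space \<Rightarrow>\<^sub>L 'l)) \<Rightarrow> bool"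
  where "linear_on_ops M f \<longleftrightarrow>
    (\<forall>a\<in>M. \<forall>b\<in>M. f (a + b) = f a + f b) \<and>
    (\<forall>c. \<forall>a\<in>M. f (scalar_op c o\<^sub>L a) = scalar_op c o\<^sub>L f a)"

definition normal_map ::
    "('h::complex_hilbert_space \<Rightarrow>\<^sub>L 'h) set \<Rightarrow>
     (('h \<Rightarrow>\<^sub>L 'h) \<Rightarrow> ('l::complex_hilbert_space \<Rightarrow>\<^sub>L 'l)) \<Rightarrow> bool"
  where "normal_map M f \<longleftrightarrow> continuous_map (subtopology sigma_weak M) sigma_weak f"

text \<open>An \<open>n \<times> n\<close> operator matrix is positive as an operator on \<open>H\<^sup>n\<close>; a map is
  completely positive if its entrywise application preserves positivity of such matrices.\<close>

definition positive_matrix ::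
    "nat \<Rightarrow> (nat \<Rightarrow> nat \<Rightarrow> ('h::complex_hilbert_space \<Rightarrow>\<^sub>L 'h)) \<Rightarrow> bool"
  where "positive_matrix n a \<longleftrightarrow>
    (\<forall>v. (\<Sum>k<n. \<Sum>l<n. cinner (v k) (blinfun_apply (a k l) (v l))) \<in> \<real>\<^sub>\<ge>\<^sub>0)"

definition completely_positive ::
    "('h::complex_hilbert_space \<Rightarrow>\<^sub>L 'h) set \<Rightarrow>
     (('h \<Rightarrow>\<^sub>L 'h) \<Rightarrow> ('l::complex_hilbert_space \<Rightarrow>\<^sub>L 'l)) \<Rightarrow> bool"
  where "completely_positive M f \<longleftrightarrow>
    (\<forall>n a. (\<forall>k<n. \<forall>l<n. a k l \<in> M) \<longrightarrow> positive_matrix n a \<longrightarrow>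
      positive_matrix n (\<lambda>k l. f (a k l)))"

section \<open>Tracial von Neumann algebras, GNS space and conditional expectation\<close>

definition tracial_von_neumann_algebra ::
    "('h::complex_hilbert_space \<Rightarrow>\<^sub>L 'h) set \<Rightarrow> (('h \<Rightarrow>\<^sub>L 'h) \<Rightarrow> complex) \<Rightarrow> bool"
  where "tracial_von_neumann_algebra M \<tau> \<longleftrightarrow>
    von_neumann_algebra M \<and>
    (\<forall>a\<in>M. \<forall>b\<in>M. \<tau> (a + b) = \<tau> a + \<tau> b) \<and>
    (\<forall>c. \<forall>a\<in>M. \<tau> (scalar_op c o\<^sub>L a) = c * \<tau> a) \<and>
    (\<forall>a\<in>M. positive_op a \<longrightarrow> \<tau> a \<in> \<real>\<^sub>\<ge>\<^sub>0) \<and>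
    \<tau> id_blinfun = 1 \<and>
    continuous_map (subtopology sigma_weak M) euclidean \<tau> \<and>
    (\<forall>a\<in>M. \<tau> (adj a o\<^sub>L a) = 0 \<longrightarrow> a = 0) \<and>
    (\<forall>a\<in>M. \<forall>b\<in>M. \<tau> (a o\<^sub>L b) = \<tau> (b o\<^sub>L a))"

text \<open>\<open>L\<^sup>2(M, \<tau>)\<close> is a Hilbert space together with the canonical map \<open>\<Lambda>\<close> from \<open>M\<close>; these data
  are determined up to a unique unitary intertwining the canonical maps.\<close>

definition GNS_space ::
    "('h::complex_hilbert_space \<Rightarrow>\<^sub>L 'h) set \<Rightarrow> (('h \<Rightarrow>\<^sub>L 'h) \<Rightarrow> complex) \<Rightarrow>
     (('h \<Rightarrow>\<^sub>L 'h) \<Rightarrow> 'k::complex_hilbert_space) \<Rightarrow> bool"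
  where "GNS_space M \<tau> \<Lambda> \<longleftrightarrow>
    (\<forall>a\<in>M. \<forall>b\<in>M. \<Lambda> (a + b) = \<Lambda> a + \<Lambda> b) \<and>
    (\<forall>c. \<forall>a\<in>M. \<Lambda> (scalar_op c o\<^sub>L a) = cscale c (\<Lambda> a)) \<and>
    (\<forall>a\<in>M. \<forall>b\<in>M. cinner (\<Lambda> a) (\<Lambda> b) = \<tau> (adj a o\<^sub>L b)) \<and>
    closure (\<Lambda> ` M) = UNIV"

definition conditional_expectation ::
    "('h::complex_hilbert_space \<Rightarrow>\<^sub>L 'h) set \<Rightarrow> (('h \<Rightarrow>\<^sub>L 'h) \<Rightarrow> complex) \<Rightarrow>
     ('h \<Rightarrow>\<^sub>L 'h) set \<Rightarrow> (('h \<Rightarrow>\<^sub>L 'h) \<Rightarrow> ('h \<Rightarrow>\<^sub>L 'h)) \<Rightarrow> bool"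
  where "conditional_expectation M \<tau> B E \<longleftrightarrow>
    linear_on_ops M E \<and> E ` M \<subseteq> B \<and> (\<forall>b\<in>B. E b = b) \<and>
    (\<forall>a\<in>M. \<forall>b\<in>B. \<forall>c\<in>B. E (b o\<^sub>L a o\<^sub>L c) = b o\<^sub>L E a o\<^sub>L c) \<and>
    (\<forall>a\<in>M. positive_op a \<longrightarrow> positive_op (E a)) \<and>
    (\<forall>a\<in>M. E (adj a o\<^sub>L a) = 0 \<longrightarrow> a = 0) \<and>
    normal_map M E \<and>
    (\<forall>a\<in>M. \<tau> (E a) = \<tau> a)"

text \<open>The bounded operator on \<open>L\<^sup>2(M, \<tau>)\<close> extending a \<open>\<parallel>\<cdot>\<parallel>\<^sub>2\<close>-bounded linear map \<open>f\<close> of \<open>M\<close>.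
  With \<open>f\<close> a left or right multiplication it gives the bimodule structure of \<open>L\<^sup>2(M, \<tau>)\<close>;
  with \<open>f = E\<^sub>B\<close> its range lies in \<open>L\<^sup>2(B, \<tau>)\<close>, the closure of \<open>\<Lambda> ` B\<close>.\<close>

definition L2_extension ::
    "('h::complex_hilbert_space \<Rightarrow>\<^sub>L 'h) set \<Rightarrow> (('h \<Rightarrow>\<^sub>L 'h) \<Rightarrow> 'k::complex_hilbert_space) \<Rightarrow>
     (('h \<Rightarrow>\<^sub>L 'h) \<Rightarrow> ('h \<Rightarrow>\<^sub>L 'h)) \<Rightarrow> ('k \<Rightarrow>\<^sub>L 'k)"
  where "L2_extension M \<Lambda> f = (THE T. \<forall>a\<in>M. blinfun_apply T (\<Lambda> a) = \<Lambda> (f a))"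

definition left_action ::
    "('h::complex_hilbert_space \<Rightarrow>\<^sub>L 'h) set \<Rightarrow> (('h \<Rightarrow>\<^sub>L 'h) \<Rightarrow> 'k::complex_hilbert_space) \<Rightarrow>
     ('h \<Rightarrow>\<^sub>L 'h) \<Rightarrow> 'k \<Rightarrow> 'k"
  where "left_action M \<Lambda> a \<xi> = blinfun_apply (L2_extension M \<Lambda> (\<lambda>m. a o\<^sub>L m)) \<xi>"

definition right_action ::
    "('h::complex_hilbert_space \<Rightarrow>\<^sub>L 'h) set \<Rightarrow> (('h \<Rightarrow>\<^sub>L 'h) \<Rightarrow> 'k::complex_hilbert_space) \<Rightarrow>
     'k \<Rightarrow> ('h \<Rightarrow>\<^sub>L 'h) \<Rightarrow> 'k"
  where "right_action M \<Lambda> \<xi> a = blinfun_apply (L2_extension M \<Lambda> (\<lambda>m. m o\<^sub>L a)) \<xi>"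

section \<open>Covariance matrices and conjugate variables\<close>

text \<open>The double sum is the \<open>\<sigma>\<close>-weak limit of the finite square truncations
  \<open>\<Sum>\<^sub>i\<^sub>,\<^sub>j\<^sub>\<in>\<^sub>F\<close>: unconditional summation over finite subsets of \<open>I \<times> I\<close> would be too strong, since it
  fails for matrices of general bounded operators on \<open>\<ell>\<^sup>2(I)\<close>.\<close>

definition covariance_matrix ::
    "('h::complex_hilbert_space \<Rightarrow>\<^sub>L 'h) set \<Rightarrow>
     (('h \<Rightarrow>\<^sub>L 'h) \<Rightarrow> (('i, 'h) ell2 \<Rightarrow>\<^sub>L ('i, 'h) ell2)) \<Rightarrow>
     ('i \<Rightarrow> 'i \<Rightarrow> ('h \<Rightarrow>\<^sub>L 'h) \<Rightarrow> ('h \<Rightarrow>\<^sub>L 'h)) \<Rightarrow> bool"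
  where "covariance_matrix B \<eta> \<eta>c \<longleftrightarrow>
    linear_on_ops B \<eta> \<and> \<eta> ` B \<subseteq> tensor_B_ell2 B \<and>
    normal_map B \<eta> \<and> completely_positive B \<eta> \<and>
    (\<forall>i j. linear_on_ops B (\<eta>c i j) \<and> \<eta>c i j ` B \<subseteq> B) \<and>
    (\<forall>b\<in>B. limitin sigma_weak (\<lambda>F. \<Sum>i\<in>F. \<Sum>j\<in>F. mat_unit i j (\<eta>c i j b)) (\<eta> b)
      (finite_subsets_at_top UNIV))"

definition tau_symmetric ::
    "('h::complex_hilbert_space \<Rightarrow>\<^sub>L 'h) set \<Rightarrow> (('h \<Rightarrow>\<^sub>L 'h) \<Rightarrow> complex) \<Rightarrow>
     ('i \<Rightarrow> 'i \<Rightarrow> ('h \<Rightarrow>\<^sub>L 'h) \<Rightarrow> ('h \<Rightarrow>\<^sub>L 'h)) \<Rightarrow> bool"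
  where "tau_symmetric B \<tau> \<eta>c \<longleftrightarrow>
    (\<forall>a\<in>B. \<forall>b\<in>B. \<forall>i j. \<tau> (\<eta>c i j a o\<^sub>L b) = \<tau> (a o\<^sub>L \<eta>c j i b))"

text \<open>\<open>word x b j k n\<close> is \<open>b\<^sub>k x\<^bsub>j(k+1)\<^esub> b\<^bsub>k+1\<^esub> \<cdots> x\<^bsub>j(k+n)\<^esub> b\<^bsub>k+n\<^esub>\<close>.\<close>

primrec word ::
    "('i \<Rightarrow> ('h::real_normed_vector \<Rightarrow>\<^sub>L 'h)) \<Rightarrow> (nat \<Rightarrow> ('h \<Rightarrow>\<^sub>L 'h)) \<Rightarrow> (nat \<Rightarrow> 'i) \<Rightarrow>
     nat \<Rightarrow> nat \<Rightarrow> ('h \<Rightarrow>\<^sub>L 'h)"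
  where
    "word x b j k 0 = b k"
  | "word x b j k (Suc n) = word x b j k n o\<^sub>L x (j (k + Suc n)) o\<^sub>L b (k + Suc n)"

definition conjugate_variable ::
    "('h::complex_hilbert_space \<Rightarrow>\<^sub>L 'h) set \<Rightarrow> (('h \<Rightarrow>\<^sub>L 'h) \<Rightarrow> complex) \<Rightarrow>
     (('h \<Rightarrow>\<^sub>L 'h) \<Rightarrow> 'k::complex_hilbert_space) \<Rightarrow> (('h \<Rightarrow>\<^sub>L 'h) \<Rightarrow> ('h \<Rightarrow>\<^sub>L 'h)) \<Rightarrow>
     ('i \<Rightarrow> 'i \<Rightarrow> ('h \<Rightarrow>\<^sub>L 'h) \<Rightarrow> ('h \<Rightarrow>\<^sub>L 'h)) \<Rightarrow> ('i \<Rightarrow> ('h \<Rightarrow>\<^sub>L 'h)) \<Rightarrow> 'i \<Rightarrow> 'k \<Rightarrow> bool"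
  where "conjugate_variable B \<tau> \<Lambda> E \<eta>c x i \<xi> \<longleftrightarrow>
    (\<forall>d j b. (\<forall>k\<le>d. b k \<in> B) \<longrightarrow>
      cinner \<xi> (\<Lambda> (word x b j 0 d)) =
      (\<Sum>k=1..d. \<tau> (\<eta>c i (j k) (E (word x b j 0 (k - 1))) o\<^sub>L E (word x b j k (d - k)))))"

section \<open>Operator-valued cumulants\<close>

definition noncrossing :: "nat set set \<Rightarrow> bool"
  where "noncrossing \<pi> \<longleftrightarrow>
    (\<forall>V\<in>\<pi>. \<forall>W\<in>\<pi>. V \<noteq> W \<longrightarrow>
      \<not> (\<exists>p\<in>V. \<exists>q\<in>W. \<exists>r\<in>V. \<exists>s\<in>W. p < q \<and> q < r \<and> r < s))"

definition NC :: "nat \<Rightarrow> nat set set set"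
  where "NC d = {\<pi>. partition_on {1..d} \<pi> \<and> noncrossing \<pi>}"

fun list_product :: "('a \<Rightarrow> 'a \<Rightarrow> 'a) \<Rightarrow> 'a list \<Rightarrow> 'a"
  where
    "list_product m [] = undefined"
  | "list_product m [a] = a"
  | "list_product m (a # b # as) = m a (list_product m (b # as))"

definition interval_block :: "nat set set \<Rightarrow> nat set \<Rightarrow> bool"
  where "interval_block \<pi> V \<longleftrightarrow>
    V \<in> \<pi> \<and> V \<noteq> {} \<and> (\<forall>s\<in>\<Union>\<pi>. Min V \<le> s \<and> s \<le> Max V \<longrightarrow> s \<in> V)"

definition last_interval_block :: "nat set set \<Rightarrow> nat set"
  where "last_interval_block \<pi> = arg_max Min (interval_block \<pi>)"

lemma last_interval_block:
  assumes "finite \<pi>" "\<exists>V. interval_block \<pi> V"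
  shows "interval_block \<pi> (last_interval_block \<pi>)"
proof -
  obtain V where V: "interval_block \<pi> V" using assms by blast
  have "\<forall>W. interval_block \<pi> W \<longrightarrow> Min W < Suc (Max (Min ` \<pi>))"
    using assms(1) by (auto simp: interval_block_def less_Suc_eq_le)
  from arg_max_nat_lemma[OF V this] show ?thesis
    unfolding last_interval_block_def by blast
qed

text \<open>Here \<open>a\<close> lists the entries at the positions \<open>S\<close> that remain after removal of \<open>V\<close>. The value \<open>v\<close>
  of \<open>V\<close> is multiplied on the right of the preceding remaining entry, or on the left of
  the following one if there is no preceding entry.\<close>

definition absorb ::
    "('a \<Rightarrow> 'a \<Rightarrow> 'a) \<Rightarrow> nat set \<Rightarrow> nat set \<Rightarrow> 'a \<Rightarrow> (nat \<Rightarrow> 'a) \<Rightarrow> (nat \<Rightarrow> 'a)"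
  where "absorb m S V v a =
    (if \<exists>s\<in>S. s < Min V
     then let p = Max {s\<in>S. s < Min V} in a(p := m (a p) v)
     else let q = Min {s\<in>S. Max V < s} in a(q := m v (a q)))"

text \<open>\<open>cumulant_part m \<kappa> \<pi> a\<close> is \<open>\<kappa>(\<pi>)\<close> evaluated at the entries \<open>a p\<close>, \<open>p \<in> \<Union>\<pi>\<close>. For the
  bimodular \<open>\<kappa>\<close> at hand its value does not depend on the order in which interval blocks are
  removed; the rightmost one is removed first. Entries keep their original positions. A partition
  with no interval block is crossing and gets a dummy value.\<close>

function cumulant_part ::
    "('a::ab_group_add \<Rightarrow> 'a \<Rightarrow> 'a) \<Rightarrow> ('a list \<Rightarrow> 'a) \<Rightarrow> nat set set \<Rightarrow> (nat \<Rightarrow> 'a) \<Rightarrow> 'a"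
  where "cumulant_part m \<kappa> \<pi> a =
    (if finite \<pi> \<and> (\<exists>V. interval_block \<pi> V) then
       let V = last_interval_block \<pi>; v = \<kappa> (map a (sorted_list_of_set V)) in
       if \<pi> = {V} then v
       else cumulant_part m \<kappa> (\<pi> - {V}) (absorb m (\<Union>(\<pi> - {V})) V v a)
     else 0)"
  by auto
termination
proof (relation "Wellfounded.measure (\<lambda>(m, \<kappa>, \<pi>, a). card \<pi>)")
  fix m :: "'a::ab_group_add \<Rightarrow> 'a \<Rightarrow> 'a" and \<kappa> :: "'a list \<Rightarrow> 'a"
    and \<pi> :: "nat set set" and a :: "nat \<Rightarrow> 'a" and V v
  assume "finite \<pi> \<and> (\<exists>V. interval_block \<pi> V)" and V: "V = last_interval_block \<pi>"
  then have "V \<in> \<pi>" "finite \<pi>"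
    using last_interval_block[of \<pi>] by (auto simp: interval_block_def)
  then have "0 < card \<pi>" using card_gt_0_iff by blast
  then show "((m, \<kappa>, \<pi> - {V}, absorb m (\<Union>(\<pi> - {V})) V v a), (m, \<kappa>, \<pi>, a))
      \<in> Wellfounded.measure (\<lambda>(m, \<kappa>, \<pi>, a). card \<pi>)"
    using \<open>V \<in> \<pi>\<close> by simp
qed simp

declare cumulant_part.simps [simp del]

text \<open>The moment-cumulant formula solved for the one-block partition, see the lemma
  \<open>moment_cumulant\<close> below. The guard on the length only serves the termination proof: all other
  partitions have blocks of smaller size.\<close>

function cumulant ::
    "('a::ab_group_add \<Rightarrow> 'a \<Rightarrow> 'a) \<Rightarrow> ('a \<Rightarrow> 'a) \<Rightarrow> 'a list \<Rightarrow> 'a"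
  where "cumulant m E as =
    E (list_product m as) -
    (\<Sum>\<pi>\<in>NC (length as) - {{{1..length as}}}.
      cumulant_part m (\<lambda>bs. if length bs < length as then cumulant m E bs else 0) \<pi>
        (\<lambda>p. as ! (p - 1)))"
  by auto
termination by (relation "Wellfounded.measure (\<lambda>(m, E, as). length as)") auto

declare cumulant.simps [simp del]

lemma cumulant_part_cong:
  assumes "partition_on A \<pi>" "finite A"
    and "\<And>V bs. V \<in> \<pi> \<Longrightarrow> length bs = card V \<Longrightarrow> \<kappa> bs = \<kappa>' bs"
  shows "cumulant_part m \<kappa> \<pi> a = cumulant_part m \<kappa>' \<pi> a"
  using assms
proof (induction "card \<pi>" arbitrary: A \<pi> a rule: less_induct)
  case less
  show ?case
  proof (cases "finite \<pi> \<and> (\<exists>V. interval_block \<pi> V)")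
    case True
    define V where "V = last_interval_block \<pi>"
    have V: "V \<in> \<pi>"
      using True last_interval_block[of \<pi>] by (auto simp: interval_block_def V_def)
    have eq: "\<kappa> (map a (sorted_list_of_set V)) = \<kappa>' (map a (sorted_list_of_set V))"
      using less.prems(3)[OF V] by simp
    have part: "partition_on (A - V) (\<pi> - {V})"
    proof -
      have "\<Union>(\<pi> - {V}) = A - V"
        using less.prems(1) V unfolding partition_on_def disjoint_def by auto
      then show ?thesis
        using less.prems(1) unfolding partition_on_def disjoint_def by auto
    qed
    have IH: "cumulant_part m \<kappa> (\<pi> - {V}) a' = cumulant_part m \<kappa>' (\<pi> - {V}) a'" for a'
      by (rule less.hyps[OF _ part])
        (use True V less.prems in \<open>auto intro!: card_Diff1_less simp del: card_Diff_insert\<close>)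
    show ?thesis
      using True by (subst (1 2) cumulant_part.simps) (simp add: Let_def eq IH flip: V_def)
  next
    case False
    then show ?thesis by (subst (1 2) cumulant_part.simps) auto
  qed
qed

lemma finite_NC: "finite (NC d)"
proof (rule finite_subset)
  show "NC d \<subseteq> Pow (Pow {1..d})" by (auto simp: NC_def partition_on_def)
qed simp

lemma moment_cumulant:
  assumes "as \<noteq> []"
  shows "E (list_product m as) =
    (\<Sum>\<pi>\<in>NC (length as). cumulant_part m (cumulant m E) \<pi> (\<lambda>p. as ! (p - 1)))"
proof -
  define d where "d = length as"
  define a where "a = (\<lambda>p. as ! (p - 1))"
  have d: "1 \<le> d" using assms by (simp add: d_def Suc_le_eq)
  have one: "{{1..d}} \<in> NC d"
    using d by (auto simp: NC_def noncrossing_def partition_on_def disjoint_def)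
  have int: "interval_block {{1..d}} V \<longleftrightarrow> V = {1..d}" for V
    using d by (auto simp: interval_block_def)
  then have last: "last_interval_block {{1..d}} = {1..d}"
    using last_interval_block[of "{{1..d}}"] by blast
  have list: "map a (sorted_list_of_set {1..d}) = as"
    by (rule nth_equalityI)
      (auto simp: a_def d_def atLeastLessThanSuc_atLeastAtMost[symmetric] simp del: upt_Suc)
  have ex: "\<exists>V. interval_block {{1..d}} V" by (simp only: int simp_thms)
  have block: "cumulant_part m (cumulant m E) {{1..d}} a = cumulant m E as"
    by (subst cumulant_part.simps)
      (simp only: Let_def last ex list finite.intros simp_thms if_True)
  have rest: "cumulant_part m (cumulant m E) \<pi> a =
      cumulant_part m (\<lambda>bs. if length bs < d then cumulant m E bs else 0) \<pi> a"
    if \<pi>: "\<pi> \<in> NC d - {{{1..d}}}" for \<pi>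
  proof (rule cumulant_part_cong)
    show P: "partition_on {1..d} \<pi>" using \<pi> by (simp add: NC_def)
    fix V :: "nat set" and bs :: "'a list"
    assume V: "V \<in> \<pi>" and bs: "length bs = card V"
    have sub: "V \<subseteq> {1..d}" using P V by (auto simp: partition_on_def)
    have "V \<noteq> {1..d}"
    proof
      assume eq: "V = {1..d}"
      have "W = V" if "W \<in> \<pi>" for W
      proof (rule ccontr)
        assume "W \<noteq> V"
        then have "W \<inter> V = {}" using P V that by (auto simp: partition_on_def disjoint_def)
        moreover have "W \<subseteq> V" "W \<noteq> {}" using P that eq by (auto simp: partition_on_def)
        ultimately show False by blast
      qed
      then have "\<pi> = {{1..d}}" using V eq by blast
      then show False using \<pi> by blast
    qed
    then have "card V < card {1..d}" using sub by (intro psubset_card_mono) auto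
    then show "cumulant m E bs = (if length bs < d then cumulant m E bs else 0)"
      using bs by simp
  qed simp
  have "cumulant m E as = E (list_product m as) -
      (\<Sum>\<pi>\<in>NC d - {{{1..d}}}. cumulant_part m (cumulant m E) \<pi> a)"
    unfolding cumulant.simps[of m E as] d_def[symmetric] a_def[symmetric]
    by (simp only: rest cong: sum.cong)
  then show ?thesis
    unfolding d_def[symmetric] a_def[symmetric]
    using sum.remove[OF finite_NC one, of "\<lambda>\<pi>. cumulant_part m (cumulant m E) \<pi> a"]
    unfolding block by simp
qed

text \<open>Entries from \<open>M\<close> and from \<open>L\<^sup>2(M, \<tau>)\<close> are both encoded in the direct sum of \<open>M\<close> and
  \<open>L\<^sup>2(M, \<tau>)\<close>, with the products given by the bimodule structure and two vectors multiplying
  to zero. For entries of \<open>M\<close> all moments and cumulants are those of \<open>M\<close>, in the first component.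
  With exactly one entry from \<open>L\<^sup>2(M, \<tau>)\<close> they are the extended ones, in the second component.\<close>

definition L2_product ::
    "('h::complex_hilbert_space \<Rightarrow>\<^sub>L 'h) set \<Rightarrow> (('h \<Rightarrow>\<^sub>L 'h) \<Rightarrow> 'k::complex_hilbert_space) \<Rightarrow>
     ('h \<Rightarrow>\<^sub>L 'h) \<times> 'k \<Rightarrow> ('h \<Rightarrow>\<^sub>L 'h) \<times> 'k \<Rightarrow> ('h \<Rightarrow>\<^sub>L 'h) \<times> 'k"
  where "L2_product M \<Lambda> p q =
    (fst p o\<^sub>L fst q, left_action M \<Lambda> (fst p) (snd q) + right_action M \<Lambda> (snd p) (fst q))"

definition L2_expectation ::
    "('h::complex_hilbert_space \<Rightarrow>\<^sub>L 'h) set \<Rightarrow> (('h \<Rightarrow>\<^sub>L 'h) \<Rightarrow> 'k::complex_hilbert_space) \<Rightarrow>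
     (('h \<Rightarrow>\<^sub>L 'h) \<Rightarrow> ('h \<Rightarrow>\<^sub>L 'h)) \<Rightarrow> ('h \<Rightarrow>\<^sub>L 'h) \<times> 'k \<Rightarrow> ('h \<Rightarrow>\<^sub>L 'h) \<times> 'k"
  where "L2_expectation M \<Lambda> E p = (E (fst p), blinfun_apply (L2_extension M \<Lambda> E) (snd p))"

text \<open>\<open>L2_cumulant M \<Lambda> E as \<xi> bs\<close> is the cumulant of the entries \<open>as\<close>, \<open>\<xi>\<close>, \<open>bs\<close> in this order.\<close>

definition L2_cumulant ::
    "('h::complex_hilbert_space \<Rightarrow>\<^sub>L 'h) set \<Rightarrow> (('h \<Rightarrow>\<^sub>L 'h) \<Rightarrow> 'k::complex_hilbert_space) \<Rightarrow>
     (('h \<Rightarrow>\<^sub>L 'h) \<Rightarrow> ('h \<Rightarrow>\<^sub>L 'h)) \<Rightarrow> ('h \<Rightarrow>\<^sub>L 'h) list \<Rightarrow> 'k \<Rightarrow> ('h \<Rightarrow>\<^sub>L 'h) list \<Rightarrow> 'k"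
  where "L2_cumulant M \<Lambda> E as \<xi> bs =
    snd (cumulant (L2_product M \<Lambda>) (L2_expectation M \<Lambda> E)
      (map (\<lambda>a. (a, 0)) as @ (0, \<xi>) # map (\<lambda>b. (b, 0)) bs))"

end

theory Submission
  imports Defs
begin

text \<open>
  For \<open>c \<in> B\<close> and a word \<open>w\<close>, traciality shows that \<open>\<langle>c, E(\<xi> w)\<rangle>\<close> is the complex conjugate of
  \<open>\<langle>\<xi>, c w\<^sup>*\<rangle>\<close>, and \<open>c w\<^sup>*\<close> is again a word. Complete positivity gives \<open>\<eta>\<^sub>i\<^sub>j(b)\<^sup>* = \<eta>\<^sub>j\<^sub>i(b\<^sup>*)\<close>, so with the
  \<open>\<tau>\<close>-symmetry of \<open>\<eta>\<close> the vector \<open>\<xi>\<close> is the conjugate variable iff \<open>E(\<xi> b\<^sub>0 x\<^sub>1 b\<^sub>1 \<cdots> x\<^sub>d b\<^sub>d)\<close> is the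
  sum over \<open>k\<close> of the products of \<open>\<eta>(E(b\<^sub>0 x\<^sub>1 \<cdots> b\<^bsub>k-1\<^esub>))\<close> and \<open>E(b\<^sub>k x\<^bsub>k+1\<^esub> \<cdots> b\<^sub>d)\<close>, for all words.

  Suppose now that the cumulants of \<open>\<xi> c\<^sub>0, b\<^sub>1 x\<^sub>1 c\<^sub>1, \<dots>, b\<^sub>n x\<^sub>n c\<^sub>n\<close> have the stated values for \<open>n < d\<close>.
  In the moment-cumulant formula with \<open>d + 1\<close> entries, only the one-block partition and the partitions
  in which the block of \<open>\<xi>\<close> is a pair \<open>{1, k}\<close> then contribute. The latter add up to the sum above,
  because the partitions of the two gaps sum to conditional expectations. So the formula for
  cumulants of this order is equivalent to the one for moments.
\<close>

text \<open>The theorem puts coefficients only on the left of the variables, but removing an inner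
  block multiplies its value on the right of the preceding entry, so blocks of lower order carry
  entries \<open>b x c\<close> and \<open>\<xi> c\<close>. The induction therefore runs over these
  two-sided entries. They are reached from the stated conditions through moments: in a product each
  right coefficient merges with the next left one, so only the last coefficient is extra, and it
  leaves the conditional expectation by right \<open>B\<close>-linearity. Order two stays on the
  cumulant side, because with two entries the pair \<open>{1, 2}\<close> is itself the one-block
  partition; this is why sums over pairs are guarded by \<open>n < 3\<close> or \<open>d < 2\<close>
  below.\<close>

section \<open>Cumulants along non-crossing partitions\<close>

text \<open>The ground set is left implicit as \<open>\<Union>\<pi>\<close>, because every removal
  of a block shrinks it.\<close>

definition nc_blocks :: "nat set set \<Rightarrow> bool"
  where "nc_blocks \<pi> \<longleftrightarrow> finite (\<Union>\<pi>) \<and> partition_on (\<Union>\<pi>) \<pi> \<and> noncrossing \<pi>"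

lemma nc_blocks_subset: "nc_blocks \<pi> \<Longrightarrow> \<rho> \<subseteq> \<pi> \<Longrightarrow> nc_blocks \<rho>"
  unfolding nc_blocks_def partition_on_def noncrossing_def disjoint_def
  by (meson Union_mono finite_subset subset_iff)

lemma nc_blocks_finite: "nc_blocks \<pi> \<Longrightarrow> finite \<pi>"
  unfolding nc_blocks_def by (blast dest: finite_UnionD)

lemma nc_blocks_block:
  assumes "nc_blocks \<pi>" "V \<in> \<pi>"
  shows "finite V" "V \<noteq> {}" "Min V \<in> V" "Max V \<in> V"
proof -
  show "finite V" "V \<noteq> {}"
    using assms finite_subset[of V "\<Union>\<pi>"] by (auto simp: nc_blocks_def partition_on_def)
  then show "Min V \<in> V" "Max V \<in> V" by auto
qed

lemma nc_blocks_disjoint: "nc_blocks \<pi> \<Longrightarrow> V \<in> \<pi> \<Longrightarrow> W \<in> \<pi> \<Longrightarrow> p \<in> V \<Longrightarrow> p \<in> W \<Longrightarrow> V = W"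
  unfolding nc_blocks_def partition_on_def disjoint_def by blast

lemma nc_blocks_noncrossing:
  "nc_blocks \<pi> \<Longrightarrow> V \<in> \<pi> \<Longrightarrow> W \<in> \<pi> \<Longrightarrow> V \<noteq> W \<Longrightarrow>
    p \<in> V \<Longrightarrow> q \<in> W \<Longrightarrow> r \<in> V \<Longrightarrow> s \<in> W \<Longrightarrow> p < q \<Longrightarrow> q < r \<Longrightarrow> r < s \<Longrightarrow> False"
  unfolding nc_blocks_def noncrossing_def by blast

lemma nc_blocks_Union_diff: "nc_blocks \<pi> \<Longrightarrow> \<rho> \<subseteq> \<pi> \<Longrightarrow> \<Union>(\<pi> - \<rho>) = \<Union>\<pi> - \<Union>\<rho>"
  using nc_blocks_disjoint by fastforce

lemma nc_blocks_single: "finite W \<Longrightarrow> W \<noteq> {} \<Longrightarrow> nc_blocks {W}"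
  by (auto simp: nc_blocks_def partition_on_def noncrossing_def)

definition is_last_block :: "nat set set \<Rightarrow> nat set \<Rightarrow> bool"
  where "is_last_block \<pi> W \<longleftrightarrow> W \<in> \<pi> \<and> (\<forall>V\<in>\<pi>. V \<noteq> W \<longrightarrow> Min V < Min W)"

lemma is_last_block_ex:
  assumes "nc_blocks \<pi>" "\<pi> \<noteq> {}"
  shows "\<exists>W. is_last_block \<pi> W"
proof -
  have "Max (Min ` \<pi>) \<in> Min ` \<pi>" using assms nc_blocks_finite by (intro Max_in) auto
  then obtain W where W: "W \<in> \<pi>" "Max (Min ` \<pi>) = Min W" by auto
  have "Min V < Min W" if "V \<in> \<pi>" "V \<noteq> W" for V
  proof -
    have "Min V \<le> Min W" using that nc_blocks_finite[OF assms(1)] unfolding W(2)[symmetric] by simp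
    moreover have "Min V \<noteq> Min W"
      using that W(1) nc_blocks_block(3)[OF assms(1)] nc_blocks_disjoint[OF assms(1), of V W "Min V"]
      by auto
    ultimately show ?thesis by simp
  qed
  then show ?thesis using W by (auto simp: is_last_block_def)
qed

text \<open>A foreign point \<open>s\<close> inside the span of \<open>W\<close> would come from a
  block \<open>U\<close> with \<open>Min U < Min W < s < Max W\<close>, which is a crossing.\<close>

lemma is_last_block_interval:
  assumes nc: "nc_blocks \<pi>" and W: "is_last_block \<pi> W"
  shows "interval_block \<pi> W"
  unfolding interval_block_def
proof (intro conjI ballI impI)
  show "W \<in> \<pi>" using W by (simp add: is_last_block_def)
  then show "W \<noteq> {}" using nc nc_blocks_block by blast
  fix s assume "s \<in> \<Union>\<pi>" and s: "Min W \<le> s \<and> s \<le> Max W"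
  then obtain U where U: "U \<in> \<pi>" "s \<in> U" by blast
  show "s \<in> W"
  proof (rule ccontr)
    assume sW: "s \<notin> W"
    then have UW: "U \<noteq> W" using U by blast
    have "Min U < Min W" using U UW W by (auto simp: is_last_block_def)
    moreover have "s \<noteq> Min W" "s \<noteq> Max W" using sW nc_blocks_block(3,4)[OF nc \<open>W \<in> \<pi>\<close>] by metis+
    then have "Min W < s" "s < Max W" using s by auto
    ultimately show False
      using nc_blocks_noncrossing[OF nc \<open>U \<in> \<pi>\<close> \<open>W \<in> \<pi>\<close> UW, of "Min U" "Min W" s "Max W"]
        U nc_blocks_block[OF nc \<open>W \<in> \<pi>\<close>] nc_blocks_block[OF nc \<open>U \<in> \<pi>\<close>] by blast
  qed
qed

text \<open>The largest minimum among all blocks is attained at an interval block, so restricting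
  the \<open>arg_max\<close> to interval blocks does not change the winner.\<close>

lemma last_interval_block_eq:
  assumes nc: "nc_blocks \<pi>" and W: "is_last_block \<pi> W"
  shows "last_interval_block \<pi> = W"
proof -
  have i: "interval_block \<pi> W" using is_last_block_interval assms by blast
  then have L: "interval_block \<pi> (last_interval_block \<pi>)"
    using last_interval_block nc_blocks_finite[OF nc] by blast
  have "\<forall>V. interval_block \<pi> V \<longrightarrow> Min V < Suc (Min W)"
    using W by (auto simp: interval_block_def is_last_block_def less_Suc_eq)
  then have "Min W \<le> Min (last_interval_block \<pi>)"
    unfolding last_interval_block_def
    by (rule arg_max_nat_le[where P = "interval_block \<pi>" and f = Min, OF i])
  then show ?thesis using L W by (auto simp: interval_block_def is_last_block_def)
qed

text \<open>Induction along the recursion of \<open>cumulant_part\<close>. It stops at one block and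
  not at the empty partition, whose value is the dummy 0.\<close>

lemma nc_blocks_induct [consumes 2, case_names single remove]:
  assumes "nc_blocks \<pi>" "\<pi> \<noteq> {}"
    and "\<And>W. finite W \<Longrightarrow> W \<noteq> {} \<Longrightarrow> P {W}"
    and "\<And>\<pi> W. nc_blocks \<pi> \<Longrightarrow> is_last_block \<pi> W \<Longrightarrow> \<pi> \<noteq> {W} \<Longrightarrow> P (\<pi> - {W}) \<Longrightarrow> P \<pi>"
  shows "P \<pi>"
  using assms(1,2)
proof (induction "card \<pi>" arbitrary: \<pi> rule: less_induct)
  case less
  then obtain W where W: "is_last_block \<pi> W" using is_last_block_ex by blast
  then have "W \<in> \<pi>" by (simp add: is_last_block_def)
  show ?case
  proof (cases "\<pi> = {W}")
    case True
    then show ?thesis using assms(3)[of W] nc_blocks_block[OF less.prems(1) \<open>W \<in> \<pi>\<close>] by simp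
  next
    case False
    have "P (\<pi> - {W})"
    proof (rule less.hyps)
      show "card (\<pi> - {W}) < card \<pi>"
        using \<open>W \<in> \<pi>\<close> nc_blocks_finite[OF less.prems(1)] by (intro card_Diff1_less)
      show "nc_blocks (\<pi> - {W})" using nc_blocks_subset[OF less.prems(1)] by blast
      show "\<pi> - {W} \<noteq> {}" using False \<open>W \<in> \<pi>\<close> by blast
    qed
    then show ?thesis using assms(4)[OF less.prems(1) W False] by blast
  qed
qed

text \<open>When \<open>W\<close> is the block of largest minimum, this is the absorbing position
  \<open>p\<close> in the first branch of \<open>absorb\<close>.\<close>

definition entry_before :: "nat set set \<Rightarrow> nat set \<Rightarrow> nat"
  where "entry_before \<pi> W = Max {s\<in>\<Union>(\<pi> - {W}). s < Min W}"

lemma entry_before: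
  assumes nc: "nc_blocks \<pi>" and W: "is_last_block \<pi> W" "\<pi> \<noteq> {W}"
  shows "entry_before \<pi> W \<in> \<Union>(\<pi> - {W})" "entry_before \<pi> W < Min W"
    "\<exists>s\<in>\<Union>(\<pi> - {W}). s < Min W" "\<And>s. s \<in> \<Union>(\<pi> - {W}) \<Longrightarrow> s < Min W \<Longrightarrow> s \<le> entry_before \<pi> W"
proof -
  let ?S = "{s\<in>\<Union>(\<pi> - {W}). s < Min W}"
  have fin: "finite ?S" by (rule finite_subset[of _ "{..<Min W}"]) auto
  have "W \<in> \<pi>" using W by (simp add: is_last_block_def)
  then obtain V where V: "V \<in> \<pi>" "V \<noteq> W" using W(2) by blast
  then have "Min V < Min W" using W(1) by (simp add: is_last_block_def)
  then have "Min V \<in> ?S" using V nc_blocks_block(3)[OF nc V(1)] by blast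
  then have "?S \<noteq> {}" by blast
  then have "entry_before \<pi> W \<in> ?S" unfolding entry_before_def using fin by (rule Max_in[rotated])
  then show "entry_before \<pi> W \<in> \<Union>(\<pi> - {W})" "entry_before \<pi> W < Min W"
    "\<exists>s\<in>\<Union>(\<pi> - {W}). s < Min W" by blast+
  show "s \<le> entry_before \<pi> W" if "s \<in> \<Union>(\<pi> - {W})" "s < Min W" for s
    unfolding entry_before_def using that fin by (intro Max_ge) auto
qed

lemma entry_before_eqI:
  assumes nc: "nc_blocks \<pi>" and W: "is_last_block \<pi> W" "\<pi> \<noteq> {W}"
    and "p \<in> \<Union>(\<pi> - {W})" "p < Min W" "\<And>s. s \<in> \<Union>(\<pi> - {W}) \<Longrightarrow> s < Min W \<Longrightarrow> s \<le> p"
  shows "entry_before \<pi> W = p"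
  using assms entry_before[OF nc W] by (meson antisym)

section \<open>Evaluation by removal of blocks\<close>

lemma cumulant_part_single:
  assumes "finite W" "W \<noteq> {}"
  shows "cumulant_part m \<kappa> {W} a = \<kappa> (map a (sorted_list_of_set W))"
proof -
  have nc: "nc_blocks {W}" using assms by (rule nc_blocks_single)
  have W: "is_last_block {W} W" by (simp add: is_last_block_def)
  have "interval_block {W} W" by (rule is_last_block_interval[OF nc W])
  then have ex: "\<exists>V. interval_block {W} V" by blast
  show ?thesis
    by (subst cumulant_part.simps) (simp add: ex last_interval_block_eq[OF nc W] Let_def)
qed

text \<open>Blocks of a non-crossing partition are removed in the order of decreasing minima, so that there
  always is a preceding entry.\<close>

lemma cumulant_part_remove:
  assumes nc: "nc_blocks \<pi>" and W: "is_last_block \<pi> W" "\<pi> \<noteq> {W}"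
  shows "cumulant_part m \<kappa> \<pi> a = cumulant_part m \<kappa> (\<pi> - {W})
    (a(entry_before \<pi> W := m (a (entry_before \<pi> W)) (\<kappa> (map a (sorted_list_of_set W)))))"
proof -
  have ex: "\<exists>V. interval_block \<pi> V" using is_last_block_interval[OF nc W(1)] by blast
  show ?thesis
    using entry_before(3)[OF assms] W(2) nc_blocks_finite[OF nc]
    by (subst cumulant_part.simps)
      (simp add: ex last_interval_block_eq[OF nc W(1)] Let_def absorb_def entry_before_def)
qed

lemma cumulant_part_empty: "cumulant_part m \<kappa> {} a = 0"
proof -
  have "\<not> (\<exists>V. interval_block {} V)" by (simp add: interval_block_def)
  then show ?thesis by (subst cumulant_part.simps) (simp only: simp_thms if_False)
qed

lemma cumulant_part_entries_cong:
  assumes "nc_blocks \<pi>" "\<And>p. p \<in> \<Union>\<pi> \<Longrightarrow> a p = a' p"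
  shows "cumulant_part m \<kappa> \<pi> a = cumulant_part m \<kappa> \<pi> a'"
proof (cases "\<pi> = {}")
  case True
  then show ?thesis by (simp add: cumulant_part_empty)
next
  case False
  with assms(1) show ?thesis using assms(2)
  proof (induction arbitrary: a a' rule: nc_blocks_induct)
    case (single W)
    then have "map a (sorted_list_of_set W) = map a' (sorted_list_of_set W)" by simp
    then show ?case using single.hyps by (simp add: cumulant_part_single del: map_eq_conv)
  next
    case (remove \<pi> W)
    have "W \<in> \<pi>" using remove by (simp add: is_last_block_def)
    then have l: "map a (sorted_list_of_set W) = map a' (sorted_list_of_set W)"
      using remove.prems nc_blocks_block(1)[OF remove.hyps(1)] by auto
    have "a (entry_before \<pi> W) = a' (entry_before \<pi> W)"
      using entry_before(1)[OF remove.hyps(1-3)] by (intro remove.prems) blast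
    then show ?case
      unfolding cumulant_part_remove[OF remove.hyps(1-3)] l
      using remove.prems by (intro remove.IH) auto
  qed
qed

text \<open>\<open>\<rho>\<close> fills a gap directly after position \<open>v\<close>. Every other
  block starts at or before \<open>v\<close>, so the blocks of \<open>\<rho>\<close> are removed
  before all of them. Their values are absorbed inside the gap until one block is left, and that
  block finds \<open>v\<close> as its preceding entry. What reaches \<open>v\<close> is thus the
  value of \<open>\<rho>\<close> on its own.\<close>

lemma cumulant_part_gap:
  assumes "nc_blocks \<rho>" "\<rho> \<noteq> {}" "nc_blocks \<pi>" "\<rho> \<subseteq> \<pi>" "v \<in> \<Union>(\<pi> - \<rho>)"
    and "\<And>g. g \<in> \<Union>\<rho> \<Longrightarrow> v < g" "\<And>V. V \<in> \<pi> - \<rho> \<Longrightarrow> Min V \<le> v"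
    and "\<And>s g. s \<in> \<Union>(\<pi> - \<rho>) \<Longrightarrow> v < s \<Longrightarrow> g \<in> \<Union>\<rho> \<Longrightarrow> g < s"
  shows "cumulant_part m \<kappa> \<pi> a
    = cumulant_part m \<kappa> (\<pi> - \<rho>) (a(v := m (a v) (cumulant_part m \<kappa> \<rho> a)))"
  using assms
proof (induction arbitrary: \<pi> a rule: nc_blocks_induct)
  case (single W)
  have W: "is_last_block \<pi> W"
    unfolding is_last_block_def
  proof (intro conjI ballI impI)
    show "W \<in> \<pi>" using single.prems(2) by blast
    fix V assume "V \<in> \<pi>" "V \<noteq> W"
    then have "Min V \<le> v" by (intro single.prems(5)) blast
    also have "v < Min W" using single.hyps by (intro single.prems(4)) simp
    finally show "Min V < Min W" .
  qed
  have ne: "\<pi> \<noteq> {W}" using single.prems by auto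
  have "entry_before \<pi> W = v"
  proof (rule entry_before_eqI[OF single.prems(1) W ne])
    show "v \<in> \<Union>(\<pi> - {W})" by (rule single.prems(3))
    show "v < Min W" using single.hyps by (intro single.prems(4)) simp
    fix s assume s: "s \<in> \<Union>(\<pi> - {W})" "s < Min W"
    show "s \<le> v"
    proof (rule ccontr)
      assume "\<not> s \<le> v"
      then have "Min W < s" using single.prems(6)[OF s(1), of "Min W"] single.hyps by simp
      then show False using s(2) by simp
    qed
  qed
  then show ?case
    using single.hyps by (simp add: cumulant_part_remove[OF single.prems(1) W ne] cumulant_part_single fun_upd_def)
next
  case (remove \<rho> W)
  note nc = remove.prems(1)
  have "W \<in> \<rho>" using remove.hyps by (simp add: is_last_block_def)
  then have WW: "W \<in> \<rho>" "W \<in> \<pi>" using remove.prems(2) by auto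
  have minW: "Min W \<in> \<Union>\<rho>" using WW nc_blocks_block[OF nc WW(2)] by blast
  have W: "is_last_block \<pi> W"
    unfolding is_last_block_def
  proof (intro conjI ballI impI)
    fix V assume V: "V \<in> \<pi>" "V \<noteq> W"
    show "Min V < Min W"
    proof (cases "V \<in> \<rho>")
      case True
      then show ?thesis using remove.hyps(2) V by (simp add: is_last_block_def)
    next
      case False
      then show ?thesis using V remove.prems(5)[of V] remove.prems(4)[OF minW] by simp
    qed
  qed (rule WW)
  have ne: "\<pi> \<noteq> {W}" using remove.hyps(3) remove.prems(2) WW by blast
  define p where "p = entry_before \<rho> W"
  note p = entry_before[OF remove.hyps(1-3), folded p_def]
  have vp: "v < p" using p(1) by (intro remove.prems(4)) auto
  \<comment> \<open>The updated entry lies in the gap, so what remains outside the gap sees only the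
    update at \<open>v\<close>.\<close>
  have pp: "p \<notin> \<Union>(\<pi> - \<rho>)"
    using p(1) nc_blocks_Union_diff[OF nc remove.prems(2)] by auto
  have "entry_before \<pi> W = p"
  proof (rule entry_before_eqI[OF nc W ne])
    show "p \<in> \<Union>(\<pi> - {W})" "p < Min W" using p remove.prems(2) by auto
    fix s assume s: "s \<in> \<Union>(\<pi> - {W})" "s < Min W"
    show "s \<le> p"
    proof (cases "s \<in> \<Union>(\<rho> - {W})")
      case True
      then show ?thesis using p(4) s by blast
    next
      case False
      then have "s \<in> \<Union>(\<pi> - \<rho>)" using s by blast
      \<comment> \<open>A point outside the gap and beyond \<open>v\<close> would lie beyond all of
        \<open>\<rho>\<close>, in particular beyond \<open>Min W\<close>.\<close>
      then have "\<not> v < s" using remove.prems(6)[of s "Min W"] minW s by fastforce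
      then show ?thesis using vp by simp
    qed
  qed
  define v1 where "v1 = \<kappa> (map a (sorted_list_of_set W))"
  define a' where "a' = a(p := m (a p) v1)"
  have diff: "\<pi> - {W} - (\<rho> - {W}) = \<pi> - \<rho>" using WW by blast
  have "cumulant_part m \<kappa> \<pi> a = cumulant_part m \<kappa> (\<pi> - {W}) a'"
    using \<open>entry_before \<pi> W = p\<close> by (simp add: cumulant_part_remove[OF nc W ne] a'_def v1_def)
  also have "\<dots> = cumulant_part m \<kappa> (\<pi> - {W} - (\<rho> - {W}))
      (a'(v := m (a' v) (cumulant_part m \<kappa> (\<rho> - {W}) a')))"
  proof (rule remove.IH)
    show "nc_blocks (\<pi> - {W})" using nc_blocks_subset[OF nc] by blast
    show "\<rho> - {W} \<subseteq> \<pi> - {W}" using remove.prems(2) by blast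
    show "v \<in> \<Union>(\<pi> - {W} - (\<rho> - {W}))" unfolding diff by (rule remove.prems(3))
    show "v < g" if "g \<in> \<Union>(\<rho> - {W})" for g using that by (intro remove.prems(4)) blast
    show "Min V \<le> v" if "V \<in> \<pi> - {W} - (\<rho> - {W})" for V
      using that unfolding diff by (rule remove.prems(5))
    show "g < s" if "s \<in> \<Union>(\<pi> - {W} - (\<rho> - {W}))" "v < s" "g \<in> \<Union>(\<rho> - {W})" for s g
    proof (rule remove.prems(6))
      show "s \<in> \<Union>(\<pi> - \<rho>)" using that(1) unfolding diff .
      show "g \<in> \<Union>\<rho>" using that(3) by blast
    qed (rule that(2))
  qed
  also have "cumulant_part m \<kappa> (\<rho> - {W}) a' = cumulant_part m \<kappa> \<rho> a"
    by (simp add: cumulant_part_remove[OF remove.hyps(1-3)] a'_def v1_def flip: p_def)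
  also have "a' v = a v" using vp by (simp add: a'_def)
  also have "cumulant_part m \<kappa> (\<pi> - {W} - (\<rho> - {W})) (a'(v := m (a v) (cumulant_part m \<kappa> \<rho> a)))
      = cumulant_part m \<kappa> (\<pi> - \<rho>) (a(v := m (a v) (cumulant_part m \<kappa> \<rho> a)))"
    unfolding diff
    using pp by (intro cumulant_part_entries_cong nc_blocks_subset[OF nc]) (auto simp: a'_def)
  finally show ?case .
qed

text \<open>\<open>R\<close> holds entries and \<open>S\<close> holds values of blocks; absorption
  keeps the entries in \<open>R\<close> because \<open>R\<close> is stable under right
  multiplication by \<open>S\<close>.\<close>

lemma cumulant_part_closed:
  assumes "nc_blocks \<pi>" "\<pi> \<noteq> {}" "\<And>p. p \<in> \<Union>\<pi> \<Longrightarrow> a p \<in> R"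
    and "\<And>V bs. V \<in> \<pi> \<Longrightarrow> length bs = card V \<Longrightarrow> set bs \<subseteq> R \<Longrightarrow> \<kappa> bs \<in> S"
    and "\<And>r s. r \<in> R \<Longrightarrow> s \<in> S \<Longrightarrow> m r s \<in> R"
  shows "cumulant_part m \<kappa> \<pi> a \<in> S"
  using assms(1-4)
proof (induction arbitrary: a rule: nc_blocks_induct)
  case (single W)
  have "\<kappa> (map a (sorted_list_of_set W)) \<in> S"
    using single by (intro single.prems(2)[of W]) auto
  then show ?case using single.hyps by (simp add: cumulant_part_single)
next
  case (remove \<pi> W)
  have W: "W \<in> \<pi>" using remove by (simp add: is_last_block_def)
  then have "\<kappa> (map a (sorted_list_of_set W)) \<in> S"
    using nc_blocks_block[OF remove.hyps(1) W] remove.prems(1)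
    by (intro remove.prems(2)[OF W]) auto
  moreover have "entry_before \<pi> W \<in> \<Union>\<pi>"
    using entry_before(1)[OF remove.hyps(1-3)] by blast
  ultimately have R: "m (a (entry_before \<pi> W)) (\<kappa> (map a (sorted_list_of_set W))) \<in> R"
    using remove.prems(1) assms(5) by blast
  show ?case
    unfolding cumulant_part_remove[OF remove.hyps(1-3)]
    using R remove.prems by (intro remove.IH) auto
qed

text \<open>The block of the first position \<open>f\<close> has the smallest minimum, so it is
  evaluated last. By then absorption may have changed its entries, but the first one is still in
  \<open>X\<close> and the others are in \<open>R\<close>, so the value is one of
  \<open>\<kappa>\<close> at a list of this shape. With \<open>Z = {0}\<close> this makes the
  contribution of a whole partition vanish.\<close>

lemma cumulant_part_first_block:
  assumes "nc_blocks \<pi>" "\<pi> \<noteq> {}" "V \<in> \<pi>" "f \<in> V" "\<And>p. p \<in> \<Union>\<pi> \<Longrightarrow> f \<le> p"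
    and "a f \<in> X" "\<And>p. p \<in> \<Union>\<pi> \<Longrightarrow> p \<noteq> f \<Longrightarrow> a p \<in> R"
    and "\<And>W bs. W \<in> \<pi> \<Longrightarrow> W \<noteq> V \<Longrightarrow> length bs = card W \<Longrightarrow> set bs \<subseteq> R \<Longrightarrow> \<kappa> bs \<in> S"
    and "\<And>\<xi> bs. \<xi> \<in> X \<Longrightarrow> length (\<xi> # bs) = card V \<Longrightarrow> set bs \<subseteq> R \<Longrightarrow> \<kappa> (\<xi> # bs) \<in> Z"
    and "\<And>r s. r \<in> R \<Longrightarrow> s \<in> S \<Longrightarrow> m r s \<in> R" "\<And>r s. r \<in> X \<Longrightarrow> s \<in> S \<Longrightarrow> m r s \<in> X"
  shows "cumulant_part m \<kappa> \<pi> a \<in> Z"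
  using assms(1-8)
proof (induction arbitrary: a rule: nc_blocks_induct)
  case (single W)
  then have V: "V = W" by simp
  define bs where "bs = sorted_list_of_set (W - {f})"
  have "Min W = f" using single V by (intro Min_eqI) auto
  then have l: "sorted_list_of_set W = f # bs"
    using sorted_list_of_set_nonempty[of W] single by (simp add: bs_def)
  have "set bs = W - {f}" using single by (simp add: bs_def)
  have "\<kappa> (a f # map a bs) \<in> Z"
  proof (rule assms(9))
    have "length (sorted_list_of_set W) = card W" by simp
    then show "length (a f # map a bs) = card V" unfolding l V by simp
    show "set (map a bs) \<subseteq> R" using \<open>set bs = _\<close> single.prems by auto
  qed (rule single.prems)
  then show ?case using single.hyps by (simp add: cumulant_part_single l)
next
  case (remove \<pi> W)
  have W: "W \<in> \<pi>" using remove by (simp add: is_last_block_def)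
  have min_f: "Min V = f"
    using nc_blocks_block[OF remove.hyps(1) \<open>V \<in> \<pi>\<close>] remove.prems(1-3) by (intro Min_eqI) auto
  have "W \<noteq> V"
  proof
    assume WV: "W = V"
    obtain U where U: "U \<in> \<pi>" "U \<noteq> W" using remove.hyps(3) W by blast
    then have "Min U < f" using remove.hyps(2) WV min_f by (auto simp: is_last_block_def)
    moreover have "f \<le> Min U" using U nc_blocks_block[OF remove.hyps(1) U(1)] remove.prems(3) by blast
    ultimately show False by simp
  qed
  have fW: "f \<notin> W" using nc_blocks_disjoint[OF remove.hyps(1) W \<open>V \<in> \<pi>\<close>] \<open>W \<noteq> V\<close> \<open>f \<in> V\<close> by blast
  then have "\<kappa> (map a (sorted_list_of_set W)) \<in> S"
    using nc_blocks_block[OF remove.hyps(1) W] remove.prems(5) W \<open>W \<noteq> V\<close>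
    by (intro remove.prems(6)[OF W \<open>W \<noteq> V\<close>]) auto
  moreover define v where "v = \<kappa> (map a (sorted_list_of_set W))"
  moreover define p where "p = entry_before \<pi> W"
  ultimately have vS: "v \<in> S" by simp
  have p: "p \<in> \<Union>\<pi>" using entry_before(1)[OF remove.hyps(1-3)] by (auto simp: p_def)
  have "cumulant_part m \<kappa> (\<pi> - {W}) (a(p := m (a p) v)) \<in> Z"
  proof (rule remove.IH)
    show "V \<in> \<pi> - {W}" "f \<in> V" using remove.prems \<open>W \<noteq> V\<close> by auto
    show "f \<le> q" if "q \<in> \<Union>(\<pi> - {W})" for q using that remove.prems(3) by blast
    show "(a(p := m (a p) v)) f \<in> X" using remove.prems(4) assms(11)[OF remove.prems(4) vS] by auto
    show "(a(p := m (a p) v)) q \<in> R" if "q \<in> \<Union>(\<pi> - {W})" "q \<noteq> f" for q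
    proof -
      have "q \<in> \<Union>\<pi>" using that by blast
      then show ?thesis using remove.prems(5)[of q] assms(10)[OF _ vS] that by auto
    qed
    show "\<kappa> bs \<in> S" if "U \<in> \<pi> - {W}" "U \<noteq> V" "length bs = card U" "set bs \<subseteq> R" for U bs
      using that remove.prems(6) by blast
  qed
  then show ?case
    unfolding cumulant_part_remove[OF remove.hyps(1-3)] p_def v_def .
qed

section \<open>Relabelling of positions\<close>

lemma sorted_list_of_set_image_strict_mono:
  fixes f :: "nat \<Rightarrow> nat"
  assumes "strict_mono f" "finite A"
  shows "sorted_list_of_set (f ` A) = map f (sorted_list_of_set A)"
proof -
  have "sorted (map f (sorted_list_of_set A))"
    using assms by (simp add: sorted_map strict_mono_less_eq)
  moreover have "distinct (map f (sorted_list_of_set A))"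
    using assms strict_mono_imp_inj_on[OF assms(1)] by (simp add: distinct_map inj_on_subset)
  moreover have "set (map f (sorted_list_of_set A)) = f ` A" using assms by simp
  ultimately show ?thesis by (metis sorted_list_of_set.idem_if_sorted_distinct)
qed

lemma noncrossing_image:
  assumes "strict_mono (f :: nat \<Rightarrow> nat)"
  shows "noncrossing ((`) f ` \<pi>) \<longleftrightarrow> noncrossing \<pi>"
  using strict_mono_imp_inj_on[OF assms]
  by (auto simp: noncrossing_def inj_image_eq_iff strict_mono_less[OF assms])

lemma partition_on_image:
  assumes "inj f"
  shows "partition_on (f ` A) ((`) f ` \<pi>) \<longleftrightarrow> partition_on A \<pi>"
proof -
  have "\<Union> ((`) f ` \<pi>) = f ` A \<longleftrightarrow> \<Union>\<pi> = A"
    using assms by (metis image_Union inj_image_eq_iff)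
  moreover have "disjoint ((`) f ` \<pi>) \<longleftrightarrow> disjoint \<pi>"
    using assms by (auto simp: disjoint_def image_Int[symmetric] inj_image_eq_iff)
  moreover have "{} \<in> (`) f ` \<pi> \<longleftrightarrow> {} \<in> \<pi>" by (auto simp: image_iff)
  ultimately show ?thesis by (auto simp: partition_on_def)
qed

lemma nc_blocks_image:
  assumes "strict_mono (f :: nat \<Rightarrow> nat)" "nc_blocks \<pi>"
  shows "nc_blocks ((`) f ` \<pi>)"
proof -
  have "inj f" using assms strict_mono_imp_inj_on by blast
  then have "partition_on (f ` \<Union>\<pi>) ((`) f ` \<pi>)"
    using assms partition_on_image by (auto simp: nc_blocks_def)
  moreover have "\<Union>((`) f ` \<pi>) = f ` \<Union>\<pi>" by blast
  ultimately show ?thesis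
    using assms(2) noncrossing_image[OF assms(1)] by (simp add: nc_blocks_def)
qed

lemma Min_image_strict_mono: "strict_mono f \<Longrightarrow> finite A \<Longrightarrow> A \<noteq> {} \<Longrightarrow> Min (f ` A) = f (Min A)"
  for f :: "nat \<Rightarrow> nat"
  using mono_Min_commute strict_mono_mono by metis

text \<open>The recursion only compares positions, and a strictly increasing \<open>f\<close>
  preserves all comparisons. It is used for shifts, to bring a gap to the form
  \<open>{1..n}\<close>.\<close>

lemma cumulant_part_image:
  assumes f: "strict_mono (f :: nat \<Rightarrow> nat)" and "nc_blocks \<pi>" "\<pi> \<noteq> {}"
  shows "cumulant_part m \<kappa> ((`) f ` \<pi>) a = cumulant_part m \<kappa> \<pi> (\<lambda>p. a (f p))"
  using assms(2,3)
proof (induction arbitrary: a rule: nc_blocks_induct)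
  case (single W)
  then show ?case
    by (simp add: cumulant_part_single sorted_list_of_set_image_strict_mono[OF f] comp_def)
next
  case (remove \<pi> W)
  let ?F = "(`) f"
  have inj: "inj f" using f strict_mono_imp_inj_on by blast
  have injF: "inj ?F" using inj by (simp add: inj_image_eq_iff inj_on_def)
  note nc = nc_blocks_image[OF f remove.hyps(1)]
  have W: "W \<in> \<pi>" using remove by (simp add: is_last_block_def)
  have finW: "finite W" "W \<noteq> {}" using nc_blocks_block[OF remove.hyps(1) W] by auto
  have mW: "Min (f ` W) = f (Min W)" using Min_image_strict_mono[OF f] finW by blast
  have diff: "?F ` \<pi> - {f ` W} = ?F ` (\<pi> - {W})"
    using injF by (simp add: image_set_diff)
  have last: "is_last_block (?F ` \<pi>) (f ` W)"
    using remove.hyps(2) nc_blocks_block[OF remove.hyps(1)]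
    by (auto simp: is_last_block_def mW Min_image_strict_mono[OF f] strict_mono_less[OF f])
  have ne: "?F ` \<pi> \<noteq> {f ` W}"
  proof
    assume "?F ` \<pi> = {f ` W}"
    then have "\<pi> - {W} = {}" using diff by simp
    then show False using W remove.hyps(3) by blast
  qed
  define p where "p = entry_before \<pi> W"
  note p = entry_before[OF remove.hyps(1-3), folded p_def]
  have eb: "entry_before (?F ` \<pi>) (f ` W) = f p"
  proof (rule entry_before_eqI[OF nc last ne])
    show "f p \<in> \<Union>(?F ` \<pi> - {f ` W})" using p(1) unfolding diff by blast
    show "f p < Min (f ` W)" using p(2) by (simp add: mW strict_mono_less[OF f])
    fix s assume s: "s \<in> \<Union>(?F ` \<pi> - {f ` W})" "s < Min (f ` W)"
    then obtain t where t: "s = f t" "t \<in> \<Union>(\<pi> - {W})" unfolding diff by blast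
    then show "s \<le> f p"
      using s(2) p(4)[of t] by (simp add: mW strict_mono_less[OF f] strict_mono_less_eq[OF f])
  qed
  have upd: "(\<lambda>q. (a(f p := y)) (f q)) = (\<lambda>q. a (f q))(p := y)" for y
    using inj by (auto simp: inj_eq)
  show ?case
    unfolding cumulant_part_remove[OF remove.hyps(1-3)] cumulant_part_remove[OF nc last ne] diff eb
      remove.IH upd p_def[symmetric] sorted_list_of_set_image_strict_mono[OF f finW(1)]
    by (simp add: comp_def)
qed

section \<open>Non-crossing partitions of intervals and of the gaps of a pair\<close>

definition NC_on :: "nat set \<Rightarrow> nat set set set"
  where "NC_on A = {\<pi>. partition_on A \<pi> \<and> noncrossing \<pi>}"

lemma NC_eq_NC_on: "NC d = NC_on {1..d}"
  by (simp add: NC_def NC_on_def)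

lemma NC_on_nc_blocks: "finite A \<Longrightarrow> \<pi> \<in> NC_on A \<Longrightarrow> nc_blocks \<pi>"
  by (auto simp: NC_on_def nc_blocks_def partition_on_def)

lemma NC_on_Union: "\<pi> \<in> NC_on A \<Longrightarrow> \<Union>\<pi> = A"
  by (auto simp: NC_on_def partition_on_def)

lemma NC_on_empty: "NC_on {} = {{}}"
  by (auto simp: NC_on_def noncrossing_def partition_on_def)

lemma finite_NC_on: "finite A \<Longrightarrow> finite (NC_on A)"
  by (rule finite_subset[of _ "Pow (Pow A)"]) (auto simp: NC_on_def partition_on_def)

lemma NC_on_image:
  assumes f: "strict_mono (f :: nat \<Rightarrow> nat)"
  shows "NC_on (f ` A) = (`) ((`) f) ` NC_on A"
proof (intro equalityI subsetI)
  have inj: "inj f" using f strict_mono_imp_inj_on by blast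
  fix \<pi> assume "\<pi> \<in> (`) ((`) f) ` NC_on A"
  then show "\<pi> \<in> NC_on (f ` A)"
    by (auto simp: NC_on_def noncrossing_image[OF f] partition_on_image[OF inj])
next
  have inj: "inj f" using f strict_mono_imp_inj_on by blast
  fix \<pi> assume \<pi>: "\<pi> \<in> NC_on (f ` A)"
  then have "\<pi> \<subseteq> Pow (f ` A)" by (auto simp: NC_on_def partition_on_def)
  then have "\<pi> \<subseteq> (`) f ` UNIV" using subset_image_iff by (metis PowD rangeI subsetD subsetI)
  then obtain \<sigma> where "\<pi> = (`) f ` \<sigma>" by (meson subset_image_iff)
  then show "\<pi> \<in> (`) ((`) f) ` NC_on A"
    using \<pi> by (auto simp: NC_on_def noncrossing_image[OF f] partition_on_image[OF inj])
qed

text \<open>A shift turns the moment-cumulant formula into one for any interval of positions; this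
  is how the partitions of a gap sum to a conditional expectation. An empty interval is excluded,
  since its one partition has the dummy value 0.\<close>

lemma sum_cumulant_part_interval:
  assumes "0 < n"
  shows "(\<Sum>\<rho>\<in>NC_on {l<..l + n}. cumulant_part m (cumulant m E) \<rho> a)
    = E (list_product m (map (\<lambda>p. a (l + p)) [1..<Suc n]))"
proof -
  define f where "f = (\<lambda>p. l + p :: nat)"
  have f: "strict_mono f" by (simp add: f_def strict_mono_def)
  then have inj: "inj f" using strict_mono_imp_inj_on by blast
  have im: "f ` {1..n} = {l<..l + n}"
    by (auto simp: f_def image_iff intro: bexI[of _ "x - l" for x])
  define as where "as = map (\<lambda>p. a (l + p)) [1..<Suc n]"
  have len: "length as = n" by (simp add: as_def)
  have injF: "inj_on ((`) ((`) f)) (NC_on {1..n})"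
    using inj by (simp add: inj_on_def inj_image_eq_iff)
  have "(\<Sum>\<rho>\<in>NC_on {l<..l + n}. cumulant_part m (cumulant m E) \<rho> a)
      = (\<Sum>\<pi>\<in>NC_on {1..n}. cumulant_part m (cumulant m E) ((`) f ` \<pi>) a)"
    unfolding im[symmetric] NC_on_image[OF f] by (subst sum.reindex[OF injF]) simp
  also have "\<dots> = (\<Sum>\<pi>\<in>NC n. cumulant_part m (cumulant m E) \<pi> (\<lambda>p. as ! (p - 1)))"
    unfolding NC_eq_NC_on
  proof (rule sum.cong[OF refl])
    fix \<pi> assume \<pi>: "\<pi> \<in> NC_on {1..n}"
    then have nc: "nc_blocks \<pi>" by (rule NC_on_nc_blocks[rotated]) simp
    have U: "\<Union>\<pi> = {1..n}" using NC_on_Union[OF \<pi>] .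
    then have "\<pi> \<noteq> {}" using assms by auto
    then have "cumulant_part m (cumulant m E) ((`) f ` \<pi>) a = cumulant_part m (cumulant m E) \<pi> (\<lambda>p. a (f p))"
      by (rule cumulant_part_image[OF f nc])
    also have "\<dots> = cumulant_part m (cumulant m E) \<pi> (\<lambda>p. as ! (p - 1))"
      by (rule cumulant_part_entries_cong[OF nc]) (auto simp: U as_def f_def simp del: upt_Suc)
    finally show "cumulant_part m (cumulant m E) ((`) f ` \<pi>) a = \<dots>" .
  qed
  also have "\<dots> = E (list_product m as)"
    using moment_cumulant[of as E m] len assms by auto
  finally show ?thesis by (simp only: as_def)
qed

lemma partition_on_Un:
  assumes "partition_on A P" "partition_on B Q" "A \<inter> B = {}"
  shows "partition_on (A \<union> B) (P \<union> Q)"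
  using assms disjoint_union[of P Q] by (simp add: partition_on_def)

text \<open>A block other than \<open>{1, k}\<close> with points on both sides of \<open>k\<close>
  would cross the pair. So the rest of the partition splits into the two gaps, and the partitions of
  the gaps can be chosen independently.\<close>

lemma NC_on_first_block_pair:
  assumes "2 \<le> k" "k \<le> n"
  shows "bij_betw (\<lambda>(\<rho>, \<sigma>). insert {1, k} (\<rho> \<union> \<sigma>)) (NC_on {1<..<k} \<times> NC_on {k<..n})
    {\<pi> \<in> NC_on {1..n}. {1, k} \<in> \<pi>}"
proof -
  define K where "K = {1, k}"
  have K: "1 \<in> K" "k \<in> K" "K \<noteq> {}" and K_D: "\<And>t. t \<in> K \<Longrightarrow> t = 1 \<or> t = k"
    by (auto simp: K_def)
  have nK: "\<not> K \<subseteq> {1<..<k}" "\<not> K \<subseteq> {k<..n}" using assms by (auto simp: K_def)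
  let ?f = "\<lambda>(\<rho>, \<sigma>). insert K (\<rho> \<union> \<sigma>)"
  let ?g = "\<lambda>\<pi>. ({W\<in>\<pi>. W \<subseteq> {1<..<k}}, {W\<in>\<pi>. W \<subseteq> {k<..n}})"
  have gf: "?g (?f p) = p" if p0: "p \<in> NC_on {1<..<k} \<times> NC_on {k<..n}" for p
  proof -
    obtain \<rho> \<sigma> where p: "p = (\<rho>, \<sigma>)" "\<rho> \<in> NC_on {1<..<k}" "\<sigma> \<in> NC_on {k<..n}"
      using p0 by blast
    have \<rho>: "W \<subseteq> {1<..<k}" "W \<noteq> {}" if "W \<in> \<rho>" for W
      using p that by (auto simp: NC_on_def partition_on_def)
    have \<sigma>: "W \<subseteq> {k<..n}" "W \<noteq> {}" if "W \<in> \<sigma>" for W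
      using p that by (auto simp: NC_on_def partition_on_def)
    have disj: "W = {}" if "W \<subseteq> {1<..<k}" "W \<subseteq> {k<..n}" for W using that by fastforce
    have "\<not> W \<subseteq> {1<..<k}" if "W \<in> \<sigma>" for W using \<sigma>[OF that] disj by blast
    then have "{W \<in> insert K (\<rho> \<union> \<sigma>). W \<subseteq> {1<..<k}} = \<rho>"
      using \<rho>(1) nK(1) by blast
    moreover have "\<not> W \<subseteq> {k<..n}" if "W \<in> \<rho>" for W using \<rho>[OF that] disj by blast
    then have "{W \<in> insert K (\<rho> \<union> \<sigma>). W \<subseteq> {k<..n}} = \<sigma>"
      using \<sigma>(1) nK(2) by blast
    ultimately show ?thesis by (simp add: p)
  qed
  have f: "?f p \<in> {\<pi> \<in> NC_on {1..n}. K \<in> \<pi>}" if p0: "p \<in> NC_on {1<..<k} \<times> NC_on {k<..n}" for p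
  proof -
    obtain \<rho> \<sigma> where p: "p = (\<rho>, \<sigma>)" "\<rho> \<in> NC_on {1<..<k}" "\<sigma> \<in> NC_on {k<..n}"
      using p0 by blast
    have \<rho>: "W \<subseteq> {1<..<k}" if "W \<in> \<rho>" for W
      using p that by (auto simp: NC_on_def partition_on_def)
    have \<sigma>: "W \<subseteq> {k<..n}" if "W \<in> \<sigma>" for W
      using p that by (auto simp: NC_on_def partition_on_def)
    have pr: "partition_on {1<..<k} \<rho>" and ps: "partition_on {k<..n} \<sigma>"
      using p by (auto simp: NC_on_def)
    have prs: "partition_on ({1<..<k} \<union> {k<..n}) (\<rho> \<union> \<sigma>)"
      by (rule partition_on_Un[OF pr ps]) auto
    have "K \<inter> ({1<..<k} \<union> {k<..n}) = {}" using assms by (auto simp: K_def)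
    then have "partition_on (K \<union> ({1<..<k} \<union> {k<..n})) ({K} \<union> (\<rho> \<union> \<sigma>))"
      by (rule partition_on_Un[OF partition_on_space[OF K(3)] prs])
    moreover have "K \<union> ({1<..<k} \<union> {k<..n}) = {1..n}" using assms by (auto simp: K_def)
    moreover have "noncrossing (insert K (\<rho> \<union> \<sigma>))"
      unfolding noncrossing_def
    proof (intro ballI impI notI)
      fix V W assume VW: "V \<in> insert K (\<rho> \<union> \<sigma>)" "W \<in> insert K (\<rho> \<union> \<sigma>)" "V \<noteq> W"
        and "\<exists>p\<in>V. \<exists>q\<in>W. \<exists>r\<in>V. \<exists>s\<in>W. p < q \<and> q < r \<and> r < s"
      then obtain p' q r s where c: "p' \<in> V" "q \<in> W" "r \<in> V" "s \<in> W" "p' < q" "q < r" "r < s" by blast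
      have nc: "noncrossing \<rho>" "noncrossing \<sigma>" using p by (auto simp: NC_on_def)
      have \<rho>': "1 < t" "t < k" if "t \<in> U" "U \<in> \<rho>" for t U using \<rho> that by fastforce+
      have \<sigma>': "k < t" if "t \<in> U" "U \<in> \<sigma>" for t U using \<sigma> that by fastforce
      have nr: "\<not> (V \<in> \<rho> \<and> W \<in> \<rho>)" using nc(1) VW(3) c unfolding noncrossing_def by blast
      have ns: "\<not> (V \<in> \<sigma> \<and> W \<in> \<sigma>)" using nc(2) VW(3) c unfolding noncrossing_def by blast
      \<comment> \<open>\<open>q\<close> lies strictly between two points of \<open>V\<close>. If
        \<open>V\<close> is the pair, this separates \<open>q\<close> from \<open>s\<close>,
        although both are in \<open>W\<close>; if \<open>V\<close> lies in a gap, it forces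
        \<open>W\<close> into the same gap.\<close>
      consider "V = K" | "V \<in> \<rho>" | "V \<in> \<sigma>" using VW(1) by blast
      then show False
      proof cases
        case 1
        have "1 \<le> q" using VW(2) c(2) \<rho>' \<sigma>' K_D assms by fastforce
        then have "p' = 1" "r = k"
          using K_D[of p'] K_D[of r] c assms unfolding 1 by auto
        then have "W \<notin> \<rho>" "W \<notin> \<sigma>" using \<rho>'(2)[OF c(4)] \<sigma>'[OF c(2)] c by auto
        then show False using 1 VW(2,3) by blast
      next
        case 2
        then have "1 < p'" "r < k" using \<rho>' c by auto
        then have "W \<noteq> K" "W \<notin> \<sigma>" using K_D[of q] \<sigma>'[OF c(2)] c by auto
        then show False using 2 nr VW(2) by blast
      next
        case 3
        then have "k < p'" using \<sigma>' c by auto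
        then have "W \<noteq> K" "W \<notin> \<rho>" using K_D[of q] \<rho>'(2)[OF c(2)] c assms by auto
        then show False using 3 ns VW(2) by blast
      qed
    qed
    ultimately show ?thesis using p by (simp add: NC_on_def)
  qed
  have g: "?g \<pi> \<in> NC_on {1<..<k} \<times> NC_on {k<..n} \<and> ?f (?g \<pi>) = \<pi>"
    if "\<pi> \<in> {\<pi> \<in> NC_on {1..n}. K \<in> \<pi>}" for \<pi>
  proof -
    have V: "K \<in> \<pi>" and \<pi>: "\<pi> \<in> NC_on {1..n}" using that by auto
    have nc: "nc_blocks \<pi>" using NC_on_nc_blocks[OF _ \<pi>] by simp
    have U: "\<Union>\<pi> = {1..n}" using NC_on_Union[OF \<pi>] .
    have side: "W \<subseteq> {1<..<k} \<or> W \<subseteq> {k<..n}" if W: "W \<in> \<pi>" "W \<noteq> K" for W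
    proof (rule ccontr)
      assume n: "\<not> ?thesis"
      have ne: "1 \<notin> W" "k \<notin> W" using nc_blocks_disjoint[OF nc V W(1)] W(2) K by auto
      have sub: "W \<subseteq> {1..n}" using U W by blast
      from n obtain s where s: "s \<in> W" "s \<notin> {1<..<k}" by blast
      from n obtain q where q: "q \<in> W" "q \<notin> {k<..n}" by blast
      have "s \<in> {1..n}" "q \<in> {1..n}" using s(1) q(1) sub by blast+
      moreover have "s \<noteq> 1" "s \<noteq> k" "q \<noteq> 1" "q \<noteq> k" using s(1) q(1) ne by metis+
      ultimately have s': "k < s" and q': "1 < q" "q < k" using s(2) q(2) by auto
      show False
        using nc_blocks_noncrossing[OF nc V W(1) _ K(1) q(1) K(2) s(1)] W(2) q' s' by auto
    qed
    have "?f (?g \<pi>) = \<pi>" using V side by auto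
    moreover have sub: "{W\<in>\<pi>. W \<subseteq> I} \<in> NC_on I"
      if I: "I \<subseteq> {1..n}" "\<And>W. W \<in> \<pi> \<Longrightarrow> W \<inter> I \<noteq> {} \<Longrightarrow> W \<subseteq> I" for I
    proof -
      have "s \<in> \<Union>{W\<in>\<pi>. W \<subseteq> I}" if s: "s \<in> I" for s
      proof -
        obtain W where "W \<in> \<pi>" "s \<in> W" using s I(1) U by blast
        then show ?thesis using I(2)[of W] s by blast
      qed
      then have "\<Union>{W\<in>\<pi>. W \<subseteq> I} = I" by blast
      moreover have "nc_blocks {W\<in>\<pi>. W \<subseteq> I}" by (rule nc_blocks_subset[OF nc]) blast
      ultimately show ?thesis by (simp add: nc_blocks_def NC_on_def)
    qed
    have "{W\<in>\<pi>. W \<subseteq> {1<..<k}} \<in> NC_on {1<..<k}"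
    proof (rule sub)
      fix W assume W: "W \<in> \<pi>" "W \<inter> {1<..<k} \<noteq> {}"
      then obtain s where s: "s \<in> W" "1 < s" "s < k" by auto
      then have "W \<noteq> K" "\<not> W \<subseteq> {k<..n}" using K_D[of s] by auto
      then show "W \<subseteq> {1<..<k}" using side[OF W(1)] by blast
    qed (use assms in auto)
    moreover have "{W\<in>\<pi>. W \<subseteq> {k<..n}} \<in> NC_on {k<..n}"
    proof (rule sub)
      fix W assume W: "W \<in> \<pi>" "W \<inter> {k<..n} \<noteq> {}"
      then obtain s where s: "s \<in> W" "k < s" by auto
      then have "W \<noteq> K" "\<not> W \<subseteq> {1<..<k}" using K_D[of s] assms by auto
      then show "W \<subseteq> {k<..n}" using side[OF W(1)] by blast
    qed (use assms in auto)
    ultimately show ?thesis by blast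
  qed
  show ?thesis
    unfolding K_def[symmetric]
  proof (rule bij_betwI)
    show "?f \<in> NC_on {1<..<k} \<times> NC_on {k<..n} \<rightarrow> {\<pi> \<in> NC_on {1..n}. K \<in> \<pi>}" using f by blast
    show "?g \<in> {\<pi> \<in> NC_on {1..n}. K \<in> \<pi>} \<rightarrow> NC_on {1<..<k} \<times> NC_on {k<..n}" using g by blast
    show "?g (?f p) = p" if "p \<in> NC_on {1<..<k} \<times> NC_on {k<..n}" for p by (rule gf[OF that])
    show "?f (?g \<pi>) = \<pi>" if "\<pi> \<in> {\<pi> \<in> NC_on {1..n}. K \<in> \<pi>}" for \<pi> using g[OF that] by blast
  qed
qed

section \<open>Expansion of a moment around the block of the first entry\<close>

lemma cumulant_part_one_block:
  assumes "0 < n"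
  shows "cumulant_part m \<kappa> {{1..n}} a = \<kappa> (map a [1..<Suc n])"
proof -
  have "sorted_list_of_set {1..n} = [1..<Suc n]"
    by (simp only: atLeastLessThanSuc_atLeastAtMost[symmetric] sorted_list_of_set_range)
  then show ?thesis using assms by (subst cumulant_part_single) auto
qed

lemma one_block_in_NC_on: "0 < n \<Longrightarrow> {{1..n}} \<in> NC_on {1..n}"
  by (auto simp: NC_on_def noncrossing_def intro: partition_on_space)

lemma cumulant_remainder:
  assumes "0 < n"
  shows "E (list_product m (map a [1..<Suc n])) = cumulant m E (map a [1..<Suc n]) +
    (\<Sum>\<pi>\<in>NC_on {1..n} - {{{1..n}}}. cumulant_part m (cumulant m E) \<pi> a)"
proof -
  have "{0<..0 + n} = {1..n}" by auto
  then have "E (list_product m (map a [1..<Suc n]))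
      = (\<Sum>\<pi>\<in>NC_on {1..n}. cumulant_part m (cumulant m E) \<pi> a)"
    using sum_cumulant_part_interval[OF assms, where m = m and E = E and l = 0 and a = a] by simp
  also have "\<dots> = cumulant_part m (cumulant m E) {{1..n}} a
      + (\<Sum>\<pi>\<in>NC_on {1..n} - {{{1..n}}}. cumulant_part m (cumulant m E) \<pi> a)"
    by (rule sum.remove[OF finite_NC_on one_block_in_NC_on[OF assms]]) simp
  finally show ?thesis unfolding cumulant_part_one_block[OF assms] .
qed

text \<open>A block equal to the whole of \<open>{1..n}\<close> would leave no room for another one.
  Inductions on the order rest on this, as all partitions but one involve only cumulants of lower
  order.\<close>

lemma NC_on_card_less:
  assumes "\<pi> \<in> NC_on {1..n} - {{{1..n}}}" "V \<in> \<pi>"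
  shows "card V < n"
proof -
  have P: "partition_on {1..n} \<pi>" using assms by (simp add: NC_on_def)
  have "V \<noteq> {1..n}"
  proof
    assume V: "V = {1..n}"
    have "W = V" if "W \<in> \<pi>" for W
    proof (rule ccontr)
      assume "W \<noteq> V"
      then have "W \<inter> V = {}" using P assms(2) that by (auto simp: partition_on_def disjoint_def)
      moreover have "W \<subseteq> V" "W \<noteq> {}" using P that V by (auto simp: partition_on_def)
      ultimately show False by blast
    qed
    then have "\<pi> = {{1..n}}" using assms(2) V by blast
    then show False using assms(1) by blast
  qed
  moreover have "V \<subseteq> {1..n}" using P assms(2) by (auto simp: partition_on_def)
  ultimately have "card V < card {1..n}" by (intro psubset_card_mono) auto
  then show ?thesis by simp
qed

lemma list_product_closed:
  "as \<noteq> [] \<Longrightarrow> set as \<subseteq> R \<Longrightarrow> (\<And>r s. r \<in> R \<Longrightarrow> s \<in> R \<Longrightarrow> m r s \<in> R) \<Longrightarrow> list_product m as \<in> R"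
  by (induction m as rule: list_product.induct) auto

lemma sum_closed:
  fixes f :: "'b \<Rightarrow> 'a::comm_monoid_add"
  assumes "0 \<in> S" "\<And>r s. r \<in> S \<Longrightarrow> s \<in> S \<Longrightarrow> r + s \<in> S" "\<And>x. x \<in> A \<Longrightarrow> f x \<in> S"
  shows "sum f A \<in> S"
  using assms(3) by (induction A rule: infinite_finite_induct) (auto intro: assms(1,2))

text \<open>Solved for its one-block term, the moment-cumulant formula writes the cumulant as a
  moment minus values built from lower orders, and \<open>S\<close> is an additive group inside
  \<open>R\<close>.\<close>

lemma cumulant_closed:
  fixes m :: "'a::ab_group_add \<Rightarrow> 'a \<Rightarrow> 'a"
  assumes R: "\<And>r s. r \<in> R \<Longrightarrow> s \<in> R \<Longrightarrow> m r s \<in> R" and E: "\<And>r. r \<in> R \<Longrightarrow> E r \<in> S"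
    and S: "S \<subseteq> R" "0 \<in> S" "\<And>r s. r \<in> S \<Longrightarrow> s \<in> S \<Longrightarrow> r + s \<in> S" "\<And>r. r \<in> S \<Longrightarrow> - r \<in> S"
    and "as \<noteq> []" "set as \<subseteq> R"
  shows "cumulant m E as \<in> S"
  using assms(7,8)
proof (induction "length as" arbitrary: as rule: less_induct)
  case less
  define n where "n = length as"
  have n: "0 < n" using less.prems by (simp add: n_def)
  define a where "a = (\<lambda>p. as ! (p - 1))"
  have as: "as = map a [1..<Suc n]"
    by (rule nth_equalityI) (auto simp: a_def n_def simp del: upt_Suc)
  have aR: "a p \<in> R" if "p \<in> {1..n}" for p
    using less.prems(2) that by (auto simp: a_def n_def intro!: subsetD[OF _ nth_mem])
  have "(\<Sum>\<pi>\<in>NC_on {1..n} - {{{1..n}}}. cumulant_part m (cumulant m E) \<pi> a) \<in> S"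
  proof (rule sum_closed)
    fix \<pi> assume \<pi>: "\<pi> \<in> NC_on {1..n} - {{{1..n}}}"
    then have nc: "nc_blocks \<pi>" and U: "\<Union>\<pi> = {1..n}"
      using NC_on_nc_blocks[of "{1..n}"] NC_on_Union by auto
    show "cumulant_part m (cumulant m E) \<pi> a \<in> S"
    proof (rule cumulant_part_closed[OF nc])
      show "\<pi> \<noteq> {}" using U n by auto
      show "a p \<in> R" if "p \<in> \<Union>\<pi>" for p using that aR by (simp add: U)
      show "cumulant m E bs \<in> S" if V: "V \<in> \<pi>" and bs: "length bs = card V" "set bs \<subseteq> R" for V bs
      proof (rule less.hyps)
        show "length bs < length as" using NC_on_card_less[OF \<pi> V] bs by (simp add: n_def)
        have "0 < card V" using nc_blocks_block[OF nc V] card_gt_0_iff by blast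
        then show "bs \<noteq> []" using bs by auto
      qed (rule bs)
      show "m r s \<in> R" if "r \<in> R" "s \<in> S" for r s using that R S(1) by blast
    qed
  qed (use S in auto)
  moreover have "E (list_product m as) \<in> S"
    using less.prems by (intro E list_product_closed R)
  ultimately have "E (list_product m as)
      + - (\<Sum>\<pi>\<in>NC_on {1..n} - {{{1..n}}}. cumulant_part m (cumulant m E) \<pi> a) \<in> S"
    by (intro S(3,4))
  then show ?case using cumulant_remainder[OF n, of E m a, folded as] by simp
qed

text \<open>\<open>cumulant_part_gap\<close> applies twice: to the gap behind \<open>k\<close>,
  which has the larger minima and goes first, and to the gap between 1 and \<open>k\<close>. Empty
  gaps are treated apart, because the dummy value 0 of the empty partition must not be multiplied
  in.\<close>

lemma cumulant_part_pair:
  assumes k: "2 \<le> k" "k \<le> n" and \<rho>: "\<rho> \<in> NC_on {1<..<k}" and \<sigma>: "\<sigma> \<in> NC_on {k<..n}"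
  shows "cumulant_part m \<kappa> (insert {1, k} (\<rho> \<union> \<sigma>)) a =
    \<kappa> [if \<rho> = {} then a 1 else m (a 1) (cumulant_part m \<kappa> \<rho> a),
       if \<sigma> = {} then a k else m (a k) (cumulant_part m \<kappa> \<sigma> a)]"
proof -
  define K where "K = {1, k}"
  have K: "1 \<in> K" "k \<in> K" and K_D: "\<And>t. t \<in> K \<Longrightarrow> t = 1 \<or> t = k" and MinK: "Min K = 1"
    using k by (auto simp: K_def)
  define \<pi> where "\<pi> = insert K (\<rho> \<union> \<sigma>)"
  have "\<pi> \<in> NC_on {1..n}"
    using bij_betw_apply[OF NC_on_first_block_pair[OF k], of "(\<rho>, \<sigma>)"] \<rho> \<sigma>
    by (auto simp: \<pi>_def K_def)
  then have nc: "nc_blocks \<pi>" by (rule NC_on_nc_blocks[rotated]) simp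
  have U\<rho>: "\<Union>\<rho> = {1<..<k}" and U\<sigma>: "\<Union>\<sigma> = {k<..n}" using \<rho> \<sigma> NC_on_Union by auto
  have ne: "{} \<notin> \<rho>" "{} \<notin> \<sigma>" using \<rho> \<sigma> by (auto simp: NC_on_def partition_on_def)
  have nc\<rho>: "nc_blocks \<rho>" and nc\<sigma>: "nc_blocks \<sigma>"
    using nc_blocks_subset[OF nc] by (auto simp: \<pi>_def)
  have \<rho>': "1 < t" "t < k" if "t \<in> U" "U \<in> \<rho>" for t U
    using that U\<rho> by (metis UnionI greaterThanLessThan_iff)+
  have \<sigma>': "k < t" "t \<le> n" if "t \<in> U" "U \<in> \<sigma>" for t U
    using that U\<sigma> by (metis UnionI greaterThanAtMost_iff)+
  have K\<rho>: "K \<notin> \<rho>" using K \<rho>' by blast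
  have K\<sigma>: "K \<notin> \<sigma>" using K \<sigma>'(1)[OF K(2)] by blast
  have \<rho>\<sigma>: "U \<notin> \<sigma>" if U: "U \<in> \<rho>" for U
  proof
    assume "U \<in> \<sigma>"
    have "Min U \<in> U" by (rule nc_blocks_block(3)[OF nc\<rho> U])
    then show False using \<rho>'(2)[OF _ U] \<sigma>'(1)[OF _ \<open>U \<in> \<sigma>\<close>] by fastforce
  qed
  have d1: "\<pi> - \<sigma> = insert K \<rho>" using K\<sigma> \<rho>\<sigma> by (auto simp: \<pi>_def)
  define a1 where "a1 = (if \<sigma> = {} then a else a(k := m (a k) (cumulant_part m \<kappa> \<sigma> a)))"
  have s1: "cumulant_part m \<kappa> \<pi> a = cumulant_part m \<kappa> (insert K \<rho>) a1"
  proof (cases "\<sigma> = {}")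
    case True
    then show ?thesis by (simp add: a1_def \<pi>_def)
  next
    case False
    have "cumulant_part m \<kappa> \<pi> a
        = cumulant_part m \<kappa> (\<pi> - \<sigma>) (a(k := m (a k) (cumulant_part m \<kappa> \<sigma> a)))"
    proof (rule cumulant_part_gap[OF nc\<sigma> False nc])
      show "\<sigma> \<subseteq> \<pi>" by (auto simp: \<pi>_def)
      show "k \<in> \<Union>(\<pi> - \<sigma>)" using K by (simp add: d1)
      show "k < g" if "g \<in> \<Union>\<sigma>" for g using that \<sigma>' by blast
      show "Min V \<le> k" if "V \<in> \<pi> - \<sigma>" for V
      proof (cases "V = K")
        case True
        then show ?thesis using MinK k by simp
      next
        case False
        then have V: "V \<in> \<rho>" using that d1 by blast
        then show ?thesis using \<rho>'(2)[OF nc_blocks_block(3)[OF nc\<rho> V] V] by simp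
      qed
      show "g < s" if "s \<in> \<Union>(\<pi> - \<sigma>)" "k < s" "g \<in> \<Union>\<sigma>" for s g
      proof -
        have "s \<in> K \<or> s \<in> \<Union>\<rho>" using that(1) d1 by auto
        then have "s \<le> k" using K_D[of s] k U\<rho> by auto
        then show ?thesis using that(2) by simp
      qed
    qed
    then show ?thesis using False by (simp add: d1 a1_def)
  qed
  define a2 where "a2 = (if \<rho> = {} then a1 else a1(1 := m (a1 1) (cumulant_part m \<kappa> \<rho> a1)))"
  have ncK: "nc_blocks (insert K \<rho>)" using nc_blocks_subset[OF nc] by (auto simp: \<pi>_def)
  have d2: "insert K \<rho> - \<rho> = {K}" using K\<rho> by blast
  have s2: "cumulant_part m \<kappa> (insert K \<rho>) a1 = cumulant_part m \<kappa> {K} a2"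
  proof (cases "\<rho> = {}")
    case True
    then show ?thesis by (simp add: a2_def)
  next
    case False
    have "cumulant_part m \<kappa> (insert K \<rho>) a1
        = cumulant_part m \<kappa> (insert K \<rho> - \<rho>) (a1(1 := m (a1 1) (cumulant_part m \<kappa> \<rho> a1)))"
    proof (rule cumulant_part_gap[OF nc\<rho> False ncK])
      show "1 \<in> \<Union>(insert K \<rho> - \<rho>)" using K by (simp add: d2)
      show "1 < g" if "g \<in> \<Union>\<rho>" for g using that \<rho>' by blast
      show "Min V \<le> 1" if "V \<in> insert K \<rho> - \<rho>" for V using that by (simp add: d2 MinK)
      show "g < s" if "s \<in> \<Union>(insert K \<rho> - \<rho>)" "1 < s" "g \<in> \<Union>\<rho>" for s g
      proof -
        have "s \<in> K" using that(1) by (simp add: d2)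
        then have "s = k" using that(2) K_D by blast
        then show ?thesis using that(3) U\<rho> by simp
      qed
    qed blast
    then show ?thesis using False by (simp add: d2 a2_def)
  qed
  \<comment> \<open>The earlier update was at \<open>k\<close>, which does not belong to the gap
    before it.\<close>
  have "cumulant_part m \<kappa> \<rho> a1 = cumulant_part m \<kappa> \<rho> a"
    by (rule cumulant_part_entries_cong[OF nc\<rho>]) (auto simp: a1_def U\<rho>)
  then have "a2 1 = (if \<rho> = {} then a 1 else m (a 1) (cumulant_part m \<kappa> \<rho> a))"
    "a2 k = (if \<sigma> = {} then a k else m (a k) (cumulant_part m \<kappa> \<sigma> a))"
    using k by (auto simp: a2_def a1_def)
  moreover have "sorted_list_of_set K = [1, k]"
    using k sorted_list_of_set.idem_if_sorted_distinct[of "[1, k]"] by (simp add: K_def)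
  then have "cumulant_part m \<kappa> {K} a2 = \<kappa> [a2 1, a2 k]"
    by (subst cumulant_part_single) (auto simp: K_def)
  ultimately show ?thesis using s1 s2 by (simp add: \<pi>_def K_def)
qed

text \<open>Partitions are sorted by the block of position 1. Removing the other blocks keeps the
  entries in \<open>X\<close> and \<open>R\<close>, so \<open>vanish\<close> kills the partition
  unless this block is a pair or all of \<open>{1..n}\<close>. For a pair, the rest runs over two
  independent gaps. With \<open>n = 2\<close> the pair is the one-block partition, already present
  as the first summand, which is the reason for the guard \<open>n < 3\<close>.\<close>

lemma cumulant_expansion:
  fixes m :: "'a::ab_group_add \<Rightarrow> 'a \<Rightarrow> 'a" and E :: "'a \<Rightarrow> 'a"
  defines "\<kappa> \<equiv> cumulant m E"
  assumes n: "0 < n" and a: "a 1 \<in> X" "\<And>p. p \<in> {2..n} \<Longrightarrow> a p \<in> R"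
    and S: "\<And>bs. bs \<noteq> [] \<Longrightarrow> set bs \<subseteq> R \<Longrightarrow> \<kappa> bs \<in> S"
    and R: "\<And>r s. r \<in> R \<Longrightarrow> s \<in> S \<Longrightarrow> m r s \<in> R" "\<And>r s. r \<in> X \<Longrightarrow> s \<in> S \<Longrightarrow> m r s \<in> X"
    and vanish: "\<And>\<xi> bs. \<xi> \<in> X \<Longrightarrow> set bs \<subseteq> R \<Longrightarrow> Suc (length bs) < n \<Longrightarrow> length bs \<noteq> 1 \<Longrightarrow> \<kappa> (\<xi> # bs) = 0"
  shows "E (list_product m (map a [1..<Suc n])) = \<kappa> (map a [1..<Suc n]) +
    (if n < 3 then 0 else \<Sum>k=2..n. \<Sum>\<rho>\<in>NC_on {1<..<k}. \<Sum>\<sigma>\<in>NC_on {k<..n}.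
      \<kappa> [if \<rho> = {} then a 1 else m (a 1) (cumulant_part m \<kappa> \<rho> a),
         if \<sigma> = {} then a k else m (a k) (cumulant_part m \<kappa> \<sigma> a)])"
proof -
  let ?Z = "NC_on {1..n} - {{{1..n}}}"
  let ?P = "\<lambda>k. {\<pi> \<in> NC_on {1..n}. {1, k} \<in> \<pi>}"
  have zero: "cumulant_part m \<kappa> \<pi> a = 0" if \<pi>: "\<pi> \<in> ?Z" and no: "\<And>k. k \<in> {2..n} \<Longrightarrow> {1, k} \<notin> \<pi>" for \<pi>
  proof -
    have nc: "nc_blocks \<pi>" and U: "\<Union>\<pi> = {1..n}"
      using \<pi> NC_on_nc_blocks[of "{1..n}"] NC_on_Union by auto
    then obtain V where V: "V \<in> \<pi>" "1 \<in> V" using n by (metis UnionE atLeastAtMost_iff le_refl less_eq_Suc_le One_nat_def)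
    have "card V \<noteq> 2"
    proof
      assume "card V = 2"
      then have "card (V - {1}) = 1" using V nc_blocks_block[OF nc V(1)] by simp
      then obtain k where k: "V - {1} = {k}" by (auto simp: card_1_singleton_iff)
      then have "V = {1, k}" "k \<in> V" "k \<noteq> 1" using V(2) by auto
      moreover have "k \<in> {1..n}" using V(1) \<open>k \<in> V\<close> U by blast
      ultimately show False using no[of k] V(1) by auto
    qed
    have "cumulant_part m \<kappa> \<pi> a \<in> {0}"
    proof (rule cumulant_part_first_block[OF nc _ V, where R = R and S = S and X = X])
      show "\<pi> \<noteq> {}" using V by blast
      show "1 \<le> p" if "p \<in> \<Union>\<pi>" for p using that by (simp add: U)
      show "a p \<in> R" if "p \<in> \<Union>\<pi>" "p \<noteq> 1" for p using that a(2)[of p] by (simp add: U)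
      show "\<kappa> bs \<in> S" if W: "W \<in> \<pi>" and bs: "length bs = card W" "set bs \<subseteq> R" for W bs
      proof -
        have "0 < card W" using nc_blocks_block[OF nc W] card_gt_0_iff by blast
        then show ?thesis using bs by (intro S) auto
      qed
      show "\<kappa> (\<xi> # bs) \<in> {0}"
        if "\<xi> \<in> X" "length (\<xi> # bs) = card V" "set bs \<subseteq> R" for \<xi> bs
        using that vanish[of \<xi> bs] NC_on_card_less[OF \<pi> V(1)] \<open>card V \<noteq> 2\<close> by auto
    qed (use a R in auto)
    then show ?thesis by simp
  qed
  have "(\<Sum>\<pi>\<in>?Z. cumulant_part m \<kappa> \<pi> a) = (\<Sum>\<pi>\<in>?Z \<inter> (\<Union>k\<in>{2..n}. ?P k). cumulant_part m \<kappa> \<pi> a)"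
  proof (rule sum.mono_neutral_right)
    show "finite ?Z" by (simp add: finite_NC_on)
    show "\<forall>\<pi>\<in>?Z - ?Z \<inter> (\<Union>k\<in>{2..n}. ?P k). cumulant_part m \<kappa> \<pi> a = 0"
    proof
      fix \<pi> assume \<pi>: "\<pi> \<in> ?Z - ?Z \<inter> (\<Union>k\<in>{2..n}. ?P k)"
      show "cumulant_part m \<kappa> \<pi> a = 0"
      proof (rule zero)
        show "\<pi> \<in> ?Z" using \<pi> by blast
        show "{1, k} \<notin> \<pi>" if "k \<in> {2..n}" for k
        proof
          assume "{1, k} \<in> \<pi>"
          then have "\<pi> \<in> ?P k" using \<open>\<pi> \<in> ?Z\<close> by simp
          then show False using \<pi> that by blast
        qed
      qed
    qed
  qed blast
  also have "\<dots> = (if n < 3 then 0 else \<Sum>k=2..n. \<Sum>\<pi>\<in>?P k. cumulant_part m \<kappa> \<pi> a)"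
  proof (cases "n < 3")
    case True
    have "\<pi> \<notin> ?Z" if "k \<in> {2..n}" "{1, k} \<in> \<pi>" for k \<pi>
    proof
      assume \<pi>: "\<pi> \<in> ?Z"
      have "card {1, k} < n" by (rule NC_on_card_less[OF \<pi> that(2)])
      then show False using that(1) True by auto
    qed
    then have "?Z \<inter> (\<Union>k\<in>{2..n}. ?P k) = {}" by blast
    then show ?thesis using True by simp
  next
    case False
    have "{1, k} \<noteq> {1..n}" if "k \<in> {2..n}" for k
    proof
      assume "{1, k} = {1..n}"
      then have "card {1, k} = n" by simp
      then show False using that False by auto
    qed
    then have "?Z \<inter> (\<Union>k\<in>{2..n}. ?P k) = (\<Union>k\<in>{2..n}. ?P k)" by fastforce
    also have "(\<Sum>\<pi>\<in>\<dots>. cumulant_part m \<kappa> \<pi> a) = (\<Sum>k=2..n. \<Sum>\<pi>\<in>?P k. cumulant_part m \<kappa> \<pi> a)"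
    proof (rule sum.UNION_disjoint)
      show "\<forall>k\<in>{2..n}. \<forall>l\<in>{2..n}. k \<noteq> l \<longrightarrow> ?P k \<inter> ?P l = {}"
      proof (intro ballI impI equals0I)
        fix k l \<pi> assume k: "k \<in> {2..n}" "l \<in> {2..n}" "k \<noteq> l" and \<pi>: "\<pi> \<in> ?P k \<inter> ?P l"
        then have nc: "nc_blocks \<pi>" using NC_on_nc_blocks[of "{1..n}"] by auto
        have "{1, k} = {1, l}" using nc_blocks_disjoint[OF nc, of "{1, k}" "{1, l}" 1] \<pi> by auto
        then show False using k by (auto simp: doubleton_eq_iff)
      qed
    qed (auto simp: finite_NC_on)
    finally show ?thesis using False by simp
  qed
  also have "(\<Sum>\<pi>\<in>?P k. cumulant_part m \<kappa> \<pi> a) = (\<Sum>\<rho>\<in>NC_on {1<..<k}. \<Sum>\<sigma>\<in>NC_on {k<..n}.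
      \<kappa> [if \<rho> = {} then a 1 else m (a 1) (cumulant_part m \<kappa> \<rho> a),
         if \<sigma> = {} then a k else m (a k) (cumulant_part m \<kappa> \<sigma> a)])" if "k \<in> {2..n}" for k
  proof -
    have k: "2 \<le> k" "k \<le> n" using that by auto
    have "(\<Sum>\<pi>\<in>?P k. cumulant_part m \<kappa> \<pi> a) = (\<Sum>(\<rho>, \<sigma>)\<in>NC_on {1<..<k} \<times> NC_on {k<..n}.
        cumulant_part m \<kappa> (insert {1, k} (\<rho> \<union> \<sigma>)) a)"
      using sum.reindex_bij_betw[OF NC_on_first_block_pair[OF k], of "\<lambda>\<pi>. cumulant_part m \<kappa> \<pi> a"]
      by (simp add: case_prod_unfold)
    also have "\<dots> = (\<Sum>\<rho>\<in>NC_on {1<..<k}. \<Sum>\<sigma>\<in>NC_on {k<..n}.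
        cumulant_part m \<kappa> (insert {1, k} (\<rho> \<union> \<sigma>)) a)"
      by (rule sum.cartesian_product[symmetric])
    also have "\<dots> = (\<Sum>\<rho>\<in>NC_on {1<..<k}. \<Sum>\<sigma>\<in>NC_on {k<..n}.
        \<kappa> [if \<rho> = {} then a 1 else m (a 1) (cumulant_part m \<kappa> \<rho> a),
           if \<sigma> = {} then a k else m (a k) (cumulant_part m \<kappa> \<sigma> a)])"
      by (intro sum.cong refl cumulant_part_pair[OF k])
    finally show ?thesis .
  qed
  then have "(if n < 3 then 0 else \<Sum>k=2..n. \<Sum>\<pi>\<in>?P k. cumulant_part m \<kappa> \<pi> a) =
    (if n < 3 then 0 else \<Sum>k=2..n. \<Sum>\<rho>\<in>NC_on {1<..<k}. \<Sum>\<sigma>\<in>NC_on {k<..n}.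
      \<kappa> [if \<rho> = {} then a 1 else m (a 1) (cumulant_part m \<kappa> \<rho> a),
         if \<sigma> = {} then a k else m (a k) (cumulant_part m \<kappa> \<sigma> a)])"
    by (simp only: cong: sum.cong)
  finally show ?thesis
    using cumulant_remainder[OF n, of E m a] by (simp add: \<kappa>_def del: upt_Suc)
qed

section \<open>Operators and the GNS space\<close>

lemma cinner_scaleR_left: "cinner (r *\<^sub>R a) b = r *\<^sub>R cinner a (b :: 'a::complex_hilbert_space)"
  by (simp add: cinner_cscale_left scaleR_conv_of_real flip: cscale_of_real)

lemma cinner_scaleR_right: "cinner a (r *\<^sub>R b) = r *\<^sub>R cinner a (b :: 'a::complex_hilbert_space)"
  by (simp add: cinner_cscale_right scaleR_conv_of_real flip: cscale_of_real)

text \<open>The constant 2 comes from \<open>cmod_cinner_le\<close> on unit vectors. Any constant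
  would do, since only continuity and bilinearity are used.\<close>

lemma bounded_bilinear_cinner:
  "bounded_bilinear (cinner :: 'a::complex_hilbert_space \<Rightarrow> 'a \<Rightarrow> complex)"
proof
  have "cmod (cinner a b) \<le> norm a * norm b * 2" for a b :: 'a
  proof (cases "a = 0 \<or> b = 0")
    case True
    then have "cinner a b = 0"
      using cinner_scaleR_left[of 0 a b] cinner_scaleR_right[of a 0 b] by auto
    then show ?thesis by simp
  next
    case False
    then have "cmod (cinner (a /\<^sub>R norm a) (b /\<^sub>R norm b)) \<le> 2"
      using cmod_cinner_le[of "a /\<^sub>R norm a" "b /\<^sub>R norm b"] by simp
    then have "cmod (cinner a b) / (norm a * norm b) \<le> 2"
      by (simp add: cinner_scaleR_left cinner_scaleR_right divide_inverse mult_ac)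
    then show ?thesis using False by (simp add: field_simps)
  qed
  then show "\<exists>K. \<forall>a b::'a. cmod (cinner a b) \<le> norm a * norm b * K" by blast
qed (simp_all add: cinner_add_left cinner_add_right cinner_scaleR_left cinner_scaleR_right)

lemmas continuous_on_cinner [continuous_intros] =
  bounded_bilinear.continuous_on [OF bounded_bilinear_cinner]
lemmas cinner_diff_left = bounded_bilinear.diff_left [OF bounded_bilinear_cinner]
lemmas cinner_diff_right = bounded_bilinear.diff_right [OF bounded_bilinear_cinner]
lemmas cinner_zero_left = bounded_bilinear.zero_left [OF bounded_bilinear_cinner]
lemmas cinner_zero_right = bounded_bilinear.zero_right [OF bounded_bilinear_cinner]

lemmas op_compose_add_left = bounded_bilinear.add_left [OF bounded_bilinear_blinfun_compose]
lemmas op_compose_add_right = bounded_bilinear.add_right [OF bounded_bilinear_blinfun_compose]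
lemmas op_compose_sum_left = bounded_bilinear.sum_left [OF bounded_bilinear_blinfun_compose]
lemmas op_compose_sum_right = bounded_bilinear.sum_right [OF bounded_bilinear_blinfun_compose]

lemma op_compose_assoc: "(a o\<^sub>L b) o\<^sub>L c = a o\<^sub>L (b o\<^sub>L c)"
  by (rule blinfun_eqI) simp

lemma op_compose_id [simp]: "a o\<^sub>L id_blinfun = a" "id_blinfun o\<^sub>L a = a"
  by (rule blinfun_eqI, simp)+

lemma scalar_op_minus_one: "scalar_op (- 1) o\<^sub>L a = - (a :: 'a::real_normed_vector \<Rightarrow>\<^sub>L 'h::complex_hilbert_space)"
proof (rule blinfun_eqI)
  fix v
  have "cscale (- 1) w = - w" for w :: 'h using cscale_of_real[of "-1" w] by simp
  then show "blinfun_apply (scalar_op (- 1) o\<^sub>L a) v = blinfun_apply (- a) v"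
    by (simp add: scalar_op_apply blinfun.minus_left)
qed

section \<open>Algebraic closure of von Neumann algebras\<close>

lemma id_in_commutant: "id_blinfun \<in> commutant S"
  by (simp add: commutant_def bounded_ops_def)

text \<open>The type of operators contains real-linear maps, so the elements of \<open>S\<close>
  must be complex linear to commute with scalars.\<close>

lemma scale_in_commutant:
  assumes a: "a \<in> commutant S" and S: "S \<subseteq> bounded_ops"
  shows "scalar_op c o\<^sub>L a \<in> commutant S"
proof -
  have "(scalar_op c o\<^sub>L a) o\<^sub>L s = s o\<^sub>L (scalar_op c o\<^sub>L a)" if s: "s \<in> S" for s
  proof (rule blinfun_eqI)
    fix v
    have "a o\<^sub>L s = s o\<^sub>L a" using a s by (simp add: commutant_def)
    from arg_cong[OF this, of "\<lambda>f. blinfun_apply f v"]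
    have "blinfun_apply a (blinfun_apply s v) = blinfun_apply s (blinfun_apply a v)" by simp
    then show "blinfun_apply ((scalar_op c o\<^sub>L a) o\<^sub>L s) v = blinfun_apply (s o\<^sub>L (scalar_op c o\<^sub>L a)) v"
      using S s by (auto simp: scalar_op_apply bounded_ops_def)
  qed
  moreover have "scalar_op c o\<^sub>L a \<in> bounded_ops"
    using a by (simp add: commutant_def bounded_ops_def scalar_op_apply cscale_cscale mult.commute)
  ultimately show ?thesis by (simp add: commutant_def)
qed

lemma add_in_commutant: "a \<in> commutant S \<Longrightarrow> b \<in> commutant S \<Longrightarrow> a + b \<in> commutant S"
  unfolding commutant_def bounded_ops_def
  by (auto simp: op_compose_add_left op_compose_add_right blinfun.add_left cscale_add_right)

lemma compose_in_commutant:
  assumes "a \<in> commutant S" "b \<in> commutant S"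
  shows "a o\<^sub>L b \<in> commutant S"
proof -
  have "(a o\<^sub>L b) o\<^sub>L s = s o\<^sub>L (a o\<^sub>L b)" if s: "s \<in> S" for s
  proof -
    have "a o\<^sub>L s = s o\<^sub>L a" "b o\<^sub>L s = s o\<^sub>L b" using assms s by (auto simp: commutant_def)
    then show ?thesis by (metis op_compose_assoc)
  qed
  then show ?thesis using assms by (simp add: commutant_def bounded_ops_def)
qed

lemma commutant_bounded_ops: "commutant S \<subseteq> bounded_ops"
  by (auto simp: commutant_def)

text \<open>A von Neumann algebra equals its bicommutant, and the commutant of a set of
  complex-linear operators is a unital algebra.\<close>

lemma
  assumes "von_neumann_algebra A"
  shows vN_id: "id_blinfun \<in> A"
    and vN_add: "a \<in> A \<Longrightarrow> b \<in> A \<Longrightarrow> a + b \<in> A"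
    and vN_scale: "a \<in> A \<Longrightarrow> scalar_op c o\<^sub>L a \<in> A"
    and vN_compose: "a \<in> A \<Longrightarrow> b \<in> A \<Longrightarrow> a o\<^sub>L b \<in> A"
    and vN_bounded: "a \<in> A \<Longrightarrow> a \<in> bounded_ops"
proof -
  have A: "commutant (commutant A) = A" "A \<subseteq> bounded_ops"
    using assms by (auto simp: von_neumann_algebra_def)
  show "id_blinfun \<in> A" using id_in_commutant[of "commutant A"] by (simp add: A)
  show "a \<in> A \<Longrightarrow> b \<in> A \<Longrightarrow> a + b \<in> A" using add_in_commutant[of a "commutant A" b] by (simp add: A)
  show "a \<in> A \<Longrightarrow> scalar_op c o\<^sub>L a \<in> A"
    using scale_in_commutant[OF _ commutant_bounded_ops, of a A c] by (simp add: A)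
  show "a \<in> A \<Longrightarrow> b \<in> A \<Longrightarrow> a o\<^sub>L b \<in> A" using compose_in_commutant[of a "commutant A" b] by (simp add: A)
  show "a \<in> A \<Longrightarrow> a \<in> bounded_ops" using A by blast
qed

lemma vN_minus: "von_neumann_algebra A \<Longrightarrow> a \<in> A \<Longrightarrow> - a \<in> A"
  using vN_scale[of A a "-1"] by (simp add: scalar_op_minus_one)

lemma vN_diff: "von_neumann_algebra A \<Longrightarrow> a \<in> A \<Longrightarrow> b \<in> A \<Longrightarrow> a - b \<in> A"
  using vN_add[of A a "- b"] vN_minus by fastforce

lemma vN_zero: "von_neumann_algebra A \<Longrightarrow> 0 \<in> A"
  using vN_diff[OF _ vN_id vN_id] by auto

lemma
  assumes "von_neumann_algebra A" "a \<in> A"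
  shows vN_adj: "adj a \<in> A"
    and adj_left: "cinner (blinfun_apply (adj a) u) v = cinner u (blinfun_apply a v)"
    and adj_right: "cinner (blinfun_apply a u) v = cinner u (blinfun_apply (adj a) v)"
    and adj_adj: "adj (adj a) = a"
proof -
  obtain a' where a': "a' \<in> A" "\<And>u v. cinner (blinfun_apply a' u) v = cinner u (blinfun_apply a v)"
    using assms unfolding von_neumann_algebra_def by blast
  then have "adj a = a'" by (intro adj_eqI) blast
  then show "adj a \<in> A" and l: "cinner (blinfun_apply (adj a) u) v = cinner u (blinfun_apply a v)" for u v
    using a' by auto
  then show r: "cinner (blinfun_apply a u) v = cinner u (blinfun_apply (adj a) v)" for u v
    by (metis cinner_commute)
  then show "adj (adj a) = a" by (intro adj_eqI) auto
qed

lemma adj_compose: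
  assumes "von_neumann_algebra A" "a \<in> A" "b \<in> A"
  shows "adj (a o\<^sub>L b) = adj b o\<^sub>L adj a"
  by (rule adj_eqI) (simp add: adj_left[OF assms(1)] assms)

lemma adj_id: "adj id_blinfun = id_blinfun"
  by (rule adj_eqI) simp

text \<open>Identities on L2 are checked on the image of \<open>M\<close> under
  \<open>\<Lambda>\<close> and extended by this.\<close>

lemma eq_on_dense:
  fixes f g :: "'a::topological_space \<Rightarrow> 'b::t2_space"
  assumes "closure D = UNIV" "continuous_on UNIV f" "continuous_on UNIV g" "\<And>x. x \<in> D \<Longrightarrow> f x = g x"
  shows "f x = g x"
proof -
  have "closed {x. f x = g x}" using assms(2,3) by (intro closed_Collect_eq) auto
  then have "closure D \<subseteq> {x. f x = g x}" using assms(4) by (intro closure_minimal) auto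
  then show ?thesis using assms(1) by blast
qed

section \<open>The GNS space and the right action of \<open>M\<close>\<close>

locale tracial_GNS =
  fixes M :: "('h::complex_hilbert_space \<Rightarrow>\<^sub>L 'h) set"
    and \<tau> :: "('h \<Rightarrow>\<^sub>L 'h) \<Rightarrow> complex"
    and \<Lambda> :: "('h \<Rightarrow>\<^sub>L 'h) \<Rightarrow> 'k::complex_hilbert_space"
  assumes tracial: "tracial_von_neumann_algebra M \<tau>" and GNS: "GNS_space M \<tau> \<Lambda>"
begin

lemma M_vN: "von_neumann_algebra M"
  using tracial by (simp add: tracial_von_neumann_algebra_def)

lemmas M_closed = vN_id[OF M_vN] vN_add[OF M_vN] vN_scale[OF M_vN] vN_compose[OF M_vN]
  vN_minus[OF M_vN] vN_diff[OF M_vN] vN_zero[OF M_vN] vN_adj[OF M_vN]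

lemma
  shows tau_add: "a \<in> M \<Longrightarrow> b \<in> M \<Longrightarrow> \<tau> (a + b) = \<tau> a + \<tau> b"
    and tau_scale: "a \<in> M \<Longrightarrow> \<tau> (scalar_op c o\<^sub>L a) = c * \<tau> a"
    and tau_positive: "a \<in> M \<Longrightarrow> positive_op a \<Longrightarrow> \<tau> a \<in> \<real>\<^sub>\<ge>\<^sub>0"
    and tau_faithful: "a \<in> M \<Longrightarrow> \<tau> (adj a o\<^sub>L a) = 0 \<Longrightarrow> a = 0"
    and tau_commute: "a \<in> M \<Longrightarrow> b \<in> M \<Longrightarrow> \<tau> (a o\<^sub>L b) = \<tau> (b o\<^sub>L a)"
  using tracial unfolding tracial_von_neumann_algebra_def by simp_all

lemma
  shows Lambda_add: "a \<in> M \<Longrightarrow> b \<in> M \<Longrightarrow> \<Lambda> (a + b) = \<Lambda> a + \<Lambda> b"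
    and Lambda_scale: "a \<in> M \<Longrightarrow> \<Lambda> (scalar_op c o\<^sub>L a) = cscale c (\<Lambda> a)"
    and cinner_Lambda: "a \<in> M \<Longrightarrow> b \<in> M \<Longrightarrow> cinner (\<Lambda> a) (\<Lambda> b) = \<tau> (adj a o\<^sub>L b)"
    and Lambda_dense: "closure (\<Lambda> ` M) = UNIV"
  using GNS unfolding GNS_space_def by simp_all

lemma tau_zero: "\<tau> 0 = 0"
  using tau_scale[of 0 0] M_closed by simp

lemma tau_diff: "a \<in> M \<Longrightarrow> b \<in> M \<Longrightarrow> \<tau> (a - b) = \<tau> a - \<tau> b"
  using tau_add[of "a - b" b] M_closed by simp

lemma tau_sum: "(\<And>k. k \<in> K \<Longrightarrow> f k \<in> M) \<Longrightarrow> \<tau> (sum f K) = (\<Sum>k\<in>K. \<tau> (f k)) \<and> sum f K \<in> M"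
  by (induction K rule: infinite_finite_induct) (auto simp: tau_zero tau_add M_closed)

lemma Lambda_zero: "\<Lambda> 0 = 0"
  using Lambda_add[of 0 0] M_closed by simp

lemma Lambda_diff: "a \<in> M \<Longrightarrow> b \<in> M \<Longrightarrow> \<Lambda> (a - b) = \<Lambda> a - \<Lambda> b"
  using Lambda_add[of "a - b" b] M_closed by simp

text \<open>Hermitian symmetry of the inner product between \<open>\<Lambda> id_blinfun\<close> and
  \<open>\<Lambda> a\<close>.\<close>

lemma tau_adj: "a \<in> M \<Longrightarrow> \<tau> (adj a) = cnj (\<tau> a)"
  using cinner_Lambda[of id_blinfun a] cinner_Lambda[of a id_blinfun]
    cinner_commute[of "\<Lambda> a" "\<Lambda> id_blinfun"] M_closed by (simp add: adj_id)

text \<open>\<open>L2_extension\<close> is a definite description, so existence and uniqueness of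
  the extension have to be shown. The bound makes \<open>f\<close> well defined and Lipschitz on a
  dense subspace; completeness of the target gives the extension, density its linearity and
  uniqueness.\<close>

lemma L2_extension_Lambda:
  assumes f: "\<And>a. a \<in> M \<Longrightarrow> f a \<in> M" "\<And>a b. a \<in> M \<Longrightarrow> b \<in> M \<Longrightarrow> f (a + b) = f a + f b"
      "\<And>c a. a \<in> M \<Longrightarrow> f (scalar_op c o\<^sub>L a) = scalar_op c o\<^sub>L f a"
    and C: "\<And>a. a \<in> M \<Longrightarrow> norm (\<Lambda> (f a)) \<le> C * norm (\<Lambda> a)"
    and a: "a \<in> M"
  shows "blinfun_apply (L2_extension M \<Lambda> f) (\<Lambda> a) = \<Lambda> (f a)"
proof -
  have diff: "norm (\<Lambda> (f a) - \<Lambda> (f b)) \<le> C * norm (\<Lambda> a - \<Lambda> b)" if "a \<in> M" "b \<in> M" for a b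
  proof -
    have "f a = f (a - b) + f b" using f(2)[of "a - b" b] that M_closed by simp
    then have "\<Lambda> (f a) - \<Lambda> (f b) = \<Lambda> (f (a - b))"
      using that M_closed f(1) by (simp add: Lambda_add)
    then show ?thesis using C[of "a - b"] that M_closed by (simp add: Lambda_diff)
  qed
  \<comment> \<open>Any representative of \<open>y\<close> will do, because \<open>diff\<close>
    makes \<open>\<Lambda> (f a)\<close> depend only on \<open>\<Lambda> a\<close>.\<close>
  define g where "g = (\<lambda>y. \<Lambda> (f (SOME a. a \<in> M \<and> \<Lambda> a = y)))"
  have g: "g (\<Lambda> a) = \<Lambda> (f a)" if a: "a \<in> M" for a
  proof -
    define b where "b = (SOME b. b \<in> M \<and> \<Lambda> b = \<Lambda> a)"
    have "b \<in> M \<and> \<Lambda> b = \<Lambda> a" unfolding b_def by (rule someI[of _ a]) (use a in simp)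
    then have "norm (\<Lambda> (f b) - \<Lambda> (f a)) \<le> 0" using diff[of b a] a by simp
    then show ?thesis by (simp add: g_def b_def)
  qed
  have "\<bar>C\<bar>-lipschitz_on (\<Lambda> ` M) g"
  proof (rule lipschitz_onI)
    fix x y assume "x \<in> \<Lambda> ` M" "y \<in> \<Lambda> ` M"
    then obtain a b where ab: "a \<in> M" "b \<in> M" "x = \<Lambda> a" "y = \<Lambda> b" by blast
    have "norm (\<Lambda> (f a) - \<Lambda> (f b)) \<le> C * norm (\<Lambda> a - \<Lambda> b)" by (rule diff) (use ab in auto)
    also have "\<dots> \<le> \<bar>C\<bar> * norm (\<Lambda> a - \<Lambda> b)" by (rule mult_right_mono) auto
    finally show "dist (g x) (g y) \<le> \<bar>C\<bar> * dist x y" using ab by (simp add: g dist_norm)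
  qed simp
  then have "uniformly_continuous_on (\<Lambda> ` M) g" by (rule lipschitz_on_uniformly_continuous)
  then obtain G where "uniformly_continuous_on (closure (\<Lambda> ` M)) G" and Gg: "\<And>x. x \<in> \<Lambda> ` M \<Longrightarrow> g x = G x"
    by (rule uniformly_continuous_on_extension_on_closure) blast
  then have cont: "continuous_on UNIV G"
    using uniformly_continuous_imp_continuous by (simp add: Lambda_dense)
  have G: "G (\<Lambda> a) = \<Lambda> (f a)" if "a \<in> M" for a using Gg[of "\<Lambda> a"] g[OF that] that by simp
  have contc: "continuous_on UNIV (\<lambda>x. G (h x))" if "continuous_on UNIV h" for h :: "'k \<Rightarrow> 'k"
    using continuous_on_compose2[OF cont that] by simp
  \<comment> \<open>Additivity is extended one variable at a time: here \<open>y\<close> leaves the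
    dense set, in the next step \<open>x\<close> does.\<close>
  have add1: "G (\<Lambda> a + y) = G (\<Lambda> a) + G y" if "a \<in> M" for a y
    by (rule eq_on_dense[OF Lambda_dense, where x = y])
      (use that M_closed f(1) in \<open>auto intro!: contc continuous_intros cont simp: G f(2) simp flip: Lambda_add\<close>)
  have add: "G (x + y) = G x + G y" for x y
    by (rule eq_on_dense[OF Lambda_dense, where x = x])
      (auto intro!: contc continuous_intros cont simp: add1)
  \<comment> \<open>Homogeneity of \<open>f\<close> is given for scalar operators, so a real factor
    is rewritten as one.\<close>
  have scale1: "G (r *\<^sub>R \<Lambda> a) = r *\<^sub>R G (\<Lambda> a)" if a: "a \<in> M" for r a
  proof -
    have "r *\<^sub>R \<Lambda> a = \<Lambda> (scalar_op (of_real r) o\<^sub>L a)"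
      "r *\<^sub>R \<Lambda> (f a) = \<Lambda> (scalar_op (of_real r) o\<^sub>L f a)"
      using a f(1) by (simp_all add: Lambda_scale cscale_of_real)
    then show ?thesis using a by (simp add: G f(3) M_closed)
  qed
  have scale: "G (r *\<^sub>R x) = r *\<^sub>R G x" for r x
    by (rule eq_on_dense[OF Lambda_dense, where x = x])
      (auto intro!: contc continuous_intros cont simp: scale1)
  have bound: "norm (G x) \<le> norm x * C" for x
  proof -
    have "closed {x. norm (G x) \<le> norm x * C}"
      by (intro closed_Collect_le continuous_intros cont)
    moreover have "\<Lambda> ` M \<subseteq> {x. norm (G x) \<le> norm x * C}" using C by (auto simp: G mult.commute)
    ultimately have "closure (\<Lambda> ` M) \<subseteq> {x. norm (G x) \<le> norm x * C}" by (rule closure_minimal[rotated])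
    then show ?thesis by (auto simp: Lambda_dense)
  qed
  have "bounded_linear G" by (rule bounded_linear_intro[OF add scale bound])
  then have "\<forall>a\<in>M. blinfun_apply (Blinfun G) (\<Lambda> a) = \<Lambda> (f a)"
    by (simp add: bounded_linear_Blinfun_apply G)
  moreover have "T = T'" if "\<forall>a\<in>M. blinfun_apply T (\<Lambda> a) = \<Lambda> (f a)"
    "\<forall>a\<in>M. blinfun_apply T' (\<Lambda> a) = \<Lambda> (f a)" for T T' :: "'k \<Rightarrow>\<^sub>L 'k"
    by (rule blinfun_eqI, rule eq_on_dense[OF Lambda_dense])
      (use that in \<open>auto intro!: continuous_intros\<close>)
  ultimately have "\<exists>!T. \<forall>a\<in>M. blinfun_apply T (\<Lambda> a) = \<Lambda> (f a)" by blast
  from theI'[OF this] have "\<forall>a\<in>M. blinfun_apply (L2_extension M \<Lambda> f) (\<Lambda> a) = \<Lambda> (f a)"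
    by (simp only: L2_extension_def)
  then show ?thesis using a by blast
qed

lemma norm_Lambda: "a \<in> M \<Longrightarrow> complex_of_real ((norm (\<Lambda> a))\<^sup>2) = \<tau> (adj a o\<^sub>L a)"
  by (metis cinner_Lambda cinner_self)

text \<open>By traciality the squared norm of \<open>\<Lambda> (m o\<^sub>L a)\<close> is the trace
  of \<open>m o\<^sub>L a o\<^sub>L adj a o\<^sub>L adj m\<close>. The operator
  \<open>a o\<^sub>L adj a\<close> is at most the squared norm of \<open>adj a\<close>, and
  conjugation by \<open>m\<close> preserves this inequality.\<close>

lemma norm_Lambda_right:
  assumes "a \<in> M" "m \<in> M"
  shows "norm (\<Lambda> (m o\<^sub>L a)) \<le> norm (adj a) * norm (\<Lambda> m)"
proof -
  define c where "c = (norm (adj a))\<^sup>2"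
  define q where "q = m o\<^sub>L adj m"
  define r where "r = (m o\<^sub>L a) o\<^sub>L adj (m o\<^sub>L a)"
  have qr: "q \<in> M" "r \<in> M" using assms by (auto simp: q_def r_def M_closed)
  define p where "p = (scalar_op (of_real c) o\<^sub>L q) - r"
  have p: "p \<in> M" using qr by (simp add: p_def M_closed)
  have "cinner v (blinfun_apply p v) = of_real (c * (norm (blinfun_apply (adj m) v))\<^sup>2
      - (norm (blinfun_apply (adj a) (blinfun_apply (adj m) v)))\<^sup>2)" for v
    using assms
    by (simp add: p_def q_def r_def blinfun.diff_left scalar_op_apply cinner_diff_right cinner_cscale_right
        adj_compose[OF M_vN] adj_left[OF M_vN, symmetric] cinner_self)
  moreover have "(norm (blinfun_apply (adj a) w))\<^sup>2 \<le> c * (norm w)\<^sup>2" for w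
    unfolding c_def power_mult_distrib[symmetric] by (intro power_mono norm_blinfun) simp
  ultimately have "positive_op p"
    unfolding positive_op_def by (simp only: nonneg_Reals_of_real_iff diff_ge_0_iff_ge simp_thms)
  then have "\<tau> p \<in> \<real>\<^sub>\<ge>\<^sub>0" using tau_positive p by blast
  moreover have "\<tau> q = of_real ((norm (\<Lambda> m))\<^sup>2)"
    using assms norm_Lambda[of m] tau_commute[of m "adj m"] by (simp add: q_def M_closed)
  moreover have "\<tau> r = of_real ((norm (\<Lambda> (m o\<^sub>L a)))\<^sup>2)"
    using assms norm_Lambda[of "m o\<^sub>L a"] tau_commute[of "m o\<^sub>L a" "adj (m o\<^sub>L a)"]
    by (simp add: r_def M_closed)
  ultimately have "of_real (c * (norm (\<Lambda> m))\<^sup>2 - (norm (\<Lambda> (m o\<^sub>L a)))\<^sup>2) \<in> (\<real>\<^sub>\<ge>\<^sub>0 :: complex set)"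
    using qr by (simp add: p_def tau_diff tau_scale M_closed)
  then have "(norm (\<Lambda> (m o\<^sub>L a)))\<^sup>2 \<le> (norm (adj a) * norm (\<Lambda> m))\<^sup>2"
    unfolding nonneg_Reals_of_real_iff by (simp add: c_def power_mult_distrib)
  then show ?thesis by (simp add: power2_le_iff_abs_le)
qed

lemma right_action_Lambda:
  assumes "a \<in> M" "m \<in> M"
  shows "right_action M \<Lambda> (\<Lambda> m) a = \<Lambda> (m o\<^sub>L a)"
  unfolding right_action_def
  by (rule L2_extension_Lambda[where C = "norm (adj a)"])
    (use assms norm_Lambda_right M_closed in \<open>auto simp: op_compose_add_left op_compose_assoc\<close>)

lemma continuous_on_right_action [continuous_intros]:
  "continuous_on S h \<Longrightarrow> continuous_on S (\<lambda>x. right_action M \<Lambda> (h x) a)"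
  unfolding right_action_def by (intro continuous_intros)

lemma right_action_id: "right_action M \<Lambda> \<xi> id_blinfun = \<xi>"
  by (rule eq_on_dense[OF Lambda_dense, where x = \<xi>])
    (auto intro!: continuous_intros simp: right_action_Lambda M_closed)

lemma right_action_compose:
  assumes "a \<in> M" "b \<in> M"
  shows "right_action M \<Lambda> (right_action M \<Lambda> \<xi> a) b = right_action M \<Lambda> \<xi> (a o\<^sub>L b)"
  by (rule eq_on_dense[OF Lambda_dense, where x = \<xi>])
    (use assms in \<open>auto intro!: continuous_intros simp: right_action_Lambda M_closed op_compose_assoc\<close>)

text \<open>Traciality makes the adjoint of a right multiplication again a right
  multiplication.\<close>

lemma cinner_right_action:
  assumes "c \<in> M" "a \<in> M"
  shows "cinner (\<Lambda> c) (right_action M \<Lambda> \<xi> a) = cinner (\<Lambda> (c o\<^sub>L adj a)) \<xi>"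
proof (rule eq_on_dense[OF Lambda_dense, where x = \<xi>])
  fix y assume "y \<in> \<Lambda> ` M"
  then obtain m where m: "m \<in> M" "y = \<Lambda> m" by blast
  have "\<tau> (adj c o\<^sub>L (m o\<^sub>L a)) = \<tau> (a o\<^sub>L (adj c o\<^sub>L m))"
    using assms m tau_commute[of "adj c o\<^sub>L m" a] by (simp add: M_closed op_compose_assoc)
  then show "cinner (\<Lambda> c) (right_action M \<Lambda> y a) = cinner (\<Lambda> (c o\<^sub>L adj a)) y"
    using assms m
    by (simp add: right_action_Lambda cinner_Lambda M_closed adj_compose[OF M_vN] adj_adj[OF M_vN]
        op_compose_assoc)
qed (auto intro!: continuous_intros)

end

section \<open>The conditional expectation on L2\<close>

locale tracial_GNS_expectation = tracial_GNS M \<tau> \<Lambda>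
  for M :: "('h::complex_hilbert_space \<Rightarrow>\<^sub>L 'h) set" and \<tau> and \<Lambda> :: "('h \<Rightarrow>\<^sub>L 'h) \<Rightarrow> 'k::complex_hilbert_space" +
  fixes B :: "('h \<Rightarrow>\<^sub>L 'h) set" and E :: "('h \<Rightarrow>\<^sub>L 'h) \<Rightarrow> ('h \<Rightarrow>\<^sub>L 'h)"
  assumes B_vN: "von_neumann_algebra B" and B_sub: "B \<subseteq> M"
    and expectation: "conditional_expectation M \<tau> B E"
begin

lemmas B_closed = vN_id[OF B_vN] vN_add[OF B_vN] vN_scale[OF B_vN] vN_compose[OF B_vN]
  vN_minus[OF B_vN] vN_diff[OF B_vN] vN_zero[OF B_vN] vN_adj[OF B_vN]

lemma B_M: "b \<in> B \<Longrightarrow> b \<in> M"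
  using B_sub by blast

lemma
  shows E_add: "a \<in> M \<Longrightarrow> b \<in> M \<Longrightarrow> E (a + b) = E a + E b"
    and E_scale: "a \<in> M \<Longrightarrow> E (scalar_op c o\<^sub>L a) = scalar_op c o\<^sub>L E a"
    and E_B: "a \<in> M \<Longrightarrow> E a \<in> B"
    and E_id: "b \<in> B \<Longrightarrow> E b = b"
    and E_bimodule: "a \<in> M \<Longrightarrow> b \<in> B \<Longrightarrow> b' \<in> B \<Longrightarrow> E (b o\<^sub>L a o\<^sub>L b') = b o\<^sub>L E a o\<^sub>L b'"
    and tau_E: "a \<in> M \<Longrightarrow> \<tau> (E a) = \<tau> a"
  using expectation unfolding conditional_expectation_def linear_on_ops_def by (simp_all add: image_subset_iff)

lemma E_left: "a \<in> M \<Longrightarrow> b \<in> B \<Longrightarrow> E (b o\<^sub>L a) = b o\<^sub>L E a"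
  using E_bimodule[of a b id_blinfun] B_closed by simp

lemma E_right: "a \<in> M \<Longrightarrow> b \<in> B \<Longrightarrow> E (a o\<^sub>L b) = E a o\<^sub>L b"
  using E_bimodule[of a id_blinfun b] B_closed by simp

lemma tau_E_left: "a \<in> M \<Longrightarrow> b \<in> B \<Longrightarrow> \<tau> (b o\<^sub>L E a) = \<tau> (b o\<^sub>L a)"
  using tau_E[of "b o\<^sub>L a"] B_M by (simp add: E_left M_closed)

text \<open>Both sides lie in \<open>B\<close> and have the same trace against every
  \<open>b \<in> B\<close>. With the adjoint of their difference for \<open>b\<close>, faithfulness
  of the trace makes the difference vanish.\<close>

lemma E_adj:
  assumes a: "a \<in> M"
  shows "E (adj a) = adj (E a)"
proof -
  have eq: "\<tau> (b o\<^sub>L E (adj a)) = \<tau> (b o\<^sub>L adj (E a))" if b: "b \<in> B" for b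
  proof -
    have "\<tau> (b o\<^sub>L E (adj a)) = \<tau> (b o\<^sub>L adj a)" using a b by (simp add: tau_E_left M_closed)
    also have "b o\<^sub>L adj a = adj (a o\<^sub>L adj b)"
      using a b B_M by (simp add: adj_compose[OF M_vN] adj_adj[OF M_vN] M_closed)
    also have "\<tau> \<dots> = cnj (\<tau> (E (a o\<^sub>L adj b)))"
      using a b B_M by (simp add: tau_adj tau_E M_closed)
    also have "\<dots> = cnj (\<tau> (E a o\<^sub>L adj b))" using a b by (simp add: E_right B_closed)
    also have "\<dots> = \<tau> (adj (E a o\<^sub>L adj b))"
      using a b B_M E_B by (simp add: tau_adj M_closed)
    also have "adj (E a o\<^sub>L adj b) = b o\<^sub>L adj (E a)"
      using a b B_M E_B by (simp add: adj_compose[OF M_vN] adj_adj[OF M_vN] M_closed)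
    finally show ?thesis .
  qed
  define d where "d = E (adj a) - adj (E a)"
  have mem: "E (adj a) \<in> B" "adj (E a) \<in> B" using a E_B by (auto simp: M_closed B_closed)
  then have d: "d \<in> B" by (simp add: d_def B_closed)
  have "\<tau> (adj d o\<^sub>L d) = \<tau> ((adj d o\<^sub>L E (adj a)) - (adj d o\<^sub>L adj (E a)))"
    by (subst (2) d_def) (simp only: bounded_bilinear.diff_right[OF bounded_bilinear_blinfun_compose])
  also have "\<dots> = 0"
    using eq[of "adj d"] d mem B_M by (simp add: tau_diff B_closed M_closed)
  finally have "d = 0" using d tau_faithful B_M by blast
  then show ?thesis by (simp add: d_def)
qed

abbreviation "L2E \<equiv> blinfun_apply (L2_extension M \<Lambda> E)"

text \<open>Pythagoras: \<open>\<Lambda> m - \<Lambda> (E m)\<close> is orthogonal to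
  \<open>\<Lambda> (E m)\<close>, because the trace of \<open>adj (E m) o\<^sub>L m\<close> does not
  change when the last factor is replaced by \<open>E m\<close>.\<close>

lemma norm_Lambda_E:
  assumes m: "m \<in> M"
  shows "norm (\<Lambda> (E m)) \<le> norm (\<Lambda> m)"
proof -
  have e: "E m \<in> B" "E m \<in> M" using m E_B B_M by auto
  have "cinner (\<Lambda> (E m)) (\<Lambda> m) = \<tau> (adj (E m) o\<^sub>L E m)"
    using m e by (simp add: cinner_Lambda tau_E_left B_closed)
  then have 1: "cinner (\<Lambda> (E m)) (\<Lambda> m) = of_real ((norm (\<Lambda> (E m)))\<^sup>2)"
    using norm_Lambda[OF e(2)] by simp
  then have 2: "cinner (\<Lambda> m) (\<Lambda> (E m)) = of_real ((norm (\<Lambda> (E m)))\<^sup>2)"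
    by (metis cinner_commute complex_cnj_complex_of_real)
  have "cinner (\<Lambda> m - \<Lambda> (E m)) (\<Lambda> m - \<Lambda> (E m)) = cinner (\<Lambda> m) (\<Lambda> m) - cinner (\<Lambda> (E m)) (\<Lambda> (E m))"
    by (simp only: cinner_diff_left cinner_diff_right 1 2 cinner_self[of "\<Lambda> (E m)"]) simp
  then have "(norm (\<Lambda> m - \<Lambda> (E m)))\<^sup>2 = (norm (\<Lambda> m))\<^sup>2 - (norm (\<Lambda> (E m)))\<^sup>2"
    unfolding cinner_self of_real_diff[symmetric] of_real_eq_iff .
  then have "(norm (\<Lambda> (E m)))\<^sup>2 \<le> (norm (\<Lambda> m))\<^sup>2"
    by (metis diff_ge_0_iff_ge zero_le_power2)
  then show ?thesis by (simp add: power2_le_iff_abs_le)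
qed

lemma L2E_Lambda: "m \<in> M \<Longrightarrow> L2E (\<Lambda> m) = \<Lambda> (E m)"
  by (rule L2_extension_Lambda[where C = 1])
    (use norm_Lambda_E E_B B_M in \<open>auto simp: E_add E_scale\<close>)

text \<open>In effect \<open>L2E\<close> is the orthogonal projection onto L2(B), so pairings with
  \<open>B\<close> do not see it.\<close>

lemma cinner_L2E:
  assumes "b \<in> B"
  shows "cinner (\<Lambda> b) (L2E \<zeta>) = cinner (\<Lambda> b) \<zeta>"
  by (rule eq_on_dense[OF Lambda_dense, where x = \<zeta>])
    (use assms B_M E_B in \<open>auto intro!: continuous_intros
      simp: L2E_Lambda cinner_Lambda tau_E_left B_closed M_closed\<close>)

lemma L2E_right:
  assumes "b \<in> B"
  shows "L2E (right_action M \<Lambda> \<zeta> b) = right_action M \<Lambda> (L2E \<zeta>) b"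
  by (rule eq_on_dense[OF Lambda_dense, where x = \<zeta>])
    (use assms B_M E_B in \<open>auto intro!: continuous_intros
      simp: L2E_Lambda right_action_Lambda E_right M_closed\<close>)

lemma L2E_range: "L2E \<zeta> \<in> closure (\<Lambda> ` B)"
proof -
  have "L2E ` closure (\<Lambda> ` M) \<subseteq> closure (\<Lambda> ` B)"
  proof (rule image_closure_subset)
    show "L2E ` (\<Lambda> ` M) \<subseteq> closure (\<Lambda> ` B)"
      using E_B closure_subset[of "\<Lambda> ` B"] by (auto simp: L2E_Lambda)
  qed (auto intro!: continuous_intros)
  then show ?thesis by (auto simp: Lambda_dense)
qed

text \<open>The difference is orthogonal to the closure, which contains both vectors, and hence to
  itself.\<close>

lemma closure_Lambda_B_eqI:
  assumes "\<zeta> \<in> closure (\<Lambda> ` B)" "\<zeta>' \<in> closure (\<Lambda> ` B)"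
    and "\<And>b. b \<in> B \<Longrightarrow> cinner (\<Lambda> b) \<zeta> = cinner (\<Lambda> b) \<zeta>'"
  shows "\<zeta> = \<zeta>'"
proof -
  have "closed {y. cinner y (\<zeta> - \<zeta>') = 0}"
    by (intro closed_Collect_eq continuous_intros)
  moreover have "\<Lambda> ` B \<subseteq> {y. cinner y (\<zeta> - \<zeta>') = 0}" using assms(3) by (auto simp: cinner_diff_right)
  ultimately have "closure (\<Lambda> ` B) \<subseteq> {y. cinner y (\<zeta> - \<zeta>') = 0}" by (rule closure_minimal[rotated])
  then have "cinner \<zeta> (\<zeta> - \<zeta>') = 0" "cinner \<zeta>' (\<zeta> - \<zeta>') = 0" using assms by auto
  then have "cinner (\<zeta> - \<zeta>') (\<zeta> - \<zeta>') = 0" by (simp add: cinner_diff_left)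
  then show ?thesis by (simp add: cinner_self)
qed

end

section \<open>Covariance matrices\<close>

lemma Rep_ell2_sum: "Rep_ell2 (sum f F) k = (\<Sum>i\<in>F. Rep_ell2 (f i) k)"
  by (induction F rule: infinite_finite_induct) (auto simp: zero_ell2.rep_eq plus_ell2.rep_eq)

lemma cinner_single: "cinner (single i h) y = cinner h (Rep_ell2 y i)"
proof -
  have "cinner (single i h) y = (\<Sum>\<^sub>\<infinity>k. cinner (if k = i then h else 0) (Rep_ell2 y k))"
    by (simp add: cinner_ell2.rep_eq Rep_single)
  also have "\<dots> = cinner h (Rep_ell2 y i)"
    by (subst infsum_cong_neutral[where T = "{i}" and g = "\<lambda>k. cinner h (Rep_ell2 y k)"])
      (auto simp: cinner_zero_left)
  finally show ?thesis .
qed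

text \<open>The \<sigma>-weak limit is tested against the single pair of vectors
  \<open>single i h\<close> and \<open>single j k\<close>. There every square truncation with
  \<open>i\<close> and \<open>j\<close> in \<open>F\<close> takes the same value, so the limit takes
  it too.\<close>

lemma covariance_matrix_entry:
  assumes cov: "covariance_matrix B \<eta> \<eta>c" and b: "b \<in> B"
  shows "cinner (single i h) (blinfun_apply (\<eta> b) (single j k)) = cinner h (blinfun_apply (\<eta>c i j b) k)"
proof (rule ccontr)
  define \<phi> where "\<phi> = (\<lambda>a. cinner (single i h) (blinfun_apply a (single j k)))"
  define t where "t = cinner h (blinfun_apply (\<eta>c i j b) k)"
  define s where "s = (\<lambda>F. \<Sum>i\<in>F. \<Sum>j\<in>F. mat_unit i j (\<eta>c i j b))"
  assume "cinner (single i h) (blinfun_apply (\<eta> b) (single j k)) \<noteq> cinner h (blinfun_apply (\<eta>c i j b) k)"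
  then have ne: "\<phi> (\<eta> b) \<in> - {t}" by (simp add: \<phi>_def t_def)
  \<comment> \<open>A single matrix coefficient is one of the functionals that generate the
    topology, given by sequences supported at 0.\<close>
  define u where "u = (\<lambda>n::nat. if n = 0 then single i h else 0)"
  define v where "v = (\<lambda>n::nat. if n = 0 then single j k else 0)"
  have \<phi>: "\<phi> a = (\<Sum>n. cinner (u n) (blinfun_apply a (v n)))" for a
  proof -
    have "(\<lambda>n. cinner (u n) (blinfun_apply a (v n))) = (\<lambda>n. if n = 0 then \<phi> a else 0)"
      by (auto simp: u_def v_def \<phi>_def cinner_zero_left)
    then show ?thesis using sums_single[of 0 "\<lambda>_. \<phi> a"] by (simp add: sums_iff)
  qed
  have "summable (\<lambda>n. (norm (u n))\<^sup>2)" "summable (\<lambda>n. (norm (v n))\<^sup>2)"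
    by (rule summable_finite[of "{0}"]; simp add: u_def v_def)+
  then have "openin sigma_weak {a. \<phi> a \<in> - {t}}"
    unfolding sigma_weak_def \<phi> by (intro topology_generated_by_Basis) (blast intro: open_Compl closed_singleton)
  moreover have "limitin sigma_weak s (\<eta> b) (finite_subsets_at_top UNIV)"
    using cov b by (simp add: covariance_matrix_def s_def)
  moreover have "\<eta> b \<in> {a. \<phi> a \<in> - {t}}" using ne by simp
  ultimately have "\<forall>\<^sub>F F in finite_subsets_at_top UNIV. s F \<in> {a. \<phi> a \<in> - {t}}"
    unfolding limitin_def by blast
  then obtain F0 where F0: "finite F0" "\<And>F. finite F \<Longrightarrow> F0 \<subseteq> F \<Longrightarrow> \<phi> (s F) \<noteq> t"
    by (auto simp: eventually_finite_subsets_at_top)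
  \<comment> \<open>Enlarging \<open>F0\<close> by both indices brings the entry
    \<open>(i, j)\<close> into the truncation.\<close>
  define F where "F = insert i (insert j F0)"
  have F: "finite F" "F0 \<subseteq> F" "i \<in> F" "j \<in> F" using F0(1) by (auto simp: F_def)
  have "Rep_ell2 (blinfun_apply (s F) (single j k)) i
      = (\<Sum>i'\<in>F. \<Sum>j'\<in>F. if i = i' then if j' = j then blinfun_apply (\<eta>c i' j' b) k else 0 else 0)"
    unfolding s_def blinfun.sum_left Rep_ell2_sum
    by (intro sum.cong refl) (simp add: mat_unit_apply Rep_single blinfun.zero_right)
  also have "\<dots> = (\<Sum>i'\<in>F. if i = i' then blinfun_apply (\<eta>c i' j b) k else 0)"
    by (intro sum.cong refl) (simp add: F sum.delta)
  also have "\<dots> = blinfun_apply (\<eta>c i j b) k" using F by (simp add: sum.delta)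
  finally have "\<phi> (s F) = t" by (simp add: \<phi>_def t_def cinner_single)
  then show False using F0(2)[OF F(1,2)] by blast
qed

text \<open>The matrix with rows \<open>(\<kappa>, b)\<close> and \<open>(b\<^sup>*, \<kappa>)\<close> is positive for large \<open>\<kappa>\<close>, so its image under \<open>\<eta>\<close>
  is self-adjoint.\<close>

lemma covariance_matrix_adj:
  fixes B :: "('h::complex_hilbert_space \<Rightarrow>\<^sub>L 'h) set"
  assumes B: "von_neumann_algebra B" and cov: "covariance_matrix B \<eta> \<eta>c" and b: "b \<in> B"
  shows "adj (\<eta>c i j b) = \<eta>c j i (adj b)"
proof (rule adj_eqI)
  fix h k
  \<comment> \<open>The constant is read off from \<open>cmod_cinner_le\<close>:
    \<open>- 2 * Re z\<close> is at most \<open>2 * (norm (v 0))\<^sup>2 + 2 * (norm b)\<^sup>2 *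
    (norm (v 1))\<^sup>2\<close>.\<close>
  define K where "K = scalar_op (of_real (2 + 2 * (norm b)\<^sup>2)) o\<^sub>L (id_blinfun :: 'h \<Rightarrow>\<^sub>L 'h)"
  have K: "K \<in> B" unfolding K_def by (intro vN_scale[OF B] vN_id[OF B])
  define a where "a = (\<lambda>k l :: nat. if k = l then K else if k = 0 then b else adj b)"
  have "positive_matrix 2 a"
    unfolding positive_matrix_def
  proof
    fix v :: "nat \<Rightarrow> 'h"
    define z where "z = cinner (v 0) (blinfun_apply b (v 1))"
    have "cinner (v 1) (blinfun_apply (adj b) (v 0)) = cnj z"
      unfolding z_def by (metis adj_right[OF B b] cinner_commute)
    then have "(\<Sum>k<2. \<Sum>l<2. cinner (v k) (blinfun_apply (a k l) (v l)))
        = of_real ((2 + 2 * (norm b)\<^sup>2) * ((norm (v 0))\<^sup>2 + (norm (v 1))\<^sup>2)) + (z + cnj z)"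
      by (simp add: numeral_2_eq_2 a_def K_def scalar_op_apply cinner_cscale_right cinner_self
          z_def algebra_simps)
    also have "\<dots> = of_real ((2 + 2 * (norm b)\<^sup>2) * ((norm (v 0))\<^sup>2 + (norm (v 1))\<^sup>2) + 2 * Re z)"
      by (simp add: complex_add_cnj)
    also have "\<dots> \<in> \<real>\<^sub>\<ge>\<^sub>0"
    proof -
      have "cmod z \<le> (norm (v 0))\<^sup>2 + (norm (blinfun_apply b (v 1)))\<^sup>2"
        unfolding z_def by (rule cmod_cinner_le)
      also have "(norm (blinfun_apply b (v 1)))\<^sup>2 \<le> (norm b)\<^sup>2 * (norm (v 1))\<^sup>2"
        unfolding power_mult_distrib[symmetric] by (intro power_mono norm_blinfun) simp
      finally have "- Re z \<le> (norm (v 0))\<^sup>2 + (norm b)\<^sup>2 * (norm (v 1))\<^sup>2"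
        using abs_Re_le_cmod[of z] by linarith
      moreover have "0 \<le> (norm b)\<^sup>2 * (norm (v 0))\<^sup>2" "0 \<le> (norm (v 1))\<^sup>2" by simp_all
      ultimately have "0 \<le> (2 + 2 * (norm b)\<^sup>2) * ((norm (v 0))\<^sup>2 + (norm (v 1))\<^sup>2) + 2 * Re z"
        unfolding distrib_left distrib_right by linarith
      then show ?thesis unfolding nonneg_Reals_of_real_iff .
    qed
    finally show "(\<Sum>k<2. \<Sum>l<2. cinner (v k) (blinfun_apply (a k l) (v l))) \<in> \<real>\<^sub>\<ge>\<^sub>0" .
  qed
  moreover have "\<forall>k<2. \<forall>l<2. a k l \<in> B" using K b vN_adj[OF B b] by (simp add: a_def)
  ultimately have pos: "positive_matrix 2 (\<lambda>k l. \<eta> (a k l))"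
    using cov by (auto simp: covariance_matrix_def completely_positive_def)
  have entry: "cinner u (blinfun_apply (\<eta> K) u) + cinner u (blinfun_apply (\<eta> b) w)
      + (cinner w (blinfun_apply (\<eta> (adj b)) u) + cinner w (blinfun_apply (\<eta> K) w)) \<in> \<real>" for u w
  proof -
    define v where "v = (\<lambda>k :: nat. if k = 0 then u else w)"
    have "(\<Sum>k<2. \<Sum>l<2. cinner (v k) (blinfun_apply (\<eta> (a k l)) (v l))) \<in> \<real>"
      using pos nonneg_Reals_subset_Reals unfolding positive_matrix_def by blast
    then show ?thesis by (simp add: numeral_2_eq_2 a_def v_def)
  qed
  \<comment> \<open>With one vector zero only a diagonal term remains; subtracting the diagonal
    terms isolates the sum of the off-diagonal ones.\<close>
  have diag: "cinner u (blinfun_apply (\<eta> K) u) \<in> \<real>" for u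
    using entry[of u 0] by (simp add: blinfun.zero_right cinner_zero_left cinner_zero_right)
  have off: "cinner u (blinfun_apply (\<eta> b) w) + cinner w (blinfun_apply (\<eta> (adj b)) u) \<in> \<real>" for u w
    using Reals_diff[OF Reals_diff[OF entry[of u w] diag[of u]] diag[of w]] by (simp add: algebra_simps)
  define X where "X = \<eta>c i j b"
  define Y where "Y = \<eta>c j i (adj b)"
  have real: "cinner h (blinfun_apply X k) + cinner k (blinfun_apply Y h) \<in> \<real>" for h k
    using off[of "single i h" "single j k"] covariance_matrix_entry[OF cov] b vN_adj[OF B b]
    by (simp add: X_def Y_def)
  have "X \<in> B" "Y \<in> B"
    using cov b vN_adj[OF B b] by (auto simp: covariance_matrix_def X_def Y_def image_subset_iff)
  then have lin: "blinfun_apply X (cscale c v) = cscale c (blinfun_apply X v)" for c v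
    using vN_bounded[OF B] by (auto simp: bounded_ops_def)
  \<comment> \<open>Polarisation: realness at \<open>k\<close> relates the imaginary parts, and
    realness at \<open>cscale \<i> k\<close> relates the real parts.\<close>
  have "\<i> * cinner h (blinfun_apply X k) - \<i> * cinner k (blinfun_apply Y h) \<in> \<real>" for h k
    using real[of h "cscale \<i> k"] by (simp add: lin cinner_cscale_right cinner_cscale_left)
  then have "Im (cinner h (blinfun_apply X k)) = - Im (cinner k (blinfun_apply Y h))"
    "Re (cinner h (blinfun_apply X k)) = Re (cinner k (blinfun_apply Y h))" for h k
    using real[of h k] by (auto simp: complex_is_Real_iff)
  then have "cinner h (blinfun_apply X k) = cnj (cinner k (blinfun_apply Y h))" for h k
    by (simp add: complex_eq_iff)
  then show "cinner (blinfun_apply (\<eta>c j i (adj b)) h) k = cinner h (blinfun_apply (\<eta>c i j b) k)"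
    using cinner_commute[of "blinfun_apply Y h" k] by (simp add: X_def Y_def)
qed

section \<open>Conjugate variables and cumulants\<close>

lemma word_cong:
  assumes "\<And>p. k \<le> p \<Longrightarrow> p \<le> k + n \<Longrightarrow> b p = b' p" "\<And>p. k < p \<Longrightarrow> p \<le> k + n \<Longrightarrow> j p = j' p"
  shows "word x b j k n = word x b' j' k n"
  using assms by (induction n) auto

lemma word_Suc_left:
  fixes x :: "'i \<Rightarrow> 'h::complex_hilbert_space \<Rightarrow>\<^sub>L 'h"
  shows "word x b j k (Suc n) = (b k o\<^sub>L x (j (Suc k))) o\<^sub>L word x b j (Suc k) n"
  by (induction n) (simp_all add: op_compose_assoc)

lemma word_update_left:
  fixes x :: "'i \<Rightarrow> 'h::complex_hilbert_space \<Rightarrow>\<^sub>L 'h"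
  shows "word x (b(k := c o\<^sub>L b k)) j k n = c o\<^sub>L word x b j k n"
  by (induction n) (simp_all add: op_compose_assoc)

lemma word_update_right:
  fixes x :: "'i \<Rightarrow> 'h::complex_hilbert_space \<Rightarrow>\<^sub>L 'h"
  shows "word x (b(k + n := b (k + n) o\<^sub>L c)) j k n = word x b j k n o\<^sub>L c"
proof (cases n)
  case (Suc m)
  have "word x (b(k + n := b (k + n) o\<^sub>L c)) j k m = word x b j k m"
    by (rule word_cong) (use Suc in auto)
  then show ?thesis using Suc by (simp add: op_compose_assoc)
qed simp

text \<open>Unlike for \<open>list_product\<close>, the empty product is the unit, which is the
  right value for an empty gap.\<close>

primrec op_product :: "('h::real_normed_vector \<Rightarrow>\<^sub>L 'h) list \<Rightarrow> ('h \<Rightarrow>\<^sub>L 'h)" where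
  "op_product [] = id_blinfun"
| "op_product (a # as) = a o\<^sub>L op_product as"

text \<open>In a product of entries \<open>b\<^sub>k x\<^bsub>j(k)\<^esub> c\<^sub>k\<close> the adjacent coefficients \<open>c\<^sub>k\<close> and \<open>b\<^bsub>k+1\<^esub>\<close> merge.\<close>

lemma word_op_product:
  fixes x :: "'i \<Rightarrow> 'h::complex_hilbert_space \<Rightarrow>\<^sub>L 'h"
  shows "word x (\<lambda>p. c p o\<^sub>L b (Suc p)) j l n =
    (c l o\<^sub>L op_product (map (\<lambda>k. b k o\<^sub>L x (j k) o\<^sub>L c k) [Suc l..<Suc (l + n)])) o\<^sub>L b (Suc (l + n))"
proof (induction n arbitrary: l)
  case 0
  then show ?case by simp
next
  case (Suc n)
  have "[Suc l..<Suc (l + Suc n)] = Suc l # [Suc (Suc l)..<Suc (Suc l + n)]"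
    by (simp add: upt_conv_Cons del: upt_Suc)
  then show ?case
    unfolding word_Suc_left Suc.IH by (simp add: op_compose_assoc del: upt_Suc)
qed

section \<open>Products with one vector factor\<close>

context tracial_GNS
begin

lemma L2_product_ops: "L2_product M \<Lambda> (a, 0) (b, 0) = (a o\<^sub>L b, 0)"
  by (simp add: L2_product_def left_action_def right_action_def blinfun.zero_right)

lemma L2_product_vector: "L2_product M \<Lambda> (0, \<zeta>) (a, 0) = (0, right_action M \<Lambda> \<zeta> a)"
  by (simp add: L2_product_def left_action_def blinfun.zero_right)

lemma list_product_ops:
  "as \<noteq> [] \<Longrightarrow> list_product (L2_product M \<Lambda>) (map (\<lambda>a. (a, 0)) as) = (op_product as, 0)"
proof (induction as)
  case (Cons a as)
  then show ?case by (cases as) (auto simp: L2_product_ops)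
qed simp

lemma list_product_vector:
  "list_product (L2_product M \<Lambda>) ((0, \<zeta>) # map (\<lambda>a. (a, 0)) as)
    = (0, right_action M \<Lambda> \<zeta> (op_product as))"
proof (cases as)
  case (Cons a as')
  then show ?thesis using list_product_ops[of as] by (simp add: L2_product_vector)
qed (simp add: right_action_id)

end

text \<open>Of the covariance matrix only its entries remain here. \<open>eta_adj\<close> is where
  complete positivity enters, through \<open>covariance_matrix_adj\<close>.\<close>

locale conjugate_setting = tracial_GNS_expectation M \<tau> \<Lambda> B E
  for M :: "('h::complex_hilbert_space \<Rightarrow>\<^sub>L 'h) set" and \<tau> and \<Lambda> :: "('h \<Rightarrow>\<^sub>L 'h) \<Rightarrow> 'k::complex_hilbert_space"
    and B E +
  fixes x :: "'i \<Rightarrow> ('h \<Rightarrow>\<^sub>L 'h)" and \<eta>c :: "'i \<Rightarrow> 'i \<Rightarrow> ('h \<Rightarrow>\<^sub>L 'h) \<Rightarrow> ('h \<Rightarrow>\<^sub>L 'h)"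
    and i :: 'i and \<xi> :: 'k
  assumes x_M: "x j \<in> M" and x_adj: "adj (x j) = x j"
    and eta_add: "a \<in> B \<Longrightarrow> b \<in> B \<Longrightarrow> \<eta>c i j (a + b) = \<eta>c i j a + \<eta>c i j b"
    and eta_B: "b \<in> B \<Longrightarrow> \<eta>c j j' b \<in> B"
    and eta_adj: "b \<in> B \<Longrightarrow> adj (\<eta>c j j' b) = \<eta>c j' j (adj b)"
    and eta_symmetric: "tau_symmetric B \<tau> \<eta>c"
begin

section \<open>Reversal of words and the moment form of the conjugate relation\<close>

lemma eta_tau: "a \<in> B \<Longrightarrow> b \<in> B \<Longrightarrow> \<tau> (\<eta>c j j' a o\<^sub>L b) = \<tau> (a o\<^sub>L \<eta>c j' j b)"
  using eta_symmetric by (simp add: tau_symmetric_def)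

lemma word_M: "(\<And>p. k \<le> p \<Longrightarrow> p \<le> k + n \<Longrightarrow> b p \<in> B) \<Longrightarrow> word x b j k n \<in> M"
  by (induction n) (auto simp: B_M x_M M_closed)

text \<open>The variables are self-adjoint, so the adjoint reads the word backwards with adjoint
  coefficients. Coefficients are numbered from 0 and variables from 1, hence the reflections
  \<open>d - p\<close> and \<open>Suc d - p\<close>.\<close>

lemma adj_word:
  assumes "\<And>p. p \<le> d \<Longrightarrow> b p \<in> B" "k + n \<le> d"
  shows "adj (word x b j k n) = word x (\<lambda>p. adj (b (d - p))) (\<lambda>p. j (Suc d - p)) (d - (k + n)) n"
  using assms(2)
proof (induction n)
  case 0
  then show ?case by simp
next
  case (Suc n)
  have eq: "Suc (d - (k + Suc n)) = d - (k + n)" "Suc d - (d - (k + n)) = k + Suc n" "d - (d - (k + Suc n)) = k + Suc n"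
    using Suc.prems by auto
  have W: "word x b j k n \<in> M" by (rule word_M) (use Suc.prems assms(1) in auto)
  have bM: "b (k + Suc n) \<in> M" using Suc.prems assms(1) B_M by auto
  have "adj (word x b j k (Suc n)) = (adj (b (k + Suc n)) o\<^sub>L x (j (k + Suc n))) o\<^sub>L adj (word x b j k n)"
    using W bM by (simp add: adj_compose[OF M_vN] M_closed x_M x_adj op_compose_assoc)
  then show ?case using Suc.IH Suc.prems unfolding word_Suc_left eq by simp
qed

text \<open>The defining sum of a conjugate variable before the trace is taken.\<close>

definition conj_sum :: "nat \<Rightarrow> (nat \<Rightarrow> ('h \<Rightarrow>\<^sub>L 'h)) \<Rightarrow> (nat \<Rightarrow> 'i) \<Rightarrow> ('h \<Rightarrow>\<^sub>L 'h)"
  where "conj_sum d b j =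
    (\<Sum>k=1..d. \<eta>c i (j k) (E (word x b j 0 (k - 1))) o\<^sub>L E (word x b j k (d - k)))"

lemma conj_sum_term:
  assumes "\<And>p. p \<le> d \<Longrightarrow> b p \<in> B" "k \<in> {1..d}"
  shows "word x b j 0 (k - 1) \<in> M" "word x b j k (d - k) \<in> M"
    "E (word x b j 0 (k - 1)) \<in> B" "E (word x b j k (d - k)) \<in> B"
    "\<eta>c i (j k) (E (word x b j 0 (k - 1))) o\<^sub>L E (word x b j k (d - k)) \<in> B"
proof -
  show 1: "word x b j 0 (k - 1) \<in> M" "word x b j k (d - k) \<in> M"
    using assms by (auto intro!: word_M)
  then show 2: "E (word x b j 0 (k - 1)) \<in> B" "E (word x b j k (d - k)) \<in> B" by (auto simp: E_B)
  show "\<eta>c i (j k) (E (word x b j 0 (k - 1))) o\<^sub>L E (word x b j k (d - k)) \<in> B"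
    using 2 by (simp add: B_closed eta_B)
qed

lemma B_sum: "(\<And>k. k \<in> K \<Longrightarrow> f k \<in> B) \<Longrightarrow> sum f K \<in> B"
  by (rule sum_closed) (auto simp: B_closed)

lemma conj_sum_B:
  assumes "\<And>p. p \<le> d \<Longrightarrow> b p \<in> B"
  shows "conj_sum d b j \<in> B"
  unfolding conj_sum_def by (intro B_sum conj_sum_term(5)[where b = b and d = d, OF assms]) auto

text \<open>This is where the \<open>\<tau>\<close>-symmetry of \<open>\<eta>\<close> enters; it says that the functional defining a conjugate
  variable is self-adjoint.\<close>

lemma tau_conj_sum_reverse:
  fixes b :: "nat \<Rightarrow> ('h \<Rightarrow>\<^sub>L 'h)" and j :: "nat \<Rightarrow> 'i" and d :: nat
  assumes b: "\<And>p. p \<le> d \<Longrightarrow> b p \<in> B" and c: "c \<in> B"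
  defines "b' \<equiv> (\<lambda>p. adj (b (d - p)))" and "j' \<equiv> (\<lambda>p. j (Suc d - p))"
  shows "cnj (\<tau> (conj_sum d (b'(0 := c o\<^sub>L b' 0)) j')) = \<tau> (adj c o\<^sub>L conj_sum d b j)"
proof -
  define b'' where "b'' = b'(0 := c o\<^sub>L b' 0)"
  have b'B: "b' p \<in> B" for p using b by (simp add: b'_def B_closed)
  have b''B: "b'' p \<in> B" for p using b'B c by (simp add: b''_def B_closed)
  define T where "T = (\<lambda>k. \<eta>c i (j k) (E (word x b j 0 (k - 1))) o\<^sub>L E (word x b j k (d - k)))"
  define T' where "T' = (\<lambda>k. \<eta>c i (j' k) (E (word x b'' j' 0 (k - 1))) o\<^sub>L E (word x b'' j' k (d - k)))"
  have T: "T k \<in> B" if "k \<in> {1..d}" for k unfolding T_def by (rule conj_sum_term(5)[where b = b and d = d, OF b that])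
  have T': "T' k \<in> B" if "k \<in> {1..d}" for k unfolding T'_def by (rule conj_sum_term(5)[where b = b'' and d = d, OF b''B that])
  \<comment> \<open>Reversal exchanges the two subwords beside the distinguished variable, so term
    \<open>Suc d - k\<close> of the reversed word belongs to term \<open>k\<close>.\<close>
  have "cnj (\<tau> (T' (Suc d - k))) = \<tau> (adj c o\<^sub>L T k)" if k: "k \<in> {1..d}" for k
  proof -
    define W1 where "W1 = word x b j 0 (k - 1)"
    define W2 where "W2 = word x b j k (d - k)"
    have W: "W1 \<in> M" "W2 \<in> M" "E W1 \<in> B" "E W2 \<in> B"
      using conj_sum_term[where b = b and d = d, OF b k] by (auto simp: W1_def W2_def)
    have "adj W2 = word x b' j' 0 (d - k)"
      using adj_word[of d b k "d - k" j] b k by (simp add: b'_def j'_def W2_def)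
    then have w2: "word x b'' j' 0 (d - k) = c o\<^sub>L adj W2"
      by (simp only: b''_def word_update_left)
    \<comment> \<open>The coefficient carrying \<open>c\<close> has index 0, and this subword starts
      at an index of at least 1.\<close>
    have "word x b'' j' (Suc d - k) (k - 1) = word x b' j' (Suc d - k) (k - 1)"
      by (rule word_cong) (use k in \<open>auto simp: b''_def\<close>)
    also have "\<dots> = adj W1"
    proof -
      have "d - (0 + (k - 1)) = Suc d - k" "0 + (k - 1) \<le> d" using k by auto
      then show ?thesis using adj_word[of d b 0 "k - 1" j] b k by (simp add: b'_def j'_def W1_def)
    qed
    finally have w1: "word x b'' j' (Suc d - k) (k - 1) = adj W1" .
    have eq: "Suc d - k - 1 = d - k" "d - (Suc d - k) = k - 1" "j' (Suc d - k) = j k"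
      using k by (auto simp: j'_def)
    have "T' (Suc d - k) = \<eta>c i (j k) (c o\<^sub>L adj (E W2)) o\<^sub>L adj (E W1)"
      unfolding T'_def eq w1 w2 using W c B_M by (simp add: E_left E_adj M_closed)
    moreover have "adj (\<eta>c i (j k) (c o\<^sub>L adj (E W2)) o\<^sub>L adj (E W1))
        = E W1 o\<^sub>L \<eta>c (j k) i (E W2 o\<^sub>L adj c)"
      using W c by (simp add: adj_compose[OF B_vN] adj_adj[OF B_vN] B_closed eta_B eta_adj)
    ultimately have "cnj (\<tau> (T' (Suc d - k))) = \<tau> (E W1 o\<^sub>L \<eta>c (j k) i (E W2 o\<^sub>L adj c))"
      using W c B_M by (simp add: B_closed eta_B M_closed flip: tau_adj)
    also have "\<dots> = \<tau> (\<eta>c i (j k) (E W1) o\<^sub>L (E W2 o\<^sub>L adj c))"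
      using W c by (simp add: eta_tau B_closed)
    also have "\<dots> = \<tau> (adj c o\<^sub>L (\<eta>c i (j k) (E W1) o\<^sub>L E W2))"
      using W c B_M tau_commute[of "\<eta>c i (j k) (E W1) o\<^sub>L E W2" "adj c"]
      by (simp add: B_closed eta_B M_closed op_compose_assoc)
    finally show ?thesis by (simp add: T_def W1_def W2_def)
  qed
  note rev = this
  have "cnj (\<tau> (conj_sum d b'' j')) = (\<Sum>k=1..d. cnj (\<tau> (T' k)))"
    using tau_sum[of "{1..d}" T'] T' B_M by (simp add: conj_sum_def T'_def)
  also have "\<dots> = (\<Sum>k=1..d. cnj (\<tau> (T' (Suc d - k))))"
    by (rule sum.reindex_bij_witness[of _ "\<lambda>k. Suc d - k" "\<lambda>k. Suc d - k"]) auto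
  also have "\<dots> = (\<Sum>k=1..d. \<tau> (adj c o\<^sub>L T k))"
    by (rule sum.cong[OF refl rev])
  also have "\<dots> = \<tau> (adj c o\<^sub>L (\<Sum>k=1..d. T k))"
    using tau_sum[of "{1..d}" "\<lambda>k. adj c o\<^sub>L T k"] T c B_M
    by (simp add: op_compose_sum_right M_closed)
  finally show ?thesis by (simp add: conj_sum_def T_def b''_def)
qed

definition expectation_formula :: "nat \<Rightarrow> bool"
  where "expectation_formula d \<longleftrightarrow> (\<forall>b j. (\<forall>p. b p \<in> B) \<longrightarrow>
    L2E (right_action M \<Lambda> \<xi> (word x b j 0 d)) = \<Lambda> (conj_sum d b j))"

text \<open>Forward, testing against all \<open>c \<in> B\<close> is enough because both vectors lie
  in L2(B). Backward, testing against the unit already recovers the scalar relation.\<close>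

lemma conjugate_variable_iff_expectation_formula:
  "conjugate_variable B \<tau> \<Lambda> E \<eta>c x i \<xi> \<longleftrightarrow> (\<forall>d. expectation_formula d)"
proof
  assume conj: "conjugate_variable B \<tau> \<Lambda> E \<eta>c x i \<xi>"
  have conj': "cinner \<xi> (\<Lambda> (word x b j 0 d)) = \<tau> (conj_sum d b j)" if b: "\<And>p. b p \<in> B" for b j d
  proof -
    have "\<eta>c i (j k) (E (word x b j 0 (k - 1))) o\<^sub>L E (word x b j k (d - k)) \<in> M" if "k \<in> {1..d}" for k
      using conj_sum_term(5)[where b = b and d = d, OF b that] B_M by blast
    then show ?thesis
      using conj b tau_sum[of "{1..d}"] unfolding conjugate_variable_def conj_sum_def by simp
  qed
  show "\<forall>d. expectation_formula d"
    unfolding expectation_formula_def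
  proof (intro allI impI)
    fix d and b :: "nat \<Rightarrow> ('h \<Rightarrow>\<^sub>L 'h)" and j :: "nat \<Rightarrow> 'i"
    assume "\<forall>p. b p \<in> B"
    then have b: "b p \<in> B" for p by blast
    define b' where "b' = (\<lambda>p. adj (b (d - p)))"
    define j' where "j' = (\<lambda>p. j (Suc d - p))"
    have b'B: "b' p \<in> B" for p using b by (simp add: b'_def B_closed)
    have W: "word x b j 0 d \<in> M" by (rule word_M) (rule b)
    show "L2E (right_action M \<Lambda> \<xi> (word x b j 0 d)) = \<Lambda> (conj_sum d b j)"
    proof (rule closure_Lambda_B_eqI[OF L2E_range])
      show "\<Lambda> (conj_sum d b j) \<in> closure (\<Lambda> ` B)"
        using conj_sum_B[where b = b and d = d, OF b] closure_subset[of "\<Lambda> ` B"] by blast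
      fix c assume c: "c \<in> B"
      have "cinner (\<Lambda> c) (L2E (right_action M \<Lambda> \<xi> (word x b j 0 d)))
          = cnj (cinner \<xi> (\<Lambda> (c o\<^sub>L adj (word x b j 0 d))))"
        using c W B_M by (simp add: cinner_L2E cinner_right_action flip: cinner_commute)
      also have "adj (word x b j 0 d) = word x b' j' 0 d"
        using adj_word[of d b 0 d j] b by (simp add: b'_def j'_def)
      also have "c o\<^sub>L word x b' j' 0 d = word x (b'(0 := c o\<^sub>L b' 0)) j' 0 d"
        by (rule word_update_left[symmetric])
      also have "cinner \<xi> (\<Lambda> \<dots>) = \<tau> (conj_sum d (b'(0 := c o\<^sub>L b' 0)) j')"
        using b'B c by (intro conj') (simp add: B_closed)
      also have "cnj \<dots> = \<tau> (adj c o\<^sub>L conj_sum d b j)"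
        unfolding b'_def j'_def by (rule tau_conj_sum_reverse[where b = b and d = d, OF b c])
      also have "\<dots> = cinner (\<Lambda> c) (\<Lambda> (conj_sum d b j))"
        using c conj_sum_B[where b = b and d = d, OF b] B_M by (simp add: cinner_Lambda)
      finally show "cinner (\<Lambda> c) (L2E (right_action M \<Lambda> \<xi> (word x b j 0 d)))
          = cinner (\<Lambda> c) (\<Lambda> (conj_sum d b j))" .
    qed
  qed
next
  assume formula: "\<forall>d. expectation_formula d"
  show "conjugate_variable B \<tau> \<Lambda> E \<eta>c x i \<xi>"
    unfolding conjugate_variable_def
  proof (intro allI impI)
    fix d and b :: "nat \<Rightarrow> ('h \<Rightarrow>\<^sub>L 'h)" and j :: "nat \<Rightarrow> 'i"
    assume "\<forall>k\<le>d. b k \<in> B"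
    then have b: "b p \<in> B" if "p \<le> d" for p using that by blast
    define b' where "b' = (\<lambda>p. adj (b (d - p)))"
    define j' where "j' = (\<lambda>p. j (Suc d - p))"
    have b'B: "b' p \<in> B" for p using b by (simp add: b'_def B_closed)
    define w where "w = word x b j 0 d"
    have w: "w \<in> M" unfolding w_def by (rule word_M) (use b in auto)
    have w': "word x b' j' 0 d = adj w"
      using adj_word[of d b 0 d j] b by (simp add: b'_def j'_def w_def)
    have "cinner (\<Lambda> w) \<xi> = cinner (\<Lambda> id_blinfun) (right_action M \<Lambda> \<xi> (adj w))"
      using w by (simp add: cinner_right_action M_closed adj_adj[OF M_vN])
    also have "\<dots> = cinner (\<Lambda> id_blinfun) (L2E (right_action M \<Lambda> \<xi> (adj w)))"
      by (simp add: cinner_L2E B_closed)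
    also have "L2E (right_action M \<Lambda> \<xi> (adj w)) = \<Lambda> (conj_sum d b' j')"
      using formula b'B w' unfolding expectation_formula_def by metis
    also have "cinner (\<Lambda> id_blinfun) (\<Lambda> (conj_sum d b' j')) = \<tau> (conj_sum d b' j')"
      using conj_sum_B[of d b' j'] b'B B_M by (simp add: cinner_Lambda M_closed adj_id)
    finally have "cinner \<xi> (\<Lambda> w) = cnj (\<tau> (conj_sum d b' j'))"
      by (metis cinner_commute)
    also have "\<dots> = \<tau> (conj_sum d b j)"
    proof -
      have "cnj (\<tau> (conj_sum d (b'(0 := id_blinfun o\<^sub>L b' 0)) j')) = \<tau> (adj id_blinfun o\<^sub>L conj_sum d b j)"
        unfolding b'_def j'_def by (rule tau_conj_sum_reverse[OF b B_closed(1)])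
      then show ?thesis by (simp add: adj_id)
    qed
    also have "\<dots> = (\<Sum>k=1..d. \<tau> (\<eta>c i (j k) (E (word x b j 0 (k - 1))) o\<^sub>L E (word x b j k (d - k))))"
      unfolding conj_sum_def
      by (rule tau_sum[THEN conjunct1]) (use conj_sum_term(5)[where b = b and d = d, OF b] B_M in blast)
    finally show "cinner \<xi> (\<Lambda> (word x b j 0 d)) = \<dots>" by (simp add: w_def)
  qed
qed


section \<open>Moments and cumulants with one vector entry\<close>

abbreviation "L2_kappa \<equiv> cumulant (L2_product M \<Lambda>) (L2_expectation M \<Lambda> E)"

definition entry :: "(nat \<Rightarrow> ('h \<Rightarrow>\<^sub>L 'h)) \<Rightarrow> (nat \<Rightarrow> ('h \<Rightarrow>\<^sub>L 'h)) \<Rightarrow> (nat \<Rightarrow> 'i) \<Rightarrow> nat \<Rightarrow> ('h \<Rightarrow>\<^sub>L 'h)"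
  where "entry b c j k = b k o\<^sub>L x (j k) o\<^sub>L c k"

text \<open>The coefficients \<open>c\<^sub>k\<close> on the right make the class of entries stable under multiplication by values
  of inner blocks, so that no bimodularity of cumulants is needed.\<close>

definition cumulant_formula :: "nat \<Rightarrow> bool"
  where "cumulant_formula d \<longleftrightarrow> (\<forall>b c j. (\<forall>p. b p \<in> B) \<longrightarrow> (\<forall>p. c p \<in> B) \<longrightarrow>
    L2_kappa ((0, right_action M \<Lambda> \<xi> (c 0)) # map (\<lambda>a. (a, 0)) (map (entry b c j) [1..<Suc d])) =
    (0, if d = 1 then \<Lambda> (\<eta>c i (j 1) (c 0 o\<^sub>L b 1) o\<^sub>L c 1) else 0))"

lemma E_zero: "E 0 = 0"
  by (simp add: E_id B_closed)

lemma entry_M: "b k \<in> B \<Longrightarrow> c k \<in> B \<Longrightarrow> entry b c j k \<in> M"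
  by (simp add: entry_def B_M x_M M_closed)

lemma op_product_M: "set as \<subseteq> M \<Longrightarrow> op_product as \<in> M"
  by (induction as) (auto simp: M_closed)

text \<open>Operator entries have no vector component, so values of inner blocks are coefficients
  from \<open>B\<close>, ready to be absorbed.\<close>

lemma L2_kappa_ops:
  assumes "bs \<noteq> []" "set bs \<subseteq> M \<times> {0}"
  shows "L2_kappa bs \<in> B \<times> {0}"
proof (rule cumulant_closed[where R = "M \<times> {0}"])
  show "L2_product M \<Lambda> r s \<in> M \<times> {0}" if "r \<in> M \<times> {0}" "s \<in> M \<times> {0}" for r s
    using that by (auto simp: L2_product_ops M_closed)
  show "L2_expectation M \<Lambda> E r \<in> B \<times> {0}" if "r \<in> M \<times> {0}" for r
    using that by (auto simp: L2_expectation_def E_B blinfun.zero_right)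
qed (use assms B_M in \<open>auto simp: B_closed zero_prod_def\<close>)

text \<open>Additivity of \<open>\<eta>c\<close> and \<open>\<Lambda>\<close> is only given on the
  algebras, so the summands carry a membership condition.\<close>

lemma sum_additive_on_B:
  fixes f :: "('h \<Rightarrow>\<^sub>L 'h) \<Rightarrow> 'b::ab_group_add"
  assumes "\<And>u v. u \<in> B \<Longrightarrow> v \<in> B \<Longrightarrow> f (u + v) = f u + f v" "\<And>k. k \<in> K \<Longrightarrow> g k \<in> B"
  shows "f (sum g K) = (\<Sum>k\<in>K. f (g k))"
proof -
  have "f 0 = 0" using assms(1)[of 0 0] by (simp add: B_closed)
  then show ?thesis using assms(2)
    by (induction K rule: infinite_finite_induct) (auto simp: assms(1) B_sum)
qed

lemma Lambda_sum: "(\<And>k. k \<in> K \<Longrightarrow> g k \<in> B) \<Longrightarrow> \<Lambda> (sum g K) = (\<Sum>k\<in>K. \<Lambda> (g k))"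
  by (rule sum_additive_on_B) (auto simp: Lambda_add B_M)

lemma sum_pair_zero: "(\<Sum>k\<in>K. (0 :: 'a::comm_monoid_add, f k :: 'b::comm_monoid_add)) = (0, sum f K)"
  by (induction K rule: infinite_finite_induct) (auto simp: zero_prod_def)

text \<open>The induction hypothesis leaves the one-block partition and the pairs
  \<open>{1, k}\<close> in \<open>cumulant_expansion\<close>. A pair has a value of order two,
  additive in the values of both gaps, so summing over each gap gives conditional expectations of
  subwords. \<open>b (Suc d)\<close> belongs to no entry; it is the unit that completes the last
  coefficient \<open>\<beta> d\<close>. With \<open>d = 1\<close> the pair is the one-block
  partition and is counted in the cumulant.\<close>

lemma moment_expansion:
  assumes b: "\<And>p. b p \<in> B" and c: "\<And>p. c p \<in> B" and b_last: "b (Suc d) = id_blinfun"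
    and IH: "\<And>d'. d' < d \<Longrightarrow> cumulant_formula d'"
  defines "\<beta> \<equiv> (\<lambda>p. c p o\<^sub>L b (Suc p))"
  shows "(0, L2E (right_action M \<Lambda> \<xi> (word x \<beta> j 0 d))) =
    L2_kappa ((0, right_action M \<Lambda> \<xi> (c 0)) # map (\<lambda>a. (a, 0)) (map (entry b c j) [1..<Suc d]))
    + (0, if d < 2 then 0 else \<Lambda> (conj_sum d \<beta> j))"
proof -
  let ?m = "L2_product M \<Lambda>"
  let ?E = "L2_expectation M \<Lambda> E"
  let ?prod = "\<lambda>l n. op_product (map (entry b c j) [Suc l..<Suc (l + n)])"
  \<comment> \<open>Position 1 holds the vector, so the entry with index \<open>k\<close> sits at
    position \<open>Suc k\<close>.\<close>
  define a where "a = (\<lambda>p. if p = 1 then (0, right_action M \<Lambda> \<xi> (c 0)) else (entry b c j (p - 1), 0 :: 'k))"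
  define X where "X = {(0 :: 'h \<Rightarrow>\<^sub>L 'h, right_action M \<Lambda> \<xi> b) | b. b \<in> B}"
  \<comment> \<open>Entries are kept in the form \<open>b x c\<close>, the shape covered by
    \<open>cumulant_formula\<close>; absorption only changes \<open>c\<close>.\<close>
  define R where "R = {(b o\<^sub>L x j o\<^sub>L c, 0 :: 'k) | b j c. b \<in> B \<and> c \<in> B}"
  define S where "S = B \<times> {0 :: 'k}"
  have RM: "R \<subseteq> M \<times> {0}" by (auto simp: R_def B_M x_M M_closed)
  have aM: "a p \<in> M \<times> {0}" if "p \<noteq> 1" for p using that b c by (auto simp: a_def entry_M)
  have prodM: "?prod l n \<in> M" for l n using entry_M b c by (intro op_product_M) auto
  have \<beta>: "\<beta> p \<in> B" for p using b c by (simp add: \<beta>_def B_closed)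
  have word: "word x \<beta> j l n = (c l o\<^sub>L ?prod l n) o\<^sub>L b (Suc (l + n))" for l n
    unfolding \<beta>_def word_op_product entry_def ..
  have list: "map a [1..<Suc (Suc d)]
      = (0, right_action M \<Lambda> \<xi> (c 0)) # map (\<lambda>a. (a, 0)) (map (entry b c j) [1..<Suc d])"
  proof -
    have "[1..<Suc (Suc d)] = 1 # map Suc [1..<Suc d]" by (simp add: upt_conv_Cons map_Suc_upt del: upt_Suc)
    then show ?thesis by (simp add: a_def del: upt_Suc)
  qed
  have word0: "word x \<beta> j 0 d = c 0 o\<^sub>L ?prod 0 d" using word[of 0 d] b_last by simp
  have moment: "?E (list_product ?m (map a [1..<Suc (Suc d)]))
      = (0, L2E (right_action M \<Lambda> \<xi> (word x \<beta> j 0 d)))"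
    unfolding list list_product_vector word0
    using c[of 0] prodM[of 0 d] B_M
    by (simp add: L2_expectation_def E_zero right_action_compose del: upt_Suc)
  \<comment> \<open>The empty partition counts as the unit: an empty gap leaves its neighbour
    unchanged.\<close>
  define val where "val = (\<lambda>\<rho>. if \<rho> = {} then id_blinfun else fst (cumulant_part ?m L2_kappa \<rho> a))"
  have val: "val \<rho> \<in> B" "\<rho> \<noteq> {} \<Longrightarrow> cumulant_part ?m L2_kappa \<rho> a = (val \<rho>, 0)"
    if \<rho>: "\<rho> \<in> NC_on {l<..<r}" and l: "1 \<le> l" for \<rho> l r
  proof -
    have nc: "nc_blocks \<rho>" using NC_on_nc_blocks[OF _ \<rho>] by simp
    have "cumulant_part ?m L2_kappa \<rho> a \<in> S" if "\<rho> \<noteq> {}"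
    proof (rule cumulant_part_closed[OF nc that, where R = "M \<times> {0}"])
      show "a p \<in> M \<times> {0}" if "p \<in> \<Union>\<rho>" for p
        using that l NC_on_Union[OF \<rho>] by (intro aM) auto
      show "L2_kappa bs \<in> S" if V: "V \<in> \<rho>" "length bs = card V" "set bs \<subseteq> M \<times> {0}" for V bs
      proof -
        have "0 < card V" using nc_blocks_block[OF nc V(1)] card_gt_0_iff by blast
        then have "bs \<noteq> []" using V(2) by auto
        then show ?thesis unfolding S_def using V(3) by (rule L2_kappa_ops)
      qed
      show "?m r s \<in> M \<times> {0}" if "r \<in> M \<times> {0}" "s \<in> S" for r s
        using that by (auto simp: S_def L2_product_ops M_closed B_M)
    qed
    then show "val \<rho> \<in> B" "\<rho> \<noteq> {} \<Longrightarrow> cumulant_part ?m L2_kappa \<rho> a = (val \<rho>, 0)"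
      by (cases "\<rho> = {}"; auto simp: val_def S_def B_closed mem_Times_iff prod_eq_iff)+
  qed
  \<comment> \<open>Position \<open>p\<close> carries the entry with index \<open>p - 1\<close>, so
    positions \<open>Suc l\<close> to \<open>l + n\<close> give the indices \<open>l\<close> to
    \<open>l + n - 1\<close>.\<close>
  have val_sum: "(\<Sum>\<rho>\<in>NC_on {l<..<Suc (l + n)}. val \<rho>) = E (op_product (map (entry b c j) [l..<l + n]))"
    if l: "1 \<le> l" for l n
  proof (cases "n = 0")
    case True
    have "{l<..<Suc l} = {}" by auto
    then show ?thesis using True by (simp add: NC_on_empty val_def E_id B_closed)
  next
    case False
    have int: "{l<..<Suc (l + n)} = {l<..l + n}" by auto
    have "\<rho> \<noteq> {}" if "\<rho> \<in> NC_on {l<..<Suc (l + n)}" for \<rho>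
    proof
      assume "\<rho> = {}"
      then have "{l<..<Suc (l + n)} = {}" using NC_on_Union[OF that] by simp
      moreover have "Suc l \<in> {l<..<Suc (l + n)}" using False by simp
      ultimately show False by blast
    qed
    then have "(\<Sum>\<rho>\<in>NC_on {l<..<Suc (l + n)}. val \<rho>)
        = fst (\<Sum>\<rho>\<in>NC_on {l<..<Suc (l + n)}. cumulant_part ?m L2_kappa \<rho> a)"
      unfolding fst_sum by (intro sum.cong) (auto simp: val_def)
    also have "\<dots> = fst (?E (list_product ?m (map (\<lambda>p. a (l + p)) [1..<Suc n])))"
      unfolding int using False by (subst sum_cumulant_part_interval) auto
    also have "map (\<lambda>p. a (l + p)) [1..<Suc n] = map (\<lambda>a. (a, 0)) (map (entry b c j) [l..<l + n])"
      by (rule nth_equalityI) (use l in \<open>auto simp: a_def simp del: upt_Suc\<close>)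
    also have "list_product ?m \<dots> = (op_product (map (entry b c j) [l..<l + n]), 0)"
      using False by (intro list_product_ops) simp
    finally show ?thesis by (simp add: L2_expectation_def)
  qed
  have kappa2: "L2_kappa [if \<rho> = {} then a 1 else ?m (a 1) (cumulant_part ?m L2_kappa \<rho> a),
         if \<sigma> = {} then a k else ?m (a k) (cumulant_part ?m L2_kappa \<sigma> a)] =
       (0, \<Lambda> (\<eta>c i (j (k - 1)) (c 0 o\<^sub>L val \<rho> o\<^sub>L b (k - 1)) o\<^sub>L (c (k - 1) o\<^sub>L val \<sigma>)))"
    if k: "k \<in> {2..Suc d}" and d: "2 \<le> d" and \<rho>: "\<rho> \<in> NC_on {1<..<k}" and \<sigma>: "\<sigma> \<in> NC_on {k<..<Suc (Suc d)}" for k \<rho> \<sigma>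
  proof -
    have 1: "(if \<rho> = {} then a 1 else ?m (a 1) (cumulant_part ?m L2_kappa \<rho> a))
        = (0, right_action M \<Lambda> \<xi> (c 0 o\<^sub>L val \<rho>))"
    proof (cases "\<rho> = {}")
      case True
      then show ?thesis by (simp add: a_def val_def)
    next
      case False
      have "cumulant_part ?m L2_kappa \<rho> a = (val \<rho>, 0)" by (rule val(2)[OF \<rho> _ False]) simp
      moreover have "c 0 \<in> M" "val \<rho> \<in> M" using c B_M val(1)[OF \<rho>] by auto
      moreover have "a 1 = (0, right_action M \<Lambda> \<xi> (c 0))" by (simp add: a_def)
      ultimately show ?thesis
        using False by (simp only: if_False L2_product_vector right_action_compose)
    qed
    have 2: "(if \<sigma> = {} then a k else ?m (a k) (cumulant_part ?m L2_kappa \<sigma> a))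
        = (b (k - 1) o\<^sub>L x (j (k - 1)) o\<^sub>L (c (k - 1) o\<^sub>L val \<sigma>), 0)"
    proof (cases "\<sigma> = {}")
      case True
      then show ?thesis using k by (simp add: a_def val_def entry_def)
    next
      case False
      have "cumulant_part ?m L2_kappa \<sigma> a = (val \<sigma>, 0)" by (rule val(2)[OF \<sigma> _ False]) (use k in simp)
      moreover have "a k = (entry b c j (k - 1), 0)" using k by (simp add: a_def)
      ultimately show ?thesis
        using False by (simp only: if_False L2_product_ops entry_def op_compose_assoc)
    qed
    \<comment> \<open>The gap values have become parts of the right coefficients of the vector and
      of entry \<open>k - 1\<close>.\<close>
    define c' where "c' = (\<lambda>p :: nat. if p = 0 then c 0 o\<^sub>L val \<rho> else c (k - 1) o\<^sub>L val \<sigma>)"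
    have c'B: "\<And>p. c' p \<in> B" using val(1)[OF \<rho>] val(1)[OF \<sigma>] k c by (auto simp: c'_def B_closed)
    \<comment> \<open>Order two is among the hypotheses because \<open>d\<close> is at least
      2.\<close>
    have cf: "cumulant_formula 1" using IH[of 1] d by simp
    have "L2_kappa ((0, right_action M \<Lambda> \<xi> (c' 0)) #
        map (\<lambda>a. (a, 0)) (map (entry (\<lambda>_. b (k - 1)) c' (\<lambda>_. j (k - 1))) [1..<Suc 1]))
        = (0, \<Lambda> (\<eta>c i (j (k - 1)) (c' 0 o\<^sub>L b (k - 1)) o\<^sub>L c' 1))"
      using cf[unfolded cumulant_formula_def, rule_format, of "\<lambda>_. b (k - 1)" c' "\<lambda>_. j (k - 1)"]
        b[of "k - 1"] c'B by (simp only: simp_thms if_True)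
    then show ?thesis unfolding 1 2 by (simp add: c'_def entry_def)
  qed
  have expansion: "?E (list_product ?m (map a [1..<Suc (Suc d)])) = L2_kappa (map a [1..<Suc (Suc d)]) +
    (if Suc d < 3 then 0 else \<Sum>k=2..Suc d. \<Sum>\<rho>\<in>NC_on {1<..<k}. \<Sum>\<sigma>\<in>NC_on {k<..Suc d}.
      L2_kappa [if \<rho> = {} then a 1 else ?m (a 1) (cumulant_part ?m L2_kappa \<rho> a),
         if \<sigma> = {} then a k else ?m (a k) (cumulant_part ?m L2_kappa \<sigma> a)])"
  proof (rule cumulant_expansion[where X = X and R = R and S = S])
    show "a 1 \<in> X" using c by (auto simp: a_def X_def)
    show "a p \<in> R" if "p \<in> {2..Suc d}" for p
    proof -
      have "a p = (b (p - 1) o\<^sub>L x (j (p - 1)) o\<^sub>L c (p - 1), 0)"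
        using that by (simp add: a_def entry_def)
      then show ?thesis unfolding R_def using b[of "p - 1"] c[of "p - 1"] by blast
    qed
    show "L2_kappa bs \<in> S" if "bs \<noteq> []" "set bs \<subseteq> R" for bs
      unfolding S_def using that RM by (intro L2_kappa_ops) auto
    show "?m r s \<in> R" if rs0: "r \<in> R" "s \<in> S" for r s
    proof -
      obtain b j c u where rs: "r = (b o\<^sub>L x j o\<^sub>L c, 0)" "s = (u, 0)" "b \<in> B" "c \<in> B" "u \<in> B"
        using rs0 by (auto simp: R_def S_def)
      then have "?m r s = (b o\<^sub>L x j o\<^sub>L (c o\<^sub>L u), 0)" by (simp add: L2_product_ops op_compose_assoc)
      then show ?thesis unfolding R_def using rs B_closed(4)[of c u] by blast
    qed
    show "?m r s \<in> X" if rs0: "r \<in> X" "s \<in> S" for r s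
    proof -
      obtain c u where rs: "r = (0, right_action M \<Lambda> \<xi> c)" "s = (u, 0)" "c \<in> B" "u \<in> B"
        using rs0 by (auto simp: X_def S_def)
      then have "?m r s = (0, right_action M \<Lambda> \<xi> (c o\<^sub>L u))"
        by (simp add: L2_product_vector right_action_compose B_M)
      then show ?thesis unfolding X_def using rs B_closed(4)[of c u] by blast
    qed
    show "L2_kappa (\<zeta> # bs) = 0"
      if \<zeta>: "\<zeta> \<in> X" and bs: "set bs \<subseteq> R" "Suc (length bs) < Suc d" "length bs \<noteq> 1" for \<zeta> bs
    proof -
      obtain u where u: "\<zeta> = (0, right_action M \<Lambda> \<xi> u)" "u \<in> B" using \<zeta> by (auto simp: X_def)
      \<comment> \<open>\<open>cumulant_formula\<close> speaks of families of coefficients, so a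
        decomposition \<open>b x c\<close> is chosen for each entry and the coefficient families are
        padded with the unit.\<close>
      define rep where "rep = (\<lambda>r t. r = (fst t o\<^sub>L x (fst (snd t)) o\<^sub>L snd (snd t), 0 :: 'k)
        \<and> fst t \<in> B \<and> snd (snd t) \<in> B)"
      define t where "t = (\<lambda>r. SOME t. rep r t)"
      have t: "rep r (t r)" if "r \<in> R" for r
      proof -
        have "\<exists>b j c. r = (b o\<^sub>L x j o\<^sub>L c, 0) \<and> b \<in> B \<and> c \<in> B" using that by (simp add: R_def)
        then obtain b j c where "rep r (b, j, c)" by (auto simp: rep_def)
        then show ?thesis unfolding t_def by (rule someI)
      qed
      define n where "n = length bs"
      define tb where "tb = (\<lambda>k. if k \<in> {1..n} then fst (t (bs ! (k - 1))) else id_blinfun)"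
      define tj where "tj = (\<lambda>k. fst (snd (t (bs ! (k - 1)))))"
      define tc where "tc = (\<lambda>k. if k = 0 then u else if k \<in> {1..n} then snd (snd (t (bs ! (k - 1)))) else id_blinfun)"
      have bsR: "bs ! (k - 1) \<in> R" if "k \<in> {1..n}" for k
        using that bs(1) by (auto simp: n_def intro!: subsetD[OF _ nth_mem])
      have "tb k \<in> B" "tc k \<in> B" for k
        using t[OF bsR, of k] u(2) by (auto simp: tb_def tc_def rep_def B_closed)
      moreover have "cumulant_formula n" using IH bs by (simp add: n_def)
      ultimately have "L2_kappa ((0, right_action M \<Lambda> \<xi> (tc 0)) #
          map (\<lambda>a. (a, 0)) (map (entry tb tc tj) [1..<Suc n])) = (0, 0)"
        using bs(3) unfolding cumulant_formula_def by (simp add: n_def del: upt_Suc)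
      moreover have "map (\<lambda>a. (a, 0)) (map (entry tb tc tj) [1..<Suc n]) = bs"
      proof (rule nth_equalityI)
        fix q assume "q < length (map (\<lambda>a. (a, 0 :: 'k)) (map (entry tb tc tj) [1..<Suc n]))"
        then have q: "Suc q \<in> {1..n}" by (simp del: upt_Suc)
        show "map (\<lambda>a. (a, 0)) (map (entry tb tc tj) [1..<Suc n]) ! q = bs ! q"
          using t[OF bsR[OF q]] q by (simp add: rep_def entry_def tb_def tc_def tj_def del: upt_Suc)
      qed (simp add: n_def del: upt_Suc)
      ultimately show ?thesis by (simp add: u tc_def zero_prod_def)
    qed
  qed simp
  have pair_sum: "(\<Sum>\<rho>\<in>NC_on {1<..<k}. \<Sum>\<sigma>\<in>NC_on {k<..Suc d}.
      L2_kappa [if \<rho> = {} then a 1 else ?m (a 1) (cumulant_part ?m L2_kappa \<rho> a),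
         if \<sigma> = {} then a k else ?m (a k) (cumulant_part ?m L2_kappa \<sigma> a)])
    = (0, \<Lambda> (\<eta>c i (j (k - 1)) (E (word x \<beta> j 0 (k - 1 - 1))) o\<^sub>L E (word x \<beta> j (k - 1) (d - (k - 1)))))"
    if k: "k \<in> {2..Suc d}" and d: "2 \<le> d" for k
  proof -
    \<comment> \<open>The value of the pair is biadditive in the two gap values, which lets each gap
      be summed separately.\<close>
    define F where "F = (\<lambda>u v. \<Lambda> (\<eta>c i (j (k - 1)) (c 0 o\<^sub>L u o\<^sub>L b (k - 1)) o\<^sub>L (c (k - 1) o\<^sub>L v)))"
    have F1: "F (u + u') v = F u v + F u' v" if "u \<in> B" "u' \<in> B" "v \<in> B" for u u' v
      using that b c by (simp add: F_def op_compose_add_left op_compose_add_right eta_add Lambda_add B_M B_closed eta_B)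
    have F2: "F u (v + v') = F u v + F u v'" if "u \<in> B" "v \<in> B" "v' \<in> B" for u v v'
      using that b c by (simp add: F_def op_compose_add_right Lambda_add B_M B_closed eta_B)
    have int: "{k<..Suc d} = {k<..<Suc (Suc d)}" "{1<..<k} = {1<..<Suc (1 + (k - 2))}"
      "{k<..<Suc (Suc d)} = {k<..<Suc (k + (Suc d - k))}" using k by auto
    have \<rho>B: "val \<rho> \<in> B" if "\<rho> \<in> NC_on {1<..<k}" for \<rho> using val(1)[OF that] by simp
    have \<sigma>B: "val \<sigma> \<in> B" if "\<sigma> \<in> NC_on {k<..<Suc (Suc d)}" for \<sigma> using val(1)[OF that] k by simp
    have "(\<Sum>\<rho>\<in>NC_on {1<..<k}. \<Sum>\<sigma>\<in>NC_on {k<..Suc d}.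
      L2_kappa [if \<rho> = {} then a 1 else ?m (a 1) (cumulant_part ?m L2_kappa \<rho> a),
         if \<sigma> = {} then a k else ?m (a k) (cumulant_part ?m L2_kappa \<sigma> a)])
      = (\<Sum>\<rho>\<in>NC_on {1<..<k}. \<Sum>\<sigma>\<in>NC_on {k<..<Suc (Suc d)}. (0, F (val \<rho>) (val \<sigma>)))"
      unfolding int(1) F_def by (intro sum.cong refl kappa2[OF k d])
    also have "\<dots> = (0, \<Sum>\<rho>\<in>NC_on {1<..<k}. \<Sum>\<sigma>\<in>NC_on {k<..<Suc (Suc d)}. F (val \<rho>) (val \<sigma>))"
      by (simp only: sum_pair_zero)
    also have "(\<Sum>\<rho>\<in>NC_on {1<..<k}. \<Sum>\<sigma>\<in>NC_on {k<..<Suc (Suc d)}. F (val \<rho>) (val \<sigma>))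
        = (\<Sum>\<rho>\<in>NC_on {1<..<k}. F (val \<rho>) (\<Sum>\<sigma>\<in>NC_on {k<..<Suc (Suc d)}. val \<sigma>))"
      by (intro sum.cong refl sum_additive_on_B[symmetric] F2 \<rho>B \<sigma>B)
    also have "\<dots> = F (\<Sum>\<rho>\<in>NC_on {1<..<k}. val \<rho>) (\<Sum>\<sigma>\<in>NC_on {k<..<Suc (Suc d)}. val \<sigma>)"
      by (rule sum_additive_on_B[symmetric, where f = "\<lambda>u. F u (\<Sum>\<sigma>\<in>NC_on {k<..<Suc (Suc d)}. val \<sigma>)"])
        (rule F1 \<rho>B B_sum[OF \<sigma>B] | assumption)+
    \<comment> \<open>The gap before position \<open>k\<close> holds the entries with indices 1 to
      \<open>k - 2\<close>, the gap behind it those with indices \<open>k\<close> to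
      \<open>d\<close>.\<close>
    also have "(\<Sum>\<rho>\<in>NC_on {1<..<k}. val \<rho>) = E (?prod 0 (k - 2))"
      unfolding int(2) by (subst val_sum) (auto simp del: upt_Suc)
    also have "(\<Sum>\<sigma>\<in>NC_on {k<..<Suc (Suc d)}. val \<sigma>) = E (?prod (k - 1) (Suc d - k))"
      unfolding int(3) using k by (subst val_sum) (auto simp: Suc_diff_le simp del: upt_Suc)
    also have "F (E (?prod 0 (k - 2))) (E (?prod (k - 1) (Suc d - k)))
       = \<Lambda> (\<eta>c i (j (k - 1)) (E (word x \<beta> j 0 (k - 1 - 1))) o\<^sub>L E (word x \<beta> j (k - 1) (d - (k - 1))))"
    proof -
      have "word x \<beta> j 0 (k - 1 - 1) = (c 0 o\<^sub>L ?prod 0 (k - 2)) o\<^sub>L b (k - 1)"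
      proof -
        have "k - 1 - 1 = k - 2" "Suc (0 + (k - 2)) = k - 1" using k by auto
        then show ?thesis using word[of 0 "k - 2"] by (simp only:)
      qed
      then have "E (word x \<beta> j 0 (k - 1 - 1)) = (c 0 o\<^sub>L E (?prod 0 (k - 2))) o\<^sub>L b (k - 1)"
        using E_bimodule[OF prodM] b c by (simp only:)
      moreover have "word x \<beta> j (k - 1) (d - (k - 1)) = c (k - 1) o\<^sub>L ?prod (k - 1) (Suc d - k)"
      proof -
        have "d - (k - 1) = Suc d - k" "Suc (k - 1 + (Suc d - k)) = Suc d" using k by auto
        then show ?thesis using word[of "k - 1" "Suc d - k"] b_last by (simp only: op_compose_id)
      qed
      then have "E (word x \<beta> j (k - 1) (d - (k - 1))) = c (k - 1) o\<^sub>L E (?prod (k - 1) (Suc d - k))"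
        using E_left[OF prodM c] by (simp only:)
      ultimately show ?thesis by (simp only: F_def)
    qed
    finally show ?thesis .
  qed
  have "(\<Sum>k=2..Suc d. \<Sum>\<rho>\<in>NC_on {1<..<k}. \<Sum>\<sigma>\<in>NC_on {k<..Suc d}.
      L2_kappa [if \<rho> = {} then a 1 else ?m (a 1) (cumulant_part ?m L2_kappa \<rho> a),
         if \<sigma> = {} then a k else ?m (a k) (cumulant_part ?m L2_kappa \<sigma> a)]) = (0, \<Lambda> (conj_sum d \<beta> j))"
    (is "?lhs = _") if d: "2 \<le> d"
  proof -
    define T where "T = (\<lambda>k. \<eta>c i (j k) (E (word x \<beta> j 0 (k - 1))) o\<^sub>L E (word x \<beta> j k (d - k)))"
    have "?lhs = (\<Sum>k=2..Suc d. (0, \<Lambda> (T (k - 1))))"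
      unfolding T_def by (intro sum.cong refl pair_sum d)
    also have "\<dots> = (0, \<Sum>k=2..Suc d. \<Lambda> (T (k - 1)))" by (rule sum_pair_zero)
    also have "(\<Sum>k=2..Suc d. \<Lambda> (T (k - 1))) = (\<Sum>k=1..d. \<Lambda> (T k))"
      by (rule sum.reindex_bij_witness[of _ Suc "\<lambda>k. k - 1"]) auto
    also have "\<dots> = \<Lambda> (\<Sum>k=1..d. T k)"
      by (rule Lambda_sum[symmetric]) (simp only: T_def conj_sum_term(5)[where b = \<beta> and d = d, OF \<beta>])
    finally show ?thesis by (simp only: conj_sum_def T_def)
  qed
  note total = this
  show ?thesis
  proof (cases "d < 2")
    case True
    then have "Suc d < 3" by simp
    with expansion[unfolded moment, unfolded list] True show ?thesis by (simp only: if_True zero_prod_def)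
  next
    case False
    then have "\<not> Suc d < 3" "2 \<le> d" by simp_all
    with expansion[unfolded moment, unfolded list] False show ?thesis by (simp only: if_False total)
  qed
qed

lemma conj_sum_1: "b 0 \<in> B \<Longrightarrow> b 1 \<in> B \<Longrightarrow> conj_sum 1 b j = \<eta>c i (j 1) (b 0) o\<^sub>L b 1"
  by (simp add: conj_sum_def E_id)

text \<open>\<open>moment_expansion\<close> links the two sides at order \<open>d\<close>. For
  \<open>d \<ge> 2\<close> it already contributes \<open>conj_sum\<close>, so the moment is right
  exactly if the cumulant vanishes; for \<open>d < 2\<close> the cumulant is the whole
  moment.\<close>

lemma cumulant_formula_iff_expectation_formula:
  assumes IH: "\<And>d'. d' < d \<Longrightarrow> cumulant_formula d'"
  shows "cumulant_formula d \<longleftrightarrow> expectation_formula d"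
proof
  assume cf: "cumulant_formula d"
  show "expectation_formula d"
    unfolding expectation_formula_def
  proof (intro allI impI)
    fix b :: "nat \<Rightarrow> ('h \<Rightarrow>\<^sub>L 'h)" and j :: "nat \<Rightarrow> 'i" assume b: "\<forall>p. b p \<in> B"
    \<comment> \<open>All coefficients of the word are placed on the right of the entries, with
      units on the left.\<close>
    have eq: "(0, L2E (right_action M \<Lambda> \<xi> (word x b j 0 d))) =
      L2_kappa ((0, right_action M \<Lambda> \<xi> (b 0)) # map (\<lambda>a. (a, 0)) (map (entry (\<lambda>_. id_blinfun) b j) [1..<Suc d]))
      + (0, if d < 2 then 0 else \<Lambda> (conj_sum d b j))"
      using moment_expansion[of "\<lambda>_. id_blinfun" b d j] IH b by (simp add: B_closed del: upt_Suc)
    have k: "L2_kappa ((0, right_action M \<Lambda> \<xi> (b 0)) # map (\<lambda>a. (a, 0)) (map (entry (\<lambda>_. id_blinfun) b j) [1..<Suc d]))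
      = (0, if d = 1 then \<Lambda> (\<eta>c i (j 1) (b 0 o\<^sub>L id_blinfun) o\<^sub>L b 1) else 0)"
      using cf[unfolded cumulant_formula_def, rule_format, of "\<lambda>_. id_blinfun" b j] b B_closed(1) by blast
    have "conj_sum 0 b j = 0" by (simp add: conj_sum_def)
    moreover have "d = 0 \<or> d = 1 \<or> 2 \<le> d" by auto
    ultimately show "L2E (right_action M \<Lambda> \<xi> (word x b j 0 d)) = \<Lambda> (conj_sum d b j)"
      using eq[unfolded k] conj_sum_1[of b j] b by (auto simp: Lambda_zero simp del: upt_Suc)
  qed
next
  assume ef: "expectation_formula d"
  show "cumulant_formula d"
    unfolding cumulant_formula_def
  proof (intro allI impI)
    fix b c :: "nat \<Rightarrow> ('h \<Rightarrow>\<^sub>L 'h)" and j :: "nat \<Rightarrow> 'i" assume bc: "\<forall>p. b p \<in> B" "\<forall>p. c p \<in> B"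
    \<comment> \<open>Index \<open>Suc d\<close> occurs in no entry, so its coefficient may be
      replaced by the unit.\<close>
    define b' where "b' = b(Suc d := id_blinfun)"
    define \<beta> where "\<beta> = (\<lambda>p. c p o\<^sub>L b' (Suc p))"
    have b': "b' p \<in> B" for p using bc by (simp add: b'_def B_closed)
    have \<beta>: "\<beta> p \<in> B" for p using b' bc by (simp add: \<beta>_def B_closed)
    have mom: "(0, L2E (right_action M \<Lambda> \<xi> (word x \<beta> j 0 d))) =
      L2_kappa ((0, right_action M \<Lambda> \<xi> (c 0)) # map (\<lambda>a. (a, 0)) (map (entry b' c j) [1..<Suc d]))
      + (0, if d < 2 then 0 else \<Lambda> (conj_sum d \<beta> j))"
      unfolding \<beta>_def by (rule moment_expansion) (use b' bc IH in \<open>auto simp: b'_def\<close>)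
    have val: "L2E (right_action M \<Lambda> \<xi> (word x \<beta> j 0 d)) = \<Lambda> (conj_sum d \<beta> j)"
      using ef \<beta> unfolding expectation_formula_def by blast
    have entries: "map (entry b' c j) [1..<Suc d] = map (entry b c j) [1..<Suc d]"
      by (rule map_cong) (auto simp: entry_def b'_def simp del: upt_Suc)
    have eq: "L2_kappa ((0, right_action M \<Lambda> \<xi> (c 0)) # map (\<lambda>a. (a, 0)) (map (entry b c j) [1..<Suc d]))
      = (0, \<Lambda> (conj_sum d \<beta> j)) - (0, if d < 2 then 0 else \<Lambda> (conj_sum d \<beta> j))"
      unfolding eq_diff_eq by (rule mom[unfolded val entries, symmetric])
    have "conj_sum 0 \<beta> j = 0" by (simp add: conj_sum_def)
    moreover have "conj_sum 1 \<beta> j = \<eta>c i (j 1) (c 0 o\<^sub>L b 1) o\<^sub>L c 1" if "d = 1"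
    proof -
      have "\<beta> 0 = c 0 o\<^sub>L b 1" "\<beta> 1 = c 1" using that by (auto simp: \<beta>_def b'_def)
      then show ?thesis using conj_sum_1[where j = j, OF \<beta> \<beta>] by (simp only:)
    qed
    moreover have "d = 0 \<or> d = 1 \<or> 2 \<le> d" by auto
    ultimately show "L2_kappa ((0, right_action M \<Lambda> \<xi> (c 0)) # map (\<lambda>a. (a, 0)) (map (entry b c j) [1..<Suc d])) =
      (0, if d = 1 then \<Lambda> (\<eta>c i (j 1) (c 0 o\<^sub>L b 1) o\<^sub>L c 1) else 0)"
      unfolding eq by (auto simp: Lambda_zero)
  qed
qed

lemma cumulant_formula_all_iff: "(\<forall>d. cumulant_formula d) \<longleftrightarrow> (\<forall>d. expectation_formula d)"
proof
  assume "\<forall>d. cumulant_formula d"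
  then show "\<forall>d. expectation_formula d" using cumulant_formula_iff_expectation_formula by blast
next
  assume "\<forall>d. expectation_formula d"
  then have "cumulant_formula d" for d
    by (induction d rule: less_induct) (use cumulant_formula_iff_expectation_formula in blast)
  then show "\<forall>d. cumulant_formula d" by blast
qed

section \<open>The cumulant conditions of the theorem\<close>

definition cumulant_conditions :: bool
  where "cumulant_conditions \<longleftrightarrow>
    (\<forall>b\<in>B. L2_cumulant M \<Lambda> E [] (right_action M \<Lambda> \<xi> b) [] = 0) \<and>
    (\<forall>b\<in>B. \<forall>j. L2_cumulant M \<Lambda> E [] \<xi> [b o\<^sub>L x j] = \<Lambda> (\<eta>c i j b)) \<and>
    (\<forall>d\<ge>2. \<forall>b j. (\<forall>k\<in>{1..d}. b k \<in> B) \<longrightarrow>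
      L2_cumulant M \<Lambda> E [] \<xi> (map (\<lambda>k. b k o\<^sub>L x (j k)) [1..<Suc d]) = 0)"

lemma cumulant_conditions_if:
  assumes cf: "\<forall>d. cumulant_formula d"
  shows "cumulant_conditions"
  unfolding cumulant_conditions_def
proof (intro conjI ballI allI impI)
  fix b assume b: "b \<in> B"
  have "L2_kappa ((0, right_action M \<Lambda> \<xi> b) #
      map (\<lambda>a. (a, 0)) (map (entry (\<lambda>_. b) (\<lambda>_. b) (\<lambda>_. i)) [1..<Suc 0])) = (0, 0)"
    using cf[rule_format, of 0, unfolded cumulant_formula_def, rule_format,
        of "\<lambda>_. b" "\<lambda>_. b" "\<lambda>_. i"] b by simp
  then show "L2_cumulant M \<Lambda> E [] (right_action M \<Lambda> \<xi> b) [] = 0"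
    by (simp add: L2_cumulant_def)
next
  fix b j assume b: "b \<in> B"
  have "L2_kappa ((0, right_action M \<Lambda> \<xi> id_blinfun) #
      map (\<lambda>a. (a, 0)) (map (entry (\<lambda>_. b) (\<lambda>_. id_blinfun) (\<lambda>_. j)) [1..<Suc 1]))
      = (0, \<Lambda> (\<eta>c i j (id_blinfun o\<^sub>L b) o\<^sub>L id_blinfun))"
    using cf[rule_format, of 1, unfolded cumulant_formula_def, rule_format,
        of "\<lambda>_. b" "\<lambda>_. id_blinfun" "\<lambda>_. j"] b B_closed(1) by simp
  then show "L2_cumulant M \<Lambda> E [] \<xi> [b o\<^sub>L x j] = \<Lambda> (\<eta>c i j b)"
    by (simp add: L2_cumulant_def right_action_id entry_def)
next
  fix d :: nat and b and j :: "nat \<Rightarrow> 'i"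
  assume d: "2 \<le> d" and b: "\<forall>k\<in>{1..d}. b k \<in> B"
  define b' where "b' = (\<lambda>k. if k \<in> {1..d} then b k else id_blinfun)"
  have "\<forall>p. b' p \<in> B" using b by (simp add: b'_def B_closed)
  then have "L2_kappa ((0, right_action M \<Lambda> \<xi> id_blinfun) #
      map (\<lambda>a. (a, 0)) (map (entry b' (\<lambda>_. id_blinfun) j) [1..<Suc d])) = (0, 0)"
    using cf[rule_format, of d, unfolded cumulant_formula_def, rule_format,
        of b' "\<lambda>_. id_blinfun" j] d B_closed(1) by (simp del: upt_Suc)
  moreover have entries: "map (entry b' (\<lambda>_. id_blinfun) j) [1..<Suc d] = map (\<lambda>k. b k o\<^sub>L x (j k)) [1..<Suc d]"
    by (rule map_cong) (auto simp: entry_def b'_def simp del: upt_Suc)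
  ultimately show "L2_cumulant M \<Lambda> E [] \<xi> (map (\<lambda>k. b k o\<^sub>L x (j k)) [1..<Suc d]) = 0"
    unfolding L2_cumulant_def right_action_id by (simp only: entries list.map append_Nil snd_conv)
qed

text \<open>\<open>b d\<close> ends the right-hand subword in every term and leaves \<open>E\<close>
  by right \<open>B\<close>-linearity.\<close>

lemma conj_sum_update_last:
  assumes b: "\<And>p. b p \<in> B"
  shows "conj_sum d (b(d := id_blinfun)) j o\<^sub>L b d = conj_sum d b j"
proof -
  define b' where "b' = b(d := id_blinfun)"
  have b': "b' p \<in> B" for p using b by (simp add: b'_def B_closed)
  have eq: "word x b' j k (d - k) o\<^sub>L b d = word x b j k (d - k)" "word x b' j 0 (k - 1) = word x b j 0 (k - 1)"
    if k: "k \<in> {1..d}" for k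
  proof -
    have "k + (d - k) = d" using k by simp
    then have "word x b' j k (d - k) o\<^sub>L b d = word x (b'(d := b' d o\<^sub>L b d)) j k (d - k)"
      using word_update_right[of x b' k "d - k" "b d" j] by simp
    then show "word x b' j k (d - k) o\<^sub>L b d = word x b j k (d - k)" by (simp add: b'_def)
    show "word x b' j 0 (k - 1) = word x b j 0 (k - 1)"
      by (rule word_cong) (use k in \<open>auto simp: b'_def\<close>)
  qed
  show ?thesis
    unfolding conj_sum_def op_compose_sum_left b'_def[symmetric]
  proof (rule sum.cong[OF refl])
    fix k assume k: "k \<in> {1..d}"
    have "E (word x b' j k (d - k)) o\<^sub>L b d = E (word x b j k (d - k))"
      unfolding eq(1)[OF k, symmetric]
      by (rule E_right[symmetric]) (use b' b in \<open>auto intro: word_M\<close>)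
    then show "(\<eta>c i (j k) (E (word x b' j 0 (k - 1))) o\<^sub>L E (word x b' j k (d - k))) o\<^sub>L b d =
        \<eta>c i (j k) (E (word x b j 0 (k - 1))) o\<^sub>L E (word x b j k (d - k))"
      by (simp only: eq(2)[OF k] op_compose_assoc)
  qed
qed

text \<open>The conditions know only left coefficients. A word whose last coefficient is the unit is
  a product of entries \<open>b x\<close>, so they determine its moment with \<open>\<xi>\<close>.
  Right multiplication restores the last coefficient, and the moments of order \<open>d\<close> give
  back the cumulants of all two-sided entries.\<close>

lemma cumulant_formula_if:
  assumes cond: "cumulant_conditions"
  shows "cumulant_formula d"
proof (induction d rule: less_induct)
  case (less d)
  have ef: "L2E (right_action M \<Lambda> \<xi> (word x \<beta> j 0 d)) = \<Lambda> (conj_sum d \<beta> j)"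
    if \<beta>: "\<And>p. \<beta> p \<in> B" "\<beta> d = id_blinfun" and d: "0 < d" for \<beta> j
  proof -
    \<comment> \<open>Shifted by one: coefficient \<open>p - 1\<close> of the word stands to the
      left of variable \<open>p\<close>.\<close>
    define b where "b = (\<lambda>p. if p = 0 then id_blinfun else \<beta> (p - 1))"
    have b: "b p \<in> B" for p using \<beta> by (simp add: b_def B_closed)
    have eq: "(0, L2E (right_action M \<Lambda> \<xi> (word x (\<lambda>p. id_blinfun o\<^sub>L b (Suc p)) j 0 d))) =
      L2_kappa ((0, right_action M \<Lambda> \<xi> id_blinfun) # map (\<lambda>a. (a, 0)) (map (entry b (\<lambda>_. id_blinfun) j) [1..<Suc d]))
      + (0, if d < 2 then 0 else \<Lambda> (conj_sum d (\<lambda>p. id_blinfun o\<^sub>L b (Suc p)) j))"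
      by (rule moment_expansion) (use b less \<beta>(2) in \<open>auto simp: B_closed b_def\<close>)
    have \<beta>b: "(\<lambda>p. id_blinfun o\<^sub>L b (Suc p)) = \<beta>" by (simp add: b_def)
    have entries: "map (entry b (\<lambda>_. id_blinfun) j) [1..<Suc d] = map (\<lambda>k. b k o\<^sub>L x (j k)) [1..<Suc d]"
      by (rule map_cong) (auto simp: entry_def simp del: upt_Suc)
    have "snd (L2_kappa ((0, right_action M \<Lambda> \<xi> id_blinfun) #
        map (\<lambda>a. (a, 0)) (map (entry b (\<lambda>_. id_blinfun) j) [1..<Suc d])))
      = L2_cumulant M \<Lambda> E [] \<xi> (map (\<lambda>k. b k o\<^sub>L x (j k)) [1..<Suc d])"
      unfolding entries by (simp add: L2_cumulant_def right_action_id del: upt_Suc map_map)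
    then have main: "L2E (right_action M \<Lambda> \<xi> (word x \<beta> j 0 d)) =
        L2_cumulant M \<Lambda> E [] \<xi> (map (\<lambda>k. b k o\<^sub>L x (j k)) [1..<Suc d])
        + (if d < 2 then 0 else \<Lambda> (conj_sum d \<beta> j))"
      using arg_cong[OF eq, of snd] unfolding \<beta>b snd_add snd_conv by simp
    show ?thesis
    proof (cases "d = 1")
      case True
      have "L2_cumulant M \<Lambda> E [] \<xi> [b 1 o\<^sub>L x (j 1)] = \<Lambda> (\<eta>c i (j 1) (b 1))"
        using cond b unfolding cumulant_conditions_def by blast
      then show ?thesis
        using main conj_sum_1[of \<beta> j] \<beta> True by (simp add: b_def)
    next
      case False
      then have d2: "2 \<le> d" using d by simp
      then have "L2_cumulant M \<Lambda> E [] \<xi> (map (\<lambda>k. b k o\<^sub>L x (j k)) [1..<Suc d]) = 0"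
        using cond b unfolding cumulant_conditions_def by blast
      then show ?thesis using main d2 by simp
    qed
  qed
  have "expectation_formula d"
    unfolding expectation_formula_def
  proof (intro allI impI)
    fix b :: "nat \<Rightarrow> ('h \<Rightarrow>\<^sub>L 'h)" and j :: "nat \<Rightarrow> 'i" assume "\<forall>p. b p \<in> B"
    then have b: "b p \<in> B" for p by blast
    show "L2E (right_action M \<Lambda> \<xi> (word x b j 0 d)) = \<Lambda> (conj_sum d b j)"
    proof (cases "d = 0")
      \<comment> \<open>A word of order 0 has no variable to carry its coefficient, so this is
        attached to the vector; the condition on \<open>\<xi> b\<close> covers it.\<close>
      case True
      have "(0, L2E (right_action M \<Lambda> \<xi> (word x (\<lambda>p. b p o\<^sub>L id_blinfun) j 0 d))) =
        L2_kappa ((0, right_action M \<Lambda> \<xi> (b 0)) # map (\<lambda>a. (a, 0)) (map (entry (\<lambda>_. id_blinfun) b j) [1..<Suc d]))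
        + (0, if d < 2 then 0 else \<Lambda> (conj_sum d (\<lambda>p. b p o\<^sub>L id_blinfun) j))"
        by (rule moment_expansion) (use b less in \<open>auto simp: B_closed\<close>)
      then have "L2E (right_action M \<Lambda> \<xi> (b 0)) = L2_cumulant M \<Lambda> E [] (right_action M \<Lambda> \<xi> (b 0)) []"
        using True by (auto simp: L2_cumulant_def zero_prod_def[symmetric] dest: arg_cong[of _ _ snd])
      also have "\<dots> = 0" using cond b unfolding cumulant_conditions_def by blast
      finally show ?thesis using True by (simp add: conj_sum_def Lambda_zero)
    next
      case False
      define b' where "b' = b(d := id_blinfun)"
      have b': "b' p \<in> B" for p using b by (simp add: b'_def B_closed)
      have "word x b j 0 d = word x b' j 0 d o\<^sub>L b d"
        using word_update_right[of x b' 0 d "b d" j] by (simp add: b'_def)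
      then have "right_action M \<Lambda> \<xi> (word x b j 0 d)
          = right_action M \<Lambda> (right_action M \<Lambda> \<xi> (word x b' j 0 d)) (b d)"
        using word_M[of 0 d b' j] b' b B_M by (simp add: right_action_compose)
      then have "L2E (right_action M \<Lambda> \<xi> (word x b j 0 d))
          = right_action M \<Lambda> (\<Lambda> (conj_sum d b' j)) (b d)"
        using ef[of b' j] b' b False by (simp add: L2E_right b'_def)
      also have "\<dots> = \<Lambda> (conj_sum d b' j o\<^sub>L b d)"
        using conj_sum_B[of d b' j] b' b B_M by (simp add: right_action_Lambda)
      also have "conj_sum d b' j o\<^sub>L b d = conj_sum d b j"
        unfolding b'_def by (rule conj_sum_update_last[OF b])
      finally show ?thesis .
    qed
  qed
  then show ?case using cumulant_formula_iff_expectation_formula less.IH by blast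
qed

lemma conjugate_variable_iff_cumulant_conditions:
  "conjugate_variable B \<tau> \<Lambda> E \<eta>c x i \<xi> \<longleftrightarrow> cumulant_conditions"
  using conjugate_variable_iff_expectation_formula cumulant_formula_all_iff
    cumulant_conditions_if cumulant_formula_if by blast

end

theorem theoremC:
  fixes M B :: "('h::complex_hilbert_space \<Rightarrow>\<^sub>L 'h) set"
    and \<tau> :: "('h \<Rightarrow>\<^sub>L 'h) \<Rightarrow> complex"
    and \<Lambda> :: "('h \<Rightarrow>\<^sub>L 'h) \<Rightarrow> 'k::complex_hilbert_space"
    and E :: "('h \<Rightarrow>\<^sub>L 'h) \<Rightarrow> ('h \<Rightarrow>\<^sub>L 'h)"
    and x :: "'i::countable \<Rightarrow> ('h \<Rightarrow>\<^sub>L 'h)"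
    and \<eta> :: "('h \<Rightarrow>\<^sub>L 'h) \<Rightarrow> (('i, 'h) ell2 \<Rightarrow>\<^sub>L ('i, 'h) ell2)"
    and \<eta>c :: "'i \<Rightarrow> 'i \<Rightarrow> ('h \<Rightarrow>\<^sub>L 'h) \<Rightarrow> ('h \<Rightarrow>\<^sub>L 'h)"
    and i :: 'i
    and \<xi> :: 'k
  assumes "tracial_von_neumann_algebra M \<tau>"
    and "von_neumann_algebra B" and "B \<subseteq> M"
    and "\<And>j. x j \<in> M" and "\<And>j. adj (x j) = x j"
    and "M = commutant (commutant (star_algebra (B \<union> range x)))"
    and "GNS_space M \<tau> \<Lambda>"
    and "conditional_expectation M \<tau> B E"
    and "covariance_matrix B \<eta> \<eta>c" and "tau_symmetric B \<tau> \<eta>c"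
  shows "conjugate_variable B \<tau> \<Lambda> E \<eta>c x i \<xi> \<longleftrightarrow>
    (\<forall>b\<in>B. L2_cumulant M \<Lambda> E [] (right_action M \<Lambda> \<xi> b) [] = 0) \<and>
    (\<forall>b\<in>B. \<forall>j. L2_cumulant M \<Lambda> E [] \<xi> [b o\<^sub>L x j] = \<Lambda> (\<eta>c i j b)) \<and>
    (\<forall>d\<ge>2. \<forall>b j. (\<forall>k\<in>{1..d}. b k \<in> B) \<longrightarrow>
      L2_cumulant M \<Lambda> E [] \<xi> (map (\<lambda>k. b k o\<^sub>L x (j k)) [1..<Suc d]) = 0)"
proof -
  interpret tracial_GNS_expectation M \<tau> \<Lambda> B E
    by unfold_locales fact+
  interpret conjugate_setting M \<tau> \<Lambda> B E x \<eta>c i \<xi>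
  proof unfold_locales
    show "x j \<in> M" "adj (x j) = x j" for j by fact+
    show "\<eta>c i j (a + b) = \<eta>c i j a + \<eta>c i j b" if "a \<in> B" "b \<in> B" for a b j
      using assms(9) that by (simp add: covariance_matrix_def linear_on_ops_def)
    show "\<eta>c j j' b \<in> B" if "b \<in> B" for b j j'
      using assms(9) that by (simp add: covariance_matrix_def image_subset_iff)
    show "adj (\<eta>c j j' b) = \<eta>c j' j (adj b)" if "b \<in> B" for b j j'
      by (rule covariance_matrix_adj[OF B_vN assms(9) that])
    show "tau_symmetric B \<tau> \<eta>c" by fact
  qed
  show ?thesis
    using conjugate_variable_iff_cumulant_conditions unfolding cumulant_conditions_def .
qed

end
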